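(* Let $d\ge2$, $1<s\le d$, and $\varepsilon,\eta\in(0,s-1)$. For all sufficiently small dyadic scales $\delta=2^{-n}$ the following holds. Let $\mathcal P$ be a $(\delta,s,\delta^{-\eta})$-set of $\delta$-cubes in $[0,1]^d$. Let $A$ be an oracle relative to which $\mathcal P$, $\delta$, $s$, $\varepsilon$ and $\eta$ are computable. Then for every $e\in\mathcal S^{d-1}$ with $$K^A_n(e)\ge (d-1)n-2\varepsilon n,$$ there are $\gtrsim\delta^{-1+O(\varepsilon+\eta)}$ many dyadic intervals $I\subset\mathbb R$ of length $\delta$ for which $$\mathcal P_1:=\{Q\in\mathcal P : Q\cap p_e^{-1}I\ne\emptyset\}$$ contains a $(\delta,s-1,\delta^{-O(\varepsilon+\eta)})$-subset $\mathcal P_2$ with $|\mathcal P_2|\gtrsim\delta^{1+o(1)}|\mathcal P|$.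
   Context: A dyadic scale is $\delta=2^{-n}$, $n\in\mathbb N$. $\mathcal D_\delta(A)$ is the set of half-open dyadic cubes of side $\delta$ meeting $A$; $\mathcal D_\delta=\mathcal D_\delta(\mathbb R^d)$; $\delta$-cubes are elements of $\mathcal D_\delta$. A non-empty bounded set $A\subseteq\mathbb R^d$ is a $(\delta,s,c)$-set if for every integer $0\le m\le n$ and $Q\in\mathcal D_{2^{-m}}$, $|\mathcal D_\delta(A\cap Q)|\le c\,2^{-sm}|\mathcal D_\delta(A)|$; a family of $\delta$-cubes is a $(\delta,s,c)$-set if the union of its cubes is. $\mathcal S^{d-1}$ is the set of unit vectors in $\mathbb R^d$ and $p_e(x)=x\cdot e\in\mathbb R$ is orthogonal projection onto the line in direction $e$ (identified with $\mathbb R$). Kolmogorov complexity: an oracle is an infinite binary sequence. Fix a universal oracle prefix Turing machine $U$. $K^A(\sigma)$ is the least length of a program $\pi$ with $U^A(\pi)=\sigma$, for finite strings $\sigma$ (finite objects such as rational points are encoded as strings). For $x\in\mathbb R^k$, $K^A_n(x)=\min\{K^A(q):q\in\mathbb Q^k,\ |q-x|<2^{-n}\}$. "$\mathcal P$, $\delta$, ... are computable relative to $A$" means that these data are encoded in $A$, i.e. computed from $A$ by a fixed program not depending on the data. $X\gtrsim Y$ means $X\ge cY$ for a constant $c>0$; the constants in the $O(\cdot)$ terms do not depend on $\delta,\varepsilon,\eta,\mathcal P,A,e$, and $o(1)$ is a quantity tending to $0$ as $\delta\to0$ for fixed $d,s,\varepsilon,\eta$. *)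

theory Defs
  imports "HOL-Analysis.Analysis" "HOL-Library.Nat_Bijection" "HOL-Library.Sublist"
begin

section \<open>Dyadic cubes and \<open>(\<delta>, s, c)\<close>-sets\<close>

text \<open>A dyadic scale \<open>\<delta> = 2 ^ -n\<close> is always represented by its exponent \<open>n\<close>.\<close>

definition dyadic_scale :: "nat \<Rightarrow> real" where
  "dyadic_scale n = (1/2) ^ n"

definition dyadic_cube :: "nat \<Rightarrow> int^'d \<Rightarrow> (real^'d) set" where
  "dyadic_cube n k = {x. \<forall>i. of_int (k $ i) * dyadic_scale n \<le> x $ i
                           \<and> x $ i < (of_int (k $ i) + 1) * dyadic_scale n}"

definition dyadic_cubes :: "nat \<Rightarrow> (real^'d) set set" where
  "dyadic_cubes n = range (dyadic_cube n)"

definition dyadic_cubes_meeting :: "nat \<Rightarrow> (real^'d) set \<Rightarrow> (real^'d) set set" where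
  "dyadic_cubes_meeting n A = {Q \<in> dyadic_cubes n. Q \<inter> A \<noteq> {}}"

definition dyadic_intervals :: "nat \<Rightarrow> real set set" where
  "dyadic_intervals n =
     range (\<lambda>k::int. {of_int k * dyadic_scale n ..< (of_int k + 1) * dyadic_scale n})"

definition dsc_set :: "nat \<Rightarrow> real \<Rightarrow> real \<Rightarrow> (real^'d) set \<Rightarrow> bool" where
  "dsc_set n s c A \<longleftrightarrow> A \<noteq> {} \<and> bounded A \<and>
     (\<forall>m\<le>n. \<forall>Q\<in>dyadic_cubes m.
        real (card (dyadic_cubes_meeting n (A \<inter> Q)))
          \<le> c * 2 powr (- s * real m) * real (card (dyadic_cubes_meeting n A)))"

definition dsc_family :: "nat \<Rightarrow> real \<Rightarrow> real \<Rightarrow> (real^'d) set set \<Rightarrow> bool" where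
  "dsc_family n s c P \<longleftrightarrow> P \<subseteq> dyadic_cubes n \<and> dsc_set n s c (\<Union>P)"


section \<open>Turing machines with oracles\<close>

type_synonym oracle_seq = "nat \<Rightarrow> bool"

datatype dir = Lft | Stay | Rgt

text \<open>
  Multitape machines with one-way infinite tapes. Tape 0 is the input tape, tape 1 the read-only
  tape holding the binary sequence \<open>A\<close>, tape 2 the output tape; the remaining \<open>work_tapes M\<close> tapes are work tapes. States
  are the numbers below \<open>num_states M\<close>, with initial state 0 and halting state 1. Tape symbols
  are the numbers below \<open>num_symbols M\<close>; 0 is the blank, 1 and 2 stand for the two bits. The
  transition function maps the state and the list of scanned symbols to the new state, the list
  of symbols written and the list of head movements. It is relevant only on the finitely many
  arguments that satisfy the bounds in \<open>oracle_tm\<close> below.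
\<close>

record tm =
  work_tapes :: nat
  num_states :: nat
  num_symbols :: nat
  trans :: "nat \<Rightarrow> nat list \<Rightarrow> nat \<times> nat list \<times> dir list"

abbreviation num_tapes :: "tm \<Rightarrow> nat" where
  "num_tapes M \<equiv> 3 + work_tapes M"

definition oracle_tm :: "tm \<Rightarrow> bool" where
  "oracle_tm M \<longleftrightarrow> 2 \<le> num_states M \<and> 3 \<le> num_symbols M \<and>
     (\<forall>q<num_states M. \<forall>xs. length xs = num_tapes M \<and> set xs \<subseteq> {..<num_symbols M} \<longrightarrow>
        (case trans M q xs of (q', ws, ds) \<Rightarrow>
           q' < num_states M \<and> length ws = num_tapes M \<and> set ws \<subseteq> {..<num_symbols M} \<and>
           length ds = num_tapes M \<and> ws ! 1 = xs ! 1))"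

text \<open>A tape is its contents together with the head position.\<close>

type_synonym tape = "(nat \<Rightarrow> nat) \<times> nat"

type_synonym config = "nat \<times> tape list"

definition scan :: "tape \<Rightarrow> nat" where
  "scan t = fst t (snd t)"

text \<open>A left move in cell 0 leaves the head in cell 0 (truncated subtraction).\<close>

definition act :: "tape \<Rightarrow> nat \<Rightarrow> dir \<Rightarrow> tape" where
  "act t w d = ((fst t)(snd t := w),
                case d of Lft \<Rightarrow> snd t - 1 | Stay \<Rightarrow> snd t | Rgt \<Rightarrow> snd t + 1)"

definition tm_step :: "tm \<Rightarrow> config \<Rightarrow> config" where
  "tm_step M = (\<lambda>(q, ts). if q = 1 then (q, ts) else
     (case trans M q (map scan ts) of (q', ws, ds) \<Rightarrow>
        (q', map (\<lambda>(t, w, d). act t w d) (zip ts (zip ws ds)))))"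

definition bit_symbol :: "bool \<Rightarrow> nat" where
  "bit_symbol b = (if b then 2 else 1)"

definition tm_init :: "tm \<Rightarrow> oracle_seq \<Rightarrow> bool list \<Rightarrow> config" where
  "tm_init M A \<pi> =
     (0, [(\<lambda>i. if i < length \<pi> then bit_symbol (\<pi> ! i) else 0, 0),
          (\<lambda>i. bit_symbol (A i), 0)]
         @ replicate (1 + work_tapes M) (\<lambda>i. 0, 0))"

text \<open>\<open>tm_computes M A \<pi> \<sigma>\<close> says that \<open>M\<close> relative to \<open>A\<close> halts on input \<open>\<pi>\<close> and that
  the output tape then contains \<open>\<sigma>\<close> followed by a blank.\<close>

definition tm_computes :: "tm \<Rightarrow> oracle_seq \<Rightarrow> bool list \<Rightarrow> bool list \<Rightarrow> bool" where
  "tm_computes M A \<pi> \<sigma> \<longleftrightarrow>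
     (\<exists>t ts. (tm_step M ^^ t) (tm_init M A \<pi>) = (1, ts) \<and>
        (\<forall>i<length \<sigma>. fst (ts ! 2) i = bit_symbol (\<sigma> ! i)) \<and> fst (ts ! 2) (length \<sigma>) = 0)"

definition prefix_tm :: "tm \<Rightarrow> bool" where
  "prefix_tm M \<longleftrightarrow> oracle_tm M \<and>
     (\<forall>A \<pi> \<pi>' \<sigma> \<sigma>'. tm_computes M A \<pi> \<sigma> \<and> tm_computes M A \<pi>' \<sigma>' \<and> prefix \<pi> \<pi>' \<longrightarrow> \<pi> = \<pi>')"

text \<open>The simulating program \<open>\<rho>\<close> must not depend on \<open>A\<close>.\<close>

definition universal_prefix_tm :: "tm \<Rightarrow> bool" where
  "universal_prefix_tm U \<longleftrightarrow> prefix_tm U \<and>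
     (\<forall>M. prefix_tm M \<longrightarrow>
        (\<exists>\<rho>. \<forall>A \<pi> \<sigma>. tm_computes U A (\<rho> @ \<pi>) \<sigma> \<longleftrightarrow> tm_computes M A \<pi> \<sigma>))"


section \<open>Encoding of finite objects\<close>

text \<open>Finite objects are encoded as natural numbers by the pairing functions of
  \<open>HOL-Library.Nat_Bijection\<close>, and numbers as their binary digits, least significant first.\<close>

fun nat_string :: "nat \<Rightarrow> bool list" where
  "nat_string n = (if n = 0 then [] else odd n # nat_string (n div 2))"

declare nat_string.simps [simp del]

definition rat_code :: "rat \<Rightarrow> nat" where
  "rat_code q = prod_encode (int_encode (fst (quotient_of q)), int_encode (snd (quotient_of q)))"

text \<open>The class \<open>wellorder\<close> only serves to list the coordinates in a definite order.\<close>

definition vec_code :: "('a \<Rightarrow> nat) \<Rightarrow> 'a^'d::{finite,wellorder} \<Rightarrow> nat" where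
  "vec_code f v = list_encode (map (\<lambda>i. f (v $ i)) (sorted_list_of_set UNIV))"


section \<open>Kolmogorov complexity\<close>

text \<open>For universal \<open>U\<close> every string has a program, so the minima below exist.\<close>

definition kolm :: "tm \<Rightarrow> oracle_seq \<Rightarrow> bool list \<Rightarrow> nat" where
  "kolm U A \<sigma> = (LEAST l. \<exists>\<pi>. length \<pi> = l \<and> tm_computes U A \<pi> \<sigma>)"

definition kolm_rat :: "tm \<Rightarrow> oracle_seq \<Rightarrow> rat^'d::{finite,wellorder} \<Rightarrow> nat" where
  "kolm_rat U A q = kolm U A (nat_string (vec_code rat_code q))"

definition kolm_point :: "tm \<Rightarrow> oracle_seq \<Rightarrow> nat \<Rightarrow> real^'d::{finite,wellorder} \<Rightarrow> nat" where
  "kolm_point U A n x =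
     (LEAST l. \<exists>q. norm ((\<chi> i. of_rat (q $ i)) - x) < dyadic_scale n \<and> l = kolm_rat U A q)"


section \<open>Data encoded in oracles\<close>

text \<open>\<open>\<Phi>\<close> is the fixed decoding program. Its input is a pair of a tag, which names the datum that
  is asked for, and a precision, which matters only for the three real numbers.\<close>

definition tm_outputs_at :: "tm \<Rightarrow> oracle_seq \<Rightarrow> nat \<Rightarrow> nat \<Rightarrow> nat \<Rightarrow> bool" where
  "tm_outputs_at \<Phi> A tag k v \<longleftrightarrow>
     tm_computes \<Phi> A (nat_string (prod_encode (tag, k))) (nat_string v)"

definition computes_real :: "tm \<Rightarrow> oracle_seq \<Rightarrow> nat \<Rightarrow> real \<Rightarrow> bool" where
  "computes_real \<Phi> A tag x \<longleftrightarrow>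
     (\<forall>k. \<exists>q. tm_outputs_at \<Phi> A tag k (rat_code q) \<and> \<bar>of_rat q - x\<bar> < (1/2) ^ k)"

definition decodes_data ::
  "tm \<Rightarrow> oracle_seq \<Rightarrow> nat \<Rightarrow> (real^'d::{finite,wellorder}) set set \<Rightarrow> real \<Rightarrow> real \<Rightarrow> real \<Rightarrow> bool" where
  "decodes_data \<Phi> A n P s \<epsilon> \<eta> \<longleftrightarrow>
     tm_outputs_at \<Phi> A 0 0 n \<and>
     (\<exists>ks. tm_outputs_at \<Phi> A 1 0 (list_encode (map (vec_code int_encode) ks))
           \<and> P = dyadic_cube n ` set ks) \<and>
     computes_real \<Phi> A 2 s \<and> computes_real \<Phi> A 3 \<epsilon> \<and> computes_real \<Phi> A 4 \<eta>"

end

theory Submission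
  imports Defs "HOL-Real_Asymp.Real_Asymp"
begin

text \<open>Let \<open>K\<close> be the set of integer vectors that index the cubes of \<open>P\<close>. For a direction \<open>e\<close> and \<open>m \<le> n\<close>
let \<open>N_m(e)\<close> be the number of pairs of cubes of \<open>P\<close> that lie in one dyadic cube of side \<open>2 ^ -m\<close> and whose
corners project into one dyadic interval of length \<open>\<delta> = 2 ^ -n\<close>. Three facts combine.

First, suppose that \<open>N_m(e) \<le> \<delta> powr (1 - O(\<epsilon> + \<eta>)) * 2 powr (-(s - 1) * m) * |P|^2\<close> for every \<open>m\<close>. By
Markov's inequality only a minority of the cubes sits in a tube that is too full near that cube at some
scale. Once these are removed, every fibre that keeps an average share of \<open>P\<close> is a
\<open>(\<delta>, s - 1, \<delta> powr (-O(\<epsilon> + \<eta>)))\<close>-set, and since no fibre is larger than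
\<open>\<delta> powr (1 - O(\<epsilon> + \<eta>)) * |P|\<close>, there must be many of them (\<open>rich_tubes\<close>).

Second, few directions are bad, that is, violate one of these bounds. Two cubes at distance \<open>r\<close> project to
nearby points only for a proportion \<open>\<delta> / r\<close> of the directions, and the sum of \<open>\<delta> / r\<close> over the cubes in a
cell of side \<open>2 ^ -m\<close> is small by the \<open>(\<delta>, s, \<delta> powr (-\<eta>))\<close>-condition, because \<open>s > 1\<close>. So on a grid of mesh
about \<open>\<delta>\<close> there are at most \<open>2 powr ((d - 1) * n - 4 * \<epsilon> * n)\<close> bad directions, up to a factor polynomial
in \<open>n\<close> (\<open>bad_directions_card\<close>).

Third, the oracle yields the list of cubes, and from the list, from \<open>n\<close>, \<open>m\<close> and from the size \<open>2 ^ t\<close> of the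
violation one can enumerate the bad grid directions. A bad direction is therefore described by its index in
this enumeration together with \<open>n\<close>, \<open>m\<close>, \<open>t\<close> (\<open>decoder_selects\<close>, \<open>kolm_upper_bound\<close>), which takes fewer than
\<open>(d - 1) * n - 2 * \<epsilon> * n\<close> bits. So the directions of the theorem are not bad (\<open>few_bad_pairs\<close>).

The bound on the complexity needs a Turing machine that carries out the enumeration. Only the length of its
input counts, never its running time. The machine is therefore built in layers that favour simplicity:
structured programs whose atomic steps act on the scanned symbols, counters that are the head positions of
otherwise constant tapes, and programs on counters for all primitive recursive functions.\<close>

section \<open>Structured programs on tapes\<close>

text \<open>The atomic command \<open>Op f\<close> performs one machine step: from the symbols scanned on all tapes, \<open>f\<close> determines for
each tape the symbol to write and the head movement.\<close>

datatype com = Skip | Op "(nat \<Rightarrow> nat) \<Rightarrow> nat \<Rightarrow> nat \<times> dir" | Seq com com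
  | While "(nat \<Rightarrow> nat) \<Rightarrow> bool" com

type_synonym store = "nat \<Rightarrow> tape"

text \<open>The control state of the machine is the program that remains to be executed. It changes only according to
the scanned symbols, and it stays within the finite set of \<open>residuals\<close>, the counterpart of the partial
derivatives of a regular expression. This gives the finite set of states without any labels or jumps.\<close>

fun next_com :: "com \<Rightarrow> (nat \<Rightarrow> nat) \<Rightarrow> com" where
  "next_com Skip x = Skip"
| "next_com (Op f) x = Skip"
| "next_com (Seq c1 c2) x = (if c1 = Skip then c2 else Seq (next_com c1 x) c2)"
| "next_com (While b c) x = (if b x then Seq c (While b c) else Skip)"

fun com_action :: "com \<Rightarrow> (nat \<Rightarrow> nat) \<Rightarrow> nat \<Rightarrow> nat \<times> dir" where
  "com_action Skip x = (\<lambda>j. (x j, Stay))"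
| "com_action (Op f) x = f x"
| "com_action (Seq c1 c2) x = com_action c1 x"
| "com_action (While b c) x = (\<lambda>j. (x j, Stay))"

fun residuals :: "com \<Rightarrow> com set" where
  "residuals Skip = {Skip}"
| "residuals (Op f) = {Op f, Skip}"
| "residuals (Seq c1 c2) = (\<lambda>c. Seq c c2) ` residuals c1 \<union> residuals c2"
| "residuals (While b c) = {While b c, Skip} \<union> (\<lambda>c'. Seq c' (While b c)) ` residuals c"

lemma finite_residuals: "finite (residuals c)"
  by (induction c) auto

lemma self_in_residuals: "c \<in> residuals c"
  by (induction c) auto

lemma Skip_in_residuals: "Skip \<in> residuals c"
  by (induction c) auto

lemma residuals_closed: "c' \<in> residuals c \<Longrightarrow> next_com c' x \<in> residuals c"
  by (induction c arbitrary: c') (auto simp: self_in_residuals Skip_in_residuals split: if_splits)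

locale tapes =
  fixes nt ns :: nat
  assumes nt: "3 \<le> nt" and ns: "3 \<le> ns"
begin

definition seen :: "store \<Rightarrow> nat \<Rightarrow> nat" where
  "seen S j = (if j < nt then scan (S j) else 0)"

text \<open>Attempts to write on the read-only tape 1 or to write a symbol outside the alphabet leave the cell as it is. With
this convention every command is the program of a legal machine.\<close>

definition write_of :: "nat \<Rightarrow> nat \<Rightarrow> nat \<Rightarrow> nat" where
  "write_of j x w = (if j = 1 \<or> ns \<le> w then x else w)"

definition perform :: "((nat \<Rightarrow> nat) \<Rightarrow> nat \<Rightarrow> nat \<times> dir) \<Rightarrow> store \<Rightarrow> store" where
  "perform f S j = (if j < nt then
     act (S j) (write_of j (scan (S j)) (fst (f (seen S) j))) (snd (f (seen S) j)) else S j)"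

definition cstep :: "com \<times> store \<Rightarrow> com \<times> store" where
  "cstep = (\<lambda>(c, S). (next_com c (seen S), perform (com_action c) S))"

definition runs :: "com \<Rightarrow> store \<Rightarrow> store \<Rightarrow> bool" where
  "runs c S S' \<longleftrightarrow> (\<exists>t. (cstep ^^ t) (c, S) = (Skip, S'))"

lemma act_scan_Stay [simp]: "act t (scan t) Stay = t"
  by (simp add: act_def scan_def)

lemma write_of_same [simp]: "write_of j x x = x"
  by (simp add: write_of_def)

lemma perform_id: "(\<And>j. j < nt \<Longrightarrow> f (seen S) j = (seen S j, Stay)) \<Longrightarrow> perform f S = S"
  by (auto simp: perform_def seen_def)

lemma cstep_Skip [simp]: "cstep (Skip, S) = (Skip, S)"
  by (simp add: cstep_def perform_id)

lemma cstep_While: "cstep (While b c, S) = (if b (seen S) then Seq c (While b c) else Skip, S)"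
  by (simp add: cstep_def perform_id)

lemma cstep_Op: "cstep (Op f, S) = (Skip, perform f S)"
  by (simp add: cstep_def perform_def fun_eq_iff)

lemma cstep_Seq_Skip: "cstep (Seq Skip c, S) = (c, S)"
  by (simp add: cstep_def perform_id)

lemma cstep_Seq: "c1 \<noteq> Skip \<Longrightarrow>
    cstep (Seq c1 c2, S) = (Seq (fst (cstep (c1, S))) c2, snd (cstep (c1, S)))"
  by (simp add: cstep_def perform_def fun_eq_iff)

lemma cstep_pow_Skip [simp]: "(cstep ^^ t) (Skip, S) = (Skip, S)"
  by (induction t) auto

lemma runs_Skip_iff [simp]: "runs Skip S S' \<longleftrightarrow> S = S'"
  by (auto simp: runs_def)

lemma runs_step: "runs c S S' \<longleftrightarrow> (case cstep (c, S) of (c', S1) \<Rightarrow> runs c' S1 S')"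
proof -
  have "runs c S S'" if "(cstep ^^ t) (cstep (c, S)) = (Skip, S')" for t
    unfolding runs_def using that by (intro exI[of _ "Suc t"]) (simp add: funpow_swap1)
  moreover have "\<exists>t. (cstep ^^ t) (cstep (c, S)) = (Skip, S')" if "(cstep ^^ t) (c, S) = (Skip, S')" for t
    using that by (cases t) (auto simp: funpow_swap1 intro: exI[of _ 0] simp del: funpow.simps(1))
  ultimately show ?thesis by (auto simp: runs_def split: prod.splits)
qed

lemma runs_Op_iff [simp]: "runs (Op f) S S' \<longleftrightarrow> S' = perform f S"
  by (subst runs_step) (auto simp: cstep_Op)

lemma runs_While_iff: "runs (While b c) S S' \<longleftrightarrow>
    (if b (seen S) then runs (Seq c (While b c)) S S' else S = S')"
  by (subst runs_step) (auto simp: cstep_While)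

lemma runs_Seq_of_steps:
  assumes "(cstep ^^ t) (c1, S) = (Skip, S1)" "runs c2 S1 S2"
  shows "runs (Seq c1 c2) S S2"
  using assms
proof (induction t arbitrary: c1 S)
  case 0
  then show ?case by (subst runs_step) (simp add: cstep_Seq_Skip)
next
  case (Suc t)
  show ?case
  proof (cases "c1 = Skip")
    case True
    then show ?thesis using Suc.prems by (subst runs_step) (simp add: cstep_Seq_Skip)
  next
    case False
    obtain c' S' where *: "cstep (c1, S) = (c', S')" by fastforce
    have "(cstep ^^ t) (c', S') = (Skip, S1)"
      using Suc.prems(1) by (simp only: funpow_Suc_right o_apply *)
    then have "runs (Seq c' c2) S' S2" using Suc.IH Suc.prems(2) by blast
    then show ?thesis using False by (subst runs_step) (simp add: cstep_Seq *)
  qed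
qed

lemma steps_Seq_inversion:
  assumes "(cstep ^^ t) (Seq c1 c2, S) = (Skip, S2)"
  shows "\<exists>S1. runs c1 S S1 \<and> runs c2 S1 S2"
  using assms
proof (induction t arbitrary: c1 S)
  case (Suc t)
  show ?case
  proof (cases "c1 = Skip")
    case True
    then have "(cstep ^^ t) (c2, S) = (Skip, S2)"
      using Suc.prems by (simp only: funpow_Suc_right o_apply cstep_Seq_Skip)
    then show ?thesis using True by (auto simp: runs_def[of c2])
  next
    case False
    obtain c' S' where *: "cstep (c1, S) = (c', S')" by fastforce
    have "(cstep ^^ t) (Seq c' c2, S') = (Skip, S2)"
      using Suc.prems False by (simp add: funpow_Suc_right cstep_Seq * del: funpow.simps)
    then obtain S1 where "runs c' S' S1" "runs c2 S1 S2" using Suc.IH by blast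
    then show ?thesis by (subst runs_step) (auto simp: *)
  qed
qed simp

lemma runs_Seq_iff: "runs (Seq c1 c2) S S2 \<longleftrightarrow> (\<exists>S1. runs c1 S S1 \<and> runs c2 S1 S2)"
  by (metis runs_Seq_of_steps steps_Seq_inversion runs_def)

lemma runs_deterministic:
  assumes "runs c S S1" "runs c S S2" shows "S1 = S2"
proof -
  obtain t1 t2 where t: "(cstep ^^ t1) (c, S) = (Skip, S1)" "(cstep ^^ t2) (c, S) = (Skip, S2)"
    using assms by (auto simp: runs_def)
  have "(cstep ^^ (t2 + t1)) (c, S) = (Skip, S1)" "(cstep ^^ (t1 + t2)) (c, S) = (Skip, S2)"
    by (simp_all add: funpow_add t)
  then show ?thesis by (simp add: add.commute)
qed

lemma runs_While_False: "\<not> b (seen S) \<Longrightarrow> runs (While b c) S S"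
  by (simp add: runs_While_iff)

lemma runs_While_True:
  "b (seen S) \<Longrightarrow> runs c S S1 \<Longrightarrow> runs (While b c) S1 S2 \<Longrightarrow> runs (While b c) S S2"
  by (subst runs_While_iff) (auto simp: runs_Seq_iff)

text \<open>A loop with empty body diverges as soon as it is entered. It serves to reject inputs.\<close>

lemma runs_While_Skip_iff: "runs (While b Skip) S S' \<longleftrightarrow> \<not> b (seen S) \<and> S' = S"
proof -
  have "\<not> b (seen S)" if "(cstep ^^ t) (While b Skip, S) = (Skip, S')" for t
    using that
  proof (induction t rule: less_induct)
    case (less t)
    show ?case
    proof
      assume b: "b (seen S)"
      show False
      proof (cases t)
        case 0 then show ?thesis using less.prems by simp
      next
        case (Suc t1)
        then have 1: "(cstep ^^ t1) (Seq Skip (While b Skip), S) = (Skip, S')"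
          using less.prems b by (simp only: funpow_Suc_right o_apply cstep_While if_True)
        then obtain t2 where t2: "t1 = Suc t2" by (cases t1) auto
        have "(cstep ^^ t2) (While b Skip, S) = (Skip, S')"
          using 1 unfolding t2 by (simp only: funpow_Suc_right o_apply cstep_Seq_Skip)
        then show False using less.IH[of t2] b Suc t2 by simp
      qed
    qed
  qed
  then show ?thesis by (metis runs_def runs_While_iff)
qed

definition list_view :: "nat list \<Rightarrow> nat \<Rightarrow> nat" where
  "list_view xs j = (if j < nt then xs ! j else 0)"

definition init_store :: "oracle_seq \<Rightarrow> bool list \<Rightarrow> store" where
  "init_store A \<pi> j =
     (if j = 0 then (\<lambda>i. if i < length \<pi> then bit_symbol (\<pi> ! i) else 0, 0)
      else if j = 1 then (\<lambda>i. bit_symbol (A i), 0) else (\<lambda>i. 0, 0))"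

text \<open>The residual programs are numbered such that the whole program is the initial state 0 and \<open>Skip\<close> the halting
state 1, which is why the program must not be \<open>Skip\<close>.\<close>

theorem com_to_tm:
  assumes c0: "c0 \<noteq> Skip"
  shows "\<exists>M. oracle_tm M \<and> (\<forall>A \<pi> \<sigma>. tm_computes M A \<pi> \<sigma> \<longleftrightarrow>
     (\<exists>S. runs c0 (init_store A \<pi>) S \<and>
        (\<forall>i<length \<sigma>. fst (S 2) i = bit_symbol (\<sigma> ! i)) \<and> fst (S 2) (length \<sigma>) = 0))"
proof -
  obtain h :: "com \<Rightarrow> nat" and N where hN: "h ` residuals c0 = {i. i < N}" "inj_on h (residuals c0)"
    using finite_imp_inj_to_nat_seg[OF finite_residuals[of c0]] by blast
  define enc where "enc c = (if c = c0 then 0 else if c = Skip then 1 else 2 + h c)" for c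
  define dec where "dec = inv_into (residuals c0) enc"
  have inj: "inj_on enc (residuals c0)"
    using hN(2) by (auto simp: inj_on_def enc_def)
  have dec_enc [simp]: "dec (enc c) = c" if "c \<in> residuals c0" for c
    using inj that by (simp add: dec_def)
  have enc_less: "enc c < N + 2" if "c \<in> residuals c0" for c
    using that hN(1) by (auto simp: enc_def)
  have enc_1: "enc c = 1 \<longleftrightarrow> c = Skip" if "c \<in> residuals c0" for c
    using c0 by (auto simp: enc_def)
  define M where "M = \<lparr>work_tapes = nt - 3, num_states = N + 2, num_symbols = ns,
     trans = (\<lambda>q xs. if q \<in> enc ` residuals c0 then
        (enc (next_com (dec q) (list_view xs)),
         map (\<lambda>j. write_of j (xs ! j) (fst (com_action (dec q) (list_view xs) j))) [0..<nt],
         map (\<lambda>j. snd (com_action (dec q) (list_view xs) j)) [0..<nt])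
       else (1, xs, replicate nt Stay))\<rparr>"
  have tapes_M: "num_tapes M = nt" using nt by (simp add: M_def)
  have otm: "oracle_tm M"
    unfolding oracle_tm_def tapes_M
  proof (intro conjI allI impI)
    show "2 \<le> num_states M" "3 \<le> num_symbols M" using ns by (auto simp: M_def)
    fix q xs assume xs: "length xs = nt \<and> set xs \<subseteq> {..<num_symbols M}"
    have sym: "xs ! j < ns" if "j < nt" for j
    proof -
      have "num_symbols M = ns" by (simp add: M_def)
      then show ?thesis using xs that nth_mem[of j xs] by (metis lessThan_iff subsetD)
    qed
    show "case trans M q xs of (q', ws, ds) \<Rightarrow> q' < num_states M \<and> length ws = nt \<and>
        set ws \<subseteq> {..<num_symbols M} \<and> length ds = nt \<and> ws ! 1 = xs ! 1"
    proof (cases "q \<in> enc ` residuals c0")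
      case True
      then obtain c where c: "c \<in> residuals c0" "q = enc c" by blast
      have "write_of j (xs ! j) w < ns" if "j < nt" for j w
        using sym[OF that] by (simp add: write_of_def)
      then show ?thesis
        using xs nt c enc_less[OF residuals_closed[OF c(1)]]
        by (auto simp: M_def write_of_def[of "Suc 0"])
    next
      case False
      then show ?thesis using xs by (simp add: M_def)
    qed
  qed
  define tp where "tp S = map (S :: store) [0..<nt]" for S
  have step: "tm_step M (enc c, tp S) = (case cstep (c, S) of (c', S') \<Rightarrow> (enc c', tp S'))"
    if c: "c \<in> residuals c0" for c S
  proof (cases "c = Skip")
    case True
    then show ?thesis using enc_1[OF c] by (simp add: tm_step_def)
  next
    case False
    have v: "list_view (map scan (tp S)) = seen S"
      by (auto simp: list_view_def seen_def tp_def)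
    have "map (\<lambda>(t, w, d). act t w d) (zip (tp S) (zip
           (map (\<lambda>j. write_of j (map scan (tp S) ! j) (fst (com_action c (seen S) j))) [0..<nt])
           (map (\<lambda>j. snd (com_action c (seen S) j)) [0..<nt]))) = tp (perform (com_action c) S)"
      by (rule nth_equalityI) (auto simp: tp_def perform_def)
    then show ?thesis using False c v enc_1[OF c] by (simp add: tm_step_def M_def cstep_def)
  qed
  have steps: "(tm_step M ^^ t) (enc c0, tp S) = (case (cstep ^^ t) (c0, S) of (c', S') \<Rightarrow> (enc c', tp S'))
       \<and> fst ((cstep ^^ t) (c0, S)) \<in> residuals c0" for t S
  proof (induction t)
    case 0 then show ?case by (simp add: self_in_residuals)
  next
    case (Suc t)
    obtain c' S' where *: "(cstep ^^ t) (c0, S) = (c', S')" by fastforce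
    have c': "c' \<in> residuals c0" using Suc.IH by (simp add: *)
    have "fst (cstep (c', S')) \<in> residuals c0"
      using residuals_closed[OF c'] by (simp add: cstep_def)
    then show ?case using Suc.IH step[OF c', of S'] by (simp add: *)
  qed
  have init: "tm_init M A \<pi> = (enc c0, tp (init_store A \<pi>))" for A \<pi>
  proof -
    have "snd (tm_init M A \<pi>) = tp (init_store A \<pi>)"
    proof (rule nth_equalityI)
      show "length (snd (tm_init M A \<pi>)) = length (tp (init_store A \<pi>))"
        using nt by (simp add: tm_init_def tp_def M_def)
      fix i assume "i < length (snd (tm_init M A \<pi>))"
      then show "snd (tm_init M A \<pi>) ! i = tp (init_store A \<pi>) ! i"
        using nt by (auto simp: tm_init_def tp_def M_def init_store_def nth_append nth_Cons' simp del: replicate_Suc)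
    qed
    then show ?thesis by (simp add: tm_init_def enc_def)
  qed
  have "tm_computes M A \<pi> \<sigma> \<longleftrightarrow>
     (\<exists>S. runs c0 (init_store A \<pi>) S \<and>
        (\<forall>i<length \<sigma>. fst (S 2) i = bit_symbol (\<sigma> ! i)) \<and> fst (S 2) (length \<sigma>) = 0)" (is "?L = ?R") for A \<pi> \<sigma>
  proof -
    have two: "tp S ! 2 = S 2" for S using nt by (simp add: tp_def numeral_2_eq_2)
    show ?thesis
    proof
      assume ?L
      then obtain t ts where t: "(tm_step M ^^ t) (tm_init M A \<pi>) = (1, ts)"
        and o: "\<forall>i<length \<sigma>. fst (ts ! 2) i = bit_symbol (\<sigma> ! i)" "fst (ts ! 2) (length \<sigma>) = 0"
        by (auto simp: tm_computes_def)
      obtain c' S' where *: "(cstep ^^ t) (c0, init_store A \<pi>) = (c', S')" by fastforce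
      have "c' = Skip" "ts = tp S'"
        using steps[of t "init_store A \<pi>"] t enc_1[of c'] by (auto simp: init *)
      then show ?R using * o by (auto simp: runs_def two)
    next
      assume ?R
      then obtain t S where *: "(cstep ^^ t) (c0, init_store A \<pi>) = (Skip, S)"
        and o: "\<forall>i<length \<sigma>. fst (S 2) i = bit_symbol (\<sigma> ! i)" "fst (S 2) (length \<sigma>) = 0"
        by (auto simp: runs_def)
      have "(tm_step M ^^ t) (tm_init M A \<pi>) = (1, tp S)"
        using steps[of t "init_store A \<pi>"] enc_1[of Skip] by (simp add: init * Skip_in_residuals)
      then show ?L
        unfolding tm_computes_def by (intro exI[of _ t] exI[of _ "tp S"]) (use o in \<open>simp add: two\<close>)
    qed
  qed
  then show ?thesis using otm by blast
qed

end

section \<open>Counter programs for primitive recursive functions\<close>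

datatype cprog = CSkip | Inc nat | Dec nat | CSeq cprog cprog | Loop nat cprog

inductive crun :: "cprog \<Rightarrow> (nat \<Rightarrow> nat) \<Rightarrow> (nat \<Rightarrow> nat) \<Rightarrow> bool" where
  crun_CSkip: "crun CSkip r r"
| crun_Inc: "crun (Inc i) r (r(i := Suc (r i)))"
| crun_Dec: "crun (Dec i) r (r(i := r i - 1))"
| crun_CSeq: "crun c1 r r1 \<Longrightarrow> crun c2 r1 r2 \<Longrightarrow> crun (CSeq c1 c2) r r2"
| crun_Loop_0: "r i = 0 \<Longrightarrow> crun (Loop i c) r r"
| crun_Loop_Suc: "r i > 0 \<Longrightarrow> crun c r r1 \<Longrightarrow> crun (Loop i c) r1 r2 \<Longrightarrow> crun (Loop i c) r r2"

definition move :: "nat \<Rightarrow> nat \<Rightarrow> cprog" where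
  "move i j = Loop i (CSeq (Dec i) (Inc j))"

lemma crun_move:
  assumes "i \<noteq> j"
  shows "crun (move i j) r (r(i := 0, j := r j + r i))"
proof (induction "r i" arbitrary: r)
  case 0
  have "r(i := 0, j := r j + r i) = r" using 0 by (auto simp: fun_eq_iff)
  then show ?case using 0 unfolding move_def by (metis crun_Loop_0)
next
  case (Suc x)
  have dec: "r i - Suc 0 = x" using Suc.hyps(2) by simp
  let ?r = "r(i := x, j := Suc (r j))"
  have "crun (move i j) ?r (?r(i := 0, j := ?r j + ?r i))"
    using Suc.hyps(1)[of ?r] assms by simp
  also have "?r(i := 0, j := ?r j + ?r i) = r(i := 0, j := r j + r i)"
    using assms Suc.hyps(2) by (auto simp: fun_eq_iff)
  finally have 1: "crun (Loop i (CSeq (Dec i) (Inc j))) ?r (r(i := 0, j := r j + r i))"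
    by (simp only: move_def)
  have "crun (Dec i) r (r(i := x))" using crun_Dec[of i r] by (simp add: dec)
  moreover have "crun (Inc j) (r(i := x)) ?r"
    using crun_Inc[of j "r(i := x)"] assms by simp
  ultimately have "crun (CSeq (Dec i) (Inc j)) r ?r"
    by (blast intro: crun_CSeq)
  moreover have "0 < r i" using Suc.hyps(2) by simp
  ultimately show ?case unfolding move_def using 1 by (blast intro: crun_Loop_Suc)
qed

lemma crun_clear: "crun (Loop i (Dec i)) r (r(i := 0))"
proof (induction "r i" arbitrary: r)
  case 0
  then have "r(i := 0) = r" by (auto simp: fun_eq_iff)
  then show ?case using 0 by (simp add: crun_Loop_0)
next
  case (Suc x)
  have dec: "r i - Suc 0 = x" using Suc.hyps(2) by simp
  let ?r = "r(i := x)"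
  have "crun (Loop i (Dec i)) ?r (r(i := 0))" using Suc.hyps(1)[of ?r] by simp
  moreover have "crun (Dec i) r ?r" using crun_Dec[of i r] by (simp add: dec)
  moreover have "0 < r i" using Suc.hyps(2) by simp
  ultimately show ?case by (blast intro: crun_Loop_Suc)
qed

definition duplicate :: "nat \<Rightarrow> nat \<Rightarrow> nat \<Rightarrow> cprog" where
  "duplicate i j k = Loop i (CSeq (Dec i) (CSeq (Inc j) (Inc k)))"

lemma crun_duplicate:
  assumes "i \<noteq> j" "i \<noteq> k" "j \<noteq> k"
  shows "crun (duplicate i j k) r (r(i := 0, j := r j + r i, k := r k + r i))"
proof (induction "r i" arbitrary: r)
  case 0
  have "r(i := 0, j := r j + r i, k := r k + r i) = r" using 0 by (auto simp: fun_eq_iff)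
  then show ?case using 0 unfolding duplicate_def by (metis crun_Loop_0)
next
  case (Suc x)
  have dec: "r i - Suc 0 = x" using Suc.hyps(2) by simp
  let ?r = "r(i := x, j := Suc (r j), k := Suc (r k))"
  have "crun (duplicate i j k) ?r (?r(i := 0, j := ?r j + ?r i, k := ?r k + ?r i))"
    using Suc.hyps(1)[of ?r] assms by simp
  also have "?r(i := 0, j := ?r j + ?r i, k := ?r k + ?r i) = r(i := 0, j := r j + r i, k := r k + r i)"
    using assms Suc.hyps(2) by (auto simp: fun_eq_iff)
  finally have 1: "crun (Loop i (CSeq (Dec i) (CSeq (Inc j) (Inc k)))) ?r (r(i := 0, j := r j + r i, k := r k + r i))"
    by (simp only: duplicate_def)
  have "crun (Dec i) r (r(i := x))" using crun_Dec[of i r] by (simp add: dec)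
  moreover have "crun (Inc j) (r(i := x)) (r(i := x, j := Suc (r j)))"
    using crun_Inc[of j "r(i := x)"] assms by simp
  moreover have "crun (Inc k) (r(i := x, j := Suc (r j))) ?r"
    using crun_Inc[of k "r(i := x, j := Suc (r j))"] assms by simp
  ultimately have "crun (CSeq (Dec i) (CSeq (Inc j) (Inc k))) r ?r"
    by (blast intro: crun_CSeq)
  moreover have "0 < r i" using Suc.hyps(2) by simp
  ultimately show ?case unfolding duplicate_def using 1 by (blast intro: crun_Loop_Suc)
qed

text \<open>Primitive recursion with a descending index. A counter program that counts \<open>n\<close> down to 0 meets the indices in
this order and thus can use its loop counter as the index.\<close>

fun down :: "(nat \<Rightarrow> nat \<Rightarrow> nat) \<Rightarrow> nat \<Rightarrow> nat \<Rightarrow> nat" where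
  "down b 0 r = r"
| "down b (Suc n) r = down b n (b n r)"

text \<open>The primitive recursive functions of an environment \<open>\<rho>\<close> of variables, which are numbered by de Bruijn indices. The body
of a recursion sees the accumulator as variable 0, the index as variable 1 and the surrounding variables
shifted by 2. In this form the rules apply by unification to functions written as ordinary terms.\<close>

inductive prec :: "((nat \<Rightarrow> nat) \<Rightarrow> nat) \<Rightarrow> bool" where
  prec_var: "prec (\<lambda>\<rho>. \<rho> i)"
| prec_0: "prec (\<lambda>\<rho>. 0)"
| prec_Suc: "prec f \<Longrightarrow> prec (\<lambda>\<rho>. Suc (f \<rho>))"
| prec_down: "prec n \<Longrightarrow> prec z \<Longrightarrow> prec (\<lambda>\<sigma>. b (\<sigma> 0) (\<sigma> 1) (\<lambda>i. \<sigma> (i + 2))) \<Longrightarrow>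
    prec (\<lambda>\<rho>. down (\<lambda>c r. b r c \<rho>) (n \<rho>) (z \<rho>))"

text \<open>Register \<open>D - 1 - i\<close> holds variable \<open>i\<close>, so that entering the body of a recursion adds registers at the top. Above
the \<open>D\<close> variables there are \<open>E\<close> registers of workspace, which are 0; registers further up are
arbitrary and are preserved.\<close>

definition layout :: "nat \<Rightarrow> nat \<Rightarrow> (nat \<Rightarrow> nat) \<Rightarrow> (nat \<Rightarrow> nat) \<Rightarrow> bool" where
  "layout D E \<rho> r \<longleftrightarrow> (\<forall>i\<ge>D. \<rho> i = 0) \<and> (\<forall>j<D. r j = \<rho> (D - 1 - j)) \<and>
     (\<forall>j. D \<le> j \<and> j < D + E \<longrightarrow> r j = 0)"

definition computes_at :: "nat \<Rightarrow> nat \<Rightarrow> cprog \<Rightarrow> ((nat \<Rightarrow> nat) \<Rightarrow> nat) \<Rightarrow> bool" where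
  "computes_at D E p f \<longleftrightarrow> (\<forall>\<rho> r. layout D E \<rho> r \<longrightarrow> crun p r (r(D := f \<rho>)))"

lemma layout_mono: "layout D E \<rho> r \<Longrightarrow> E' \<le> E \<Longrightarrow> layout D E' \<rho> r"
  by (auto simp: layout_def)

text \<open>The program leaves the value in register \<open>D\<close> and restores all others. In a recursion, the start value is parked in
register \<open>G\<close>, out of reach of the program for the number of rounds.\<close>

lemma prec_compile: "prec f \<Longrightarrow> \<exists>p E. computes_at D E p f"
proof (induction arbitrary: D rule: prec.induct)
  case (prec_var i)
  show ?case
  proof (cases "i < D")
    case True
    define s where "s = D - 1 - i"
    have s: "s < D" "D - 1 - s = i" using True by (simp_all add: s_def)
    have "computes_at D 2 (CSeq (duplicate s D (Suc D)) (move (Suc D) s)) (\<lambda>\<rho>. \<rho> i)"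
      unfolding computes_at_def
    proof (intro allI impI)
      fix \<rho> r assume l: "layout D 2 \<rho> r"
      have v: "r s = \<rho> i" "r D = 0" "r (Suc D) = 0"
        using l s unfolding layout_def by (metis, simp_all)
      let ?r = "r(s := 0, D := r D + r s, Suc D := r (Suc D) + r s)"
      have "crun (duplicate s D (Suc D)) r ?r" using s(1) by (intro crun_duplicate) linarith+
      moreover have "crun (move (Suc D) s) ?r (?r(Suc D := 0, s := ?r s + ?r (Suc D)))"
        using s(1) by (intro crun_move) linarith
      moreover have "?r(Suc D := 0, s := ?r s + ?r (Suc D)) = r(D := \<rho> i)"
      proof
        fix j
        have "s \<noteq> D" "s \<noteq> Suc D" using s(1) by linarith+
        then show "(?r(Suc D := 0, s := ?r s + ?r (Suc D))) j = (r(D := \<rho> i)) j"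
          using v by (cases "j = s"; cases "j = D"; cases "j = Suc D") (simp_all del: diff_diff_left)
      qed
      ultimately show "crun (CSeq (duplicate s D (Suc D)) (move (Suc D) s)) r (r(D := \<rho> i))"
        by (metis crun_CSeq)
    qed
    then show ?thesis by blast
  next
    case False
    have "computes_at D 1 CSkip (\<lambda>\<rho>. \<rho> i)"
      unfolding computes_at_def
    proof (intro allI impI)
      fix \<rho> r assume "layout D 1 \<rho> r"
      then have "r(D := \<rho> i) = r" using False by (auto simp: layout_def fun_eq_iff)
      then show "crun CSkip r (r(D := \<rho> i))" by (simp add: crun_CSkip)
    qed
    then show ?thesis by blast
  qed
next
  case prec_0
  have "computes_at D 1 CSkip (\<lambda>\<rho>. 0)"
    unfolding computes_at_def
  proof (intro allI impI)
    fix \<rho> r assume "layout D 1 \<rho> r"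
    then have "r(D := 0) = r" by (auto simp: layout_def fun_eq_iff)
    then show "crun CSkip r (r(D := 0))" by (simp add: crun_CSkip)
  qed
  then show ?case by blast
next
  case (prec_Suc f)
  then obtain p E where p: "computes_at D E p f" by blast
  have "computes_at D E (CSeq p (Inc D)) (\<lambda>\<rho>. Suc (f \<rho>))"
    unfolding computes_at_def
  proof (intro allI impI)
    fix \<rho> r assume "layout D E \<rho> r"
    then have "crun p r (r(D := f \<rho>))" using p by (auto simp: computes_at_def)
    then show "crun (CSeq p (Inc D)) r (r(D := Suc (f \<rho>)))"
      using crun_CSeq[OF _ crun_Inc[of D "r(D := f \<rho>)"]] by simp
  qed
  then show ?case by blast
next
  case (prec_down n z b)
  obtain pn En where pn: "computes_at D En pn n" using prec_down.IH(1) by blast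
  obtain pz Ez where pz: "computes_at D Ez pz z" using prec_down.IH(2) by blast
  obtain pb Eb where pb: "computes_at (D + 2) Eb pb (\<lambda>\<sigma>. b (\<sigma> 0) (\<sigma> 1) (\<lambda>i. \<sigma> (i + 2)))"
    using prec_down.IH(3) by blast
  define G where "G = D + En + Ez + Eb + 3"
  define E where "E = En + Ez + Eb + 4"
  define body where "body = CSeq (Dec D) (CSeq pb (CSeq (Loop (D + 1) (Dec (D + 1))) (move (D + 2) (D + 1))))"
  define prog where "prog = CSeq pz (CSeq (move D G) (CSeq pn (CSeq (move G (D + 1))
     (CSeq (Loop D body) (move (D + 1) D)))))"
  have "computes_at D E prog (\<lambda>\<rho>. down (\<lambda>c r. b r c \<rho>) (n \<rho>) (z \<rho>))"
    unfolding computes_at_def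
  proof (intro allI impI)
    fix \<rho> r assume l: "layout D E \<rho> r"
    have zero: "r j = 0" if "D \<le> j" "j < D + E" for j using l that by (auto simp: layout_def)
    define r0 where "r0 c x = r(D := c, D + 1 := x)" for c x
    have loop: "crun (Loop D body) (r0 c x) (r0 0 (down (\<lambda>c r. b r c \<rho>) c x))" for c x
    proof (induction c arbitrary: x)
      case 0
      show ?case by (simp add: crun_Loop_0 r0_def)
    next
      case (Suc c)
      let ?\<rho> = "\<lambda>i. if i = 0 then x else if i = 1 then c else \<rho> (i - 2)"
      let ?y = "b x c \<rho>"
      have lay: "layout (D + 2) Eb ?\<rho> (r0 c x)"
        using l unfolding layout_def r0_def E_def
        by (auto simp: less_Suc_eq numeral_2_eq_2 intro: arg_cong[where f = \<rho>])
      have 1: "crun (Dec D) (r0 (Suc c) x) (r0 c x)"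
        using crun_Dec[of D "r0 (Suc c) x"] by (simp add: r0_def fun_upd_twist)
      have 2: "crun pb (r0 c x) ((r0 c x)(D + 2 := ?y))"
        using pb[unfolded computes_at_def, rule_format, OF lay] by simp
      have 3: "crun (Loop (D + 1) (Dec (D + 1))) ((r0 c x)(D + 2 := ?y)) ((r0 c 0)(D + 2 := ?y))"
      proof -
        have "((r0 c x)(D + 2 := ?y))(D + 1 := 0) = (r0 c 0)(D + 2 := ?y)"
          by (auto simp: r0_def fun_eq_iff)
        then show ?thesis by (metis crun_clear)
      qed
      have 4: "crun (move (D + 2) (D + 1)) ((r0 c 0)(D + 2 := ?y)) (r0 c ?y)"
      proof -
        let ?q = "(r0 c 0)(D + 2 := ?y)"
        have "?q(D + 2 := 0, D + 1 := ?q (D + 1) + ?q (D + 2)) = r0 c ?y"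
          using zero[of "D + 2"] by (auto simp: r0_def fun_eq_iff E_def)
        then show ?thesis using crun_move[of "D + 2" "D + 1" ?q] by simp
      qed
      have "crun body (r0 (Suc c) x) (r0 c ?y)"
        unfolding body_def using 1 2 3 4 by (blast intro: crun_CSeq)
      moreover have "r0 (Suc c) x D > 0" by (simp add: r0_def)
      ultimately show ?case using Suc.IH[of ?y] by (auto intro: crun_Loop_Suc)
    qed
    have 1: "crun pz r (r(D := z \<rho>))"
      using pz layout_mono[OF l, of Ez] by (auto simp: computes_at_def E_def)
    have 2: "crun (move D G) (r(D := z \<rho>)) (r(G := z \<rho>))"
    proof -
      let ?q = "r(D := z \<rho>)"
      have "?q(D := 0, G := ?q G + ?q D) = r(G := z \<rho>)"
        using zero[of D] zero[of G] by (auto simp: fun_eq_iff E_def G_def)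
      then show ?thesis using crun_move[of D G ?q] by (simp add: G_def)
    qed
    have 3: "crun pn (r(G := z \<rho>)) (r(G := z \<rho>, D := n \<rho>))"
    proof -
      have "layout D En \<rho> (r(G := z \<rho>))" using l by (auto simp: layout_def E_def G_def)
      then show ?thesis using pn by (auto simp: computes_at_def)
    qed
    have 4: "crun (move G (D + 1)) (r(G := z \<rho>, D := n \<rho>)) (r0 (n \<rho>) (z \<rho>))"
    proof -
      let ?q = "r(G := z \<rho>, D := n \<rho>)"
      have "?q(G := 0, D + 1 := ?q (D + 1) + ?q G) = r0 (n \<rho>) (z \<rho>)"
        using zero[of "D + 1"] zero[of G] by (auto simp: fun_eq_iff E_def G_def r0_def)
      then show ?thesis using crun_move[of G "D + 1" ?q] by (simp add: G_def)
    qed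
    let ?v = "down (\<lambda>c r. b r c \<rho>) (n \<rho>) (z \<rho>)"
    have 5: "crun (move (D + 1) D) (r0 0 ?v) (r(D := ?v))"
    proof -
      let ?q = "r0 0 ?v"
      have "?q(D + 1 := 0, D := ?q D + ?q (D + 1)) = r(D := ?v)"
        using zero[of "D + 1"] by (auto simp: fun_eq_iff E_def r0_def)
      then show ?thesis using crun_move[of "D + 1" D ?q] by simp
    qed
    show "crun prog r (r(D := ?v))"
      unfolding prog_def using 1 2 3 4 loop 5 by (blast intro: crun_CSeq)
  qed
  then show ?case by blast
qed

section \<open>Primitive recursive arithmetic\<close>

named_theorems prec_intros
declare prec_var [prec_intros] prec_0 [prec_intros] prec_Suc [prec_intros] prec_down [prec_intros]

lemma prec_const [prec_intros]: "prec (\<lambda>\<rho>. k)"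
  by (induction k) (auto intro: prec_intros)

text \<open>Renaming and substitution of variables are derived by induction on the construction of the function. They
yield the closure under composition with functions of several arguments.\<close>

lemma prec_rename: "prec f \<Longrightarrow> prec (\<lambda>\<sigma>. f (\<lambda>i. \<sigma> (h i)))"
proof (induction arbitrary: h rule: prec.induct)
  case (prec_down n z b)
  have "prec (\<lambda>\<sigma>. b (\<sigma> 0) (\<sigma> 1) (\<lambda>i. \<sigma> (h i + 2)))"
    using prec_down.IH(3)[of "\<lambda>i. if i = 0 then 0 else if i = 1 then 1 else h (i - 2) + 2"] by simp
  then show ?case
    using prec.prec_down[OF prec_down.IH(1)[of h] prec_down.IH(2)[of h],
        of "\<lambda>r c \<rho>. b r c (\<lambda>i. \<rho> (h i))"] by simp
qed (auto intro: prec_intros)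

lemma prec_comp: "prec f \<Longrightarrow> (\<And>i. prec (g i)) \<Longrightarrow> prec (\<lambda>\<rho>. f (\<lambda>i. g i \<rho>))"
proof (induction arbitrary: g rule: prec.induct)
  case (prec_down n z b)
  let ?g = "\<lambda>i \<sigma>. if i = 0 then \<sigma> 0 else if i = 1 then \<sigma> 1 else g (i - 2) (\<lambda>i. \<sigma> (i + 2)) :: nat"
  have "prec (?g i)" for i
  proof (cases "i = 0 \<or> i = 1")
    case True
    then show ?thesis by (auto intro: prec_intros)
  next
    case False
    then show ?thesis using prec_rename[OF prec_down.prems[of "i - 2"], of "\<lambda>i. i + 2"] by simp
  qed
  from prec_down.IH(3)[of ?g, OF this]
  have "prec (\<lambda>\<sigma>. b (\<sigma> 0) (\<sigma> 1) (\<lambda>i. g i (\<lambda>i. \<sigma> (i + 2))))" by simp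
  then show ?case
    using prec.prec_down[OF prec_down.IH(1)[of g] prec_down.IH(2)[of g],
        of "\<lambda>r c \<rho>. b r c (\<lambda>i. g i \<rho>)"] prec_down.prems by simp
qed (auto intro: prec_intros)

lemma prec_comp1:
  "prec (\<lambda>\<sigma>. F (\<sigma> 0)) \<Longrightarrow> prec f \<Longrightarrow> prec (\<lambda>\<rho>. F (f \<rho>))"
  using prec_comp[of "\<lambda>\<sigma>. F (\<sigma> 0)" "\<lambda>_. f"] by simp

lemma prec_comp2:
  "prec (\<lambda>\<sigma>. F (\<sigma> 0) (\<sigma> 1)) \<Longrightarrow> prec f \<Longrightarrow> prec g \<Longrightarrow> prec (\<lambda>\<rho>. F (f \<rho>) (g \<rho>))"
  using prec_comp[of "\<lambda>\<sigma>. F (\<sigma> 0) (\<sigma> 1)" "\<lambda>i. if i = 0 then f else g"] by simp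

lemma down_funpow: "down (\<lambda>c r. f r) n z = (f ^^ n) z"
  by (induction n arbitrary: z) (simp_all add: funpow_swap1)

lemma down_sum: "down (\<lambda>c r. r + f c) n z = z + (\<Sum>i<n. f i)"
  by (induction n arbitrary: z) (simp_all add: add_ac)

lemma prec_funpow [prec_intros]:
  assumes "prec n" "prec z" "prec (\<lambda>\<sigma>. f (\<sigma> 0) (\<lambda>i. \<sigma> (i + 2)))"
  shows "prec (\<lambda>\<rho>. ((\<lambda>r. f r \<rho>) ^^ n \<rho>) (z \<rho>))"
  using prec_down[OF assms(1,2), of "\<lambda>r c \<rho>. f r \<rho>"] assms(3) by (simp add: down_funpow)

lemma funpow_Suc: "(Suc ^^ n) m = m + n"
  by (induction n) auto

lemma prec_add [prec_intros]:
  assumes "prec f" "prec g" shows "prec (\<lambda>\<rho>. f \<rho> + g \<rho>)"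
  using prec_funpow[OF assms(2,1), of "\<lambda>r _. Suc r", OF prec_Suc[OF prec_var]]
  by (simp add: funpow_Suc add.commute)

lemma prec_sum [prec_intros]:
  assumes "prec n" "prec (\<lambda>\<sigma>. f (\<sigma> 1) (\<lambda>i. \<sigma> (i + 2)))"
  shows "prec (\<lambda>\<rho>. \<Sum>i<n \<rho>. f i \<rho>)"
  using prec_down[OF assms(1) prec_0, of "\<lambda>r c \<rho>. r + f c \<rho>", OF prec_add[OF prec_var assms(2)]]
  by (simp add: down_sum)

lemma prec_mult [prec_intros]:
  assumes "prec f" "prec g" shows "prec (\<lambda>\<rho>. f \<rho> * g \<rho>)"
  using prec_sum[OF assms(1), of "\<lambda>i. g"] prec_rename[OF assms(2)] by simp

text \<open>The predecessor of \<open>n\<close> is the number of nonzero indices below \<open>n\<close>; whether an index \<open>c\<close> is nonzero is told by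
iterating a constant function \<open>c\<close> times from 0.\<close>

lemma prec_diff [prec_intros]:
  assumes "prec f" "prec g" shows "prec (\<lambda>\<rho>. f \<rho> - g \<rho>)"
proof -
  have pos: "((\<lambda>_::nat. 1) ^^ c) 0 = (if c = 0 then 0 else 1 :: nat)" for c :: nat
    by (cases c) auto
  have "(\<Sum>c<n. if c = 0 then 0 else 1) = n - (1::nat)" for n :: nat
    by (induction n) auto
  then have "(\<Sum>c<n. ((\<lambda>_::nat. 1) ^^ c) 0) = n - (1::nat)" for n
    by (simp only: pos)
  moreover have "prec (\<lambda>\<rho>. \<Sum>c<\<rho> 0. ((\<lambda>_::nat. 1) ^^ c) 0)" by (intro prec_intros)
  ultimately have "prec (\<lambda>\<rho>. \<rho> 0 - 1)" by simp
  then have "prec (\<lambda>\<rho>. ((\<lambda>r. r - 1) ^^ g \<rho>) (f \<rho>))" using assms by (intro prec_intros)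
  moreover have "((\<lambda>r. r - 1) ^^ n) m = m - n" for m n :: nat
    by (induction n) auto
  ultimately show ?thesis by simp
qed

text \<open>Predicates are treated through their characteristic functions with values 0 and 1.\<close>

abbreviation decidable :: "((nat \<Rightarrow> nat) \<Rightarrow> bool) \<Rightarrow> bool" where
  "decidable P \<equiv> prec (\<lambda>\<rho>. of_bool (P \<rho>))"

lemma decidable_le [prec_intros]: "prec f \<Longrightarrow> prec g \<Longrightarrow> decidable (\<lambda>\<rho>. f \<rho> \<le> g \<rho>)"
proof -
  have "of_bool (x \<le> y) = 1 - (x - y)" for x y :: nat by auto
  then show "prec f \<Longrightarrow> prec g \<Longrightarrow> decidable (\<lambda>\<rho>. f \<rho> \<le> g \<rho>)"
    by (simp only:) (intro prec_intros)
qed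

lemma decidable_conj [prec_intros]: "decidable P \<Longrightarrow> decidable Q \<Longrightarrow> decidable (\<lambda>\<rho>. P \<rho> \<and> Q \<rho>)"
  by (simp only: of_bool_conj) (intro prec_intros)

lemma decidable_not [prec_intros]:
  assumes "decidable P" shows "decidable (\<lambda>\<rho>. \<not> P \<rho>)"
proof -
  have "of_bool (\<not> p) = 1 - (of_bool p :: nat)" for p by simp
  then show ?thesis using assms by (simp only:) (intro prec_intros)
qed

lemma decidable_eq [prec_intros]: "prec f \<Longrightarrow> prec g \<Longrightarrow> decidable (\<lambda>\<rho>. f \<rho> = g \<rho>)"
  unfolding order.eq_iff by (intro prec_intros)

lemma decidable_less [prec_intros]: "prec f \<Longrightarrow> prec g \<Longrightarrow> decidable (\<lambda>\<rho>. f \<rho> < g \<rho>)"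
  unfolding less_le_not_le by (intro prec_intros)

lemma decidable_ex [prec_intros]:
  assumes "prec n" "decidable (\<lambda>\<sigma>. P (\<sigma> 1) (\<lambda>i. \<sigma> (i + 2)))"
  shows "decidable (\<lambda>\<rho>. \<exists>i<n \<rho>. P i \<rho>)"
proof -
  have "(\<exists>i<n. Q i) \<longleftrightarrow> 1 \<le> (\<Sum>i<n. of_bool (Q i) :: nat)" for n and Q :: "nat \<Rightarrow> bool"
  proof -
    have "1 \<le> (\<Sum>i<n. of_bool (Q i) :: nat) \<longleftrightarrow> (\<Sum>i<n. of_bool (Q i) :: nat) \<noteq> 0"
      by linarith
    then show ?thesis by (simp only: sum_eq_0_iff finite_lessThan) auto
  qed
  then show ?thesis using assms by (simp only:) (intro prec_intros)
qed

lemma decidable_all [prec_intros]: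
  assumes "prec n" "decidable (\<lambda>\<sigma>. P (\<sigma> 1) (\<lambda>i. \<sigma> (i + 2)))"
  shows "decidable (\<lambda>\<rho>. \<forall>i<n \<rho>. P i \<rho>)"
proof -
  have "(\<forall>i<n. Q i) \<longleftrightarrow> \<not> (\<exists>i<n. \<not> Q i)" for n :: nat and Q by auto
  then show ?thesis using assms by (simp only:) (intro prec_intros)
qed

text \<open>The quotient counts the positive multiples of \<open>y\<close> up to \<open>x\<close>; the factor accounts for division by 0.\<close>

lemma prec_div [prec_intros]:
  assumes "prec f" "prec g" shows "prec (\<lambda>\<rho>. f \<rho> div g \<rho>)"
proof -
  have "x div y = of_bool (0 < y) * (\<Sum>i<x. of_bool (Suc i * y \<le> x))" for x y :: nat
  proof (cases "y = 0")
    case False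
    have "(\<Sum>i<x. of_bool (Suc i * y \<le> x) :: nat) = card ({..<x} \<inter> {i. Suc i * y \<le> x})"
      by (simp del: mult_Suc)
    also have "{..<x} \<inter> {i. Suc i * y \<le> x} = {..<x div y}"
    proof (intro set_eqI iffI)
      fix i assume "i \<in> {..<x} \<inter> {i. Suc i * y \<le> x}"
      then have "Suc i * y div y \<le> x div y" by (intro div_le_mono) auto
      then show "i \<in> {..<x div y}" using False by simp
    next
      fix i assume i: "i \<in> {..<x div y}"
      then have "Suc i \<le> x div y" by simp
      then have "Suc i * y \<le> x" using False
        by (metis div_times_less_eq_dividend le_trans mult_le_mono1)
      moreover have "Suc i \<le> x" using \<open>Suc i \<le> x div y\<close> div_le_dividend le_trans by blast
      ultimately show "i \<in> {..<x} \<inter> {i. Suc i * y \<le> x}" by simp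
    qed
    finally show ?thesis using False by simp
  qed simp
  moreover have "prec (\<lambda>\<sigma>. of_bool (0 < \<sigma> 1) * (\<Sum>i<\<sigma> 0. of_bool (Suc i * \<sigma> 1 \<le> \<sigma> 0)))"
    by (intro prec_intros)
  ultimately have "prec (\<lambda>\<sigma>. \<sigma> 0 div \<sigma> 1)" by simp
  from prec_comp2[OF this assms] show ?thesis .
qed

lemma prec_mod [prec_intros]:
  assumes "prec f" "prec g" shows "prec (\<lambda>\<rho>. f \<rho> mod g \<rho>)"
  unfolding modulo_nat_def using assms by (intro prec_intros)

lemma prec_power [prec_intros]:
  assumes "prec f" "prec g" shows "prec (\<lambda>\<rho>. f \<rho> ^ g \<rho>)"
proof -
  have "((\<lambda>r. r * x) ^^ n) 1 = x ^ n" for x n :: nat by (induction n) auto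
  moreover have "prec (\<lambda>\<sigma>. ((\<lambda>r. r * \<sigma> 0) ^^ \<sigma> 1) 1)" by (intro prec_intros)
  ultimately have "prec (\<lambda>\<sigma>. \<sigma> 0 ^ \<sigma> 1)" by simp
  from prec_comp2[OF this assms] show ?thesis .
qed

lemma prec_if [prec_intros]:
  assumes "decidable P" "prec f" "prec g" shows "prec (\<lambda>\<rho>. if P \<rho> then f \<rho> else g \<rho>)"
proof -
  have "(if p then x else y) = of_bool p * x + (1 - of_bool p) * y" for p and x y :: nat by simp
  then show ?thesis using assms by (simp only:) (intro prec_intros)
qed

lemma prec_prod_encode [prec_intros]:
  assumes "prec f" "prec g" shows "prec (\<lambda>\<rho>. prod_encode (f \<rho>, g \<rho>))"
proof -
  have "prec (\<lambda>\<sigma>. prod_encode (\<sigma> 0, \<sigma> 1))"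
    unfolding prod_encode_def triangle_def prod.case by (intro prec_intros)
  from prec_comp2[OF this assms] show ?thesis .
qed

text \<open>A search for the unique solution of \<open>P\<close> below \<open>n\<close> written as a sum, hence as a primitive recursive expression.\<close>

lemma sum_pick: "x < n \<Longrightarrow> (\<And>i. i < n \<Longrightarrow> P i \<longleftrightarrow> i = x) \<Longrightarrow> (\<Sum>i<n. of_bool (P i) * i) = (x :: nat)"
proof -
  assume a: "x < n" "\<And>i. i < n \<Longrightarrow> P i \<longleftrightarrow> i = x"
  have "(\<Sum>i<n. of_bool (P i) * i) = (\<Sum>i<n. if i = x then i else 0)"
    by (rule sum.cong) (auto simp: a(2))
  then show ?thesis using a(1) by simp
qed

lemma prec_fst_decode [prec_intros]:
  assumes "prec f" shows "prec (\<lambda>\<rho>. fst (prod_decode (f \<rho>)))"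
proof -
  have "fst (prod_decode w) = (\<Sum>a<Suc w. of_bool (\<exists>b<Suc w. prod_encode (a, b) = w) * a)" for w
  proof (rule sum_pick[symmetric])
    obtain a b where ab: "prod_decode w = (a, b)" by fastforce
    then have w: "w = prod_encode (a, b)" by (metis prod_decode_inverse)
    then show "fst (prod_decode w) < Suc w" using ab le_prod_encode_1 by (simp add: less_Suc_eq_le)
    fix i show "(\<exists>b<Suc w. prod_encode (i, b) = w) = (i = fst (prod_decode w))"
      using ab w le_prod_encode_2[of b a] by (auto simp: less_Suc_eq_le)
  qed
  moreover have "prec (\<lambda>\<rho>. \<Sum>a<Suc (\<rho> 0). of_bool (\<exists>b<Suc (\<rho> 0). prod_encode (a, b) = \<rho> 0) * a)"
    by (intro prec_intros)
  ultimately have "prec (\<lambda>\<sigma>. fst (prod_decode (\<sigma> 0)))" by simp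
  from prec_comp1[OF this assms] show ?thesis .
qed

lemma prec_snd_decode [prec_intros]:
  assumes "prec f" shows "prec (\<lambda>\<rho>. snd (prod_decode (f \<rho>)))"
proof -
  have "snd (prod_decode w) = (\<Sum>b<Suc w. of_bool (\<exists>a<Suc w. prod_encode (a, b) = w) * b)" for w
  proof (rule sum_pick[symmetric])
    obtain a b where ab: "prod_decode w = (a, b)" by fastforce
    then have w: "w = prod_encode (a, b)" by (metis prod_decode_inverse)
    then show "snd (prod_decode w) < Suc w" using ab le_prod_encode_2 by (simp add: less_Suc_eq_le)
    fix i show "(\<exists>a<Suc w. prod_encode (a, i) = w) = (i = snd (prod_decode w))"
      using ab w le_prod_encode_1[of a b] by (auto simp: less_Suc_eq_le)
  qed
  moreover have "prec (\<lambda>\<rho>. \<Sum>b<Suc (\<rho> 0). of_bool (\<exists>a<Suc (\<rho> 0). prod_encode (a, b) = \<rho> 0) * b)"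
    by (intro prec_intros)
  ultimately have "prec (\<lambda>\<sigma>. snd (prod_decode (\<sigma> 0)))" by simp
  from prec_comp1[OF this assms] show ?thesis .
qed

text \<open>Access to an element of a coded list: removing the head of a list takes one \<open>prod_decode\<close>.\<close>

definition code_nth :: "nat \<Rightarrow> nat \<Rightarrow> nat" where
  "code_nth v i = fst (prod_decode (((\<lambda>w. snd (prod_decode (w - 1))) ^^ i) v - 1))"

lemma funpow_drop_list_encode:
  "i \<le> length xs \<Longrightarrow> ((\<lambda>w. snd (prod_decode (w - 1))) ^^ i) (list_encode xs) = list_encode (drop i xs)"
proof (induction i)
  case (Suc i)
  then have "drop i xs = xs ! i # drop (Suc i) xs" by (simp add: Cons_nth_drop_Suc)
  then show ?case using Suc by simp
qed simp

lemma code_nth_list_encode: "i < length xs \<Longrightarrow> code_nth (list_encode xs) i = xs ! i"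
proof -
  assume i: "i < length xs"
  then have "drop i xs = xs ! i # drop (Suc i) xs" by (simp add: Cons_nth_drop_Suc)
  then show ?thesis using i by (simp only: code_nth_def funpow_drop_list_encode less_imp_le) simp
qed

lemma prec_code_nth [prec_intros]:
  assumes "prec f" "prec g" shows "prec (\<lambda>\<rho>. code_nth (f \<rho>) (g \<rho>))"
proof -
  have "prec (\<lambda>\<sigma>. code_nth (\<sigma> 0) (\<sigma> 1))"
    unfolding code_nth_def by (intro prec_intros)
  from prec_comp2[OF this assms] show ?thesis .
qed

section \<open>The machine\<close>

primrec cregs :: "cprog \<Rightarrow> nat set" where
  "cregs CSkip = {}"
| "cregs (Inc i) = {i}"
| "cregs (Dec i) = {i}"
| "cregs (CSeq c1 c2) = cregs c1 \<union> cregs c2"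
| "cregs (Loop i c) = insert i (cregs c)"

lemma finite_cregs: "finite (cregs p)"
  by (induction p) auto

definition shift :: "nat \<Rightarrow> dir \<Rightarrow> (nat \<Rightarrow> nat) \<Rightarrow> nat \<Rightarrow> nat \<times> dir" where
  "shift j d x k = (x k, if k = j then d else Stay)"

text \<open>Counter \<open>i\<close> is the head position on tape \<open>bt + i\<close>. This tape never changes: it carries the symbol 1 in cell 0 and
is blank elsewhere, so that the scanned symbol tells whether the counter is 0. A left move in cell 0
matches the truncated decrement.\<close>

primrec tape_com :: "nat \<Rightarrow> cprog \<Rightarrow> com" where
  "tape_com bt CSkip = Skip"
| "tape_com bt (Inc i) = Op (shift (bt + i) Rgt)"
| "tape_com bt (Dec i) = Op (shift (bt + i) Lft)"
| "tape_com bt (CSeq c1 c2) = Seq (tape_com bt c1) (tape_com bt c2)"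
| "tape_com bt (Loop i c) = While (\<lambda>x. x (bt + i) = 0) (tape_com bt c)"

definition double :: "nat \<Rightarrow> nat \<Rightarrow> nat \<Rightarrow> cprog" where
  "double a b c = CSeq (duplicate a b c) (CSeq (move b a) (move c a))"

lemma crun_double:
  assumes "a \<noteq> b" "a \<noteq> c" "b \<noteq> c" "r b = 0" "r c = 0"
  shows "crun (double a b c) r (r(a := 2 * r a))"
proof -
  let ?r1 = "r(a := 0, b := r b + r a, c := r c + r a)"
  let ?r2 = "?r1(b := 0, a := ?r1 a + ?r1 b)"
  have "crun (duplicate a b c) r ?r1" using assms by (intro crun_duplicate) auto
  moreover have "crun (move b a) ?r1 ?r2" using assms by (intro crun_move) auto
  moreover have "crun (move c a) ?r2 (r(a := 2 * r a))"
  proof -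
    have "?r2(c := 0, a := ?r2 a + ?r2 c) = r(a := 2 * r a)"
    proof
      fix j
      show "(?r2(c := 0, a := ?r2 a + ?r2 c)) j = (r(a := 2 * r a)) j"
        using assms by (cases "j = a"; cases "j = b"; cases "j = c") simp_all
    qed
    then show ?thesis using crun_move[of c a ?r2] assms(2) by metis
  qed
  ultimately show ?thesis unfolding double_def by (blast intro: crun_CSeq)
qed

lemma cregs_double: "cregs (double a b c) = {a, b, c}"
  by (auto simp: double_def duplicate_def move_def)

text \<open>The number with the given binary digits, least significant first.\<close>

definition bit_value :: "bool list \<Rightarrow> nat" where
  "bit_value bs = foldr (\<lambda>b a. of_bool b + 2 * a) bs 0"

lemma bit_value_Nil [simp]: "bit_value [] = 0"
  and bit_value_Cons [simp]: "bit_value (b # bs) = of_bool b + 2 * bit_value bs"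
  by (simp_all add: bit_value_def)

lemma bit_value_snoc: "bit_value (bs @ [b]) = bit_value bs + of_bool b * 2 ^ length bs"
  by (induction bs) (auto simp: algebra_simps)

lemma bit_value_nat_string: "bit_value (nat_string n) = n"
proof (induction n rule: nat_string.induct)
  case (1 n)
  show ?case
  proof (cases "n = 0")
    case True then show ?thesis by (simp add: nat_string.simps)
  next
    case False
    then have "bit_value (nat_string n) = of_bool (odd n) + 2 * (n div 2)"
      using 1 by (simp add: nat_string.simps[of n])
    then show ?thesis by (simp only: of_bool_odd_eq_mod_2 mod_mult_div_eq)
  qed
qed

text \<open>Binary input is read with the most significant bit first. The start value 1 of \<open>input_number\<close> acts as a leading
marker that preserves the length of the input.\<close>

abbreviation push_bits :: "nat \<Rightarrow> bool list \<Rightarrow> nat" where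
  "push_bits \<equiv> foldl (\<lambda>u b. 2 * u + of_bool b)"

definition input_number :: "bool list \<Rightarrow> nat" where
  "input_number \<pi> = push_bits 1 \<pi>"

definition append_bits :: "tape \<Rightarrow> bool list \<Rightarrow> tape" where
  "append_bits t \<sigma> = (\<lambda>i. if snd t \<le> i \<and> i < snd t + length \<sigma> then bit_symbol (\<sigma> ! (i - snd t))
     else fst t i, snd t + length \<sigma>)"

lemma append_bits_Nil: "append_bits t [] = t"
  by (auto simp: append_bits_def prod_eq_iff)

lemma append_bits_Cons:
  "append_bits t (b # \<sigma>) = append_bits ((fst t)(snd t := bit_symbol b), Suc (snd t)) \<sigma>"
  by (auto simp: append_bits_def fun_eq_iff nth_Cons' le_Suc_eq)

text \<open>Tapes 0, 1 and 2 are the input, oracle and output tape. Tapes 3 and 4 serve as the input and output tape of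
the decoding machine \<open>\<Phi>\<close>, tape 5 holds its state as the single symbol in cell 0, its work tapes follow from
tape 6 on, and the tapes from \<open>bt\<close> on are the counters. The oracle tape is shared with \<open>\<Phi>\<close>. The
alphabet provides two copies of the symbols of \<open>\<Phi>\<close>: those from \<open>g\<close> on mark cell 0 of tape 4, where the head must be
able to find its way back after the simulation.\<close>

locale counter_machine = tapes nt ns for nt ns +
  fixes \<Phi> :: tm and bt :: nat
  assumes \<Phi>: "oracle_tm \<Phi>" and bt: "bt = 6 + work_tapes \<Phi>" and bt_nt: "bt + 5 \<le> nt"
    and ns_eq: "ns = 2 * num_symbols \<Phi> + num_states \<Phi>"
begin

abbreviation g :: nat where "g \<equiv> num_symbols \<Phi>"

lemma bt6: "6 \<le> bt" and bt_work: "i < work_tapes \<Phi> \<Longrightarrow> 6 + i < bt"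
  by (simp_all add: bt)

lemma ns_ge: "2 * g \<le> ns" "num_states \<Phi> \<le> ns"
  by (simp_all add: ns_eq)

lemma g3: "3 \<le> g" using \<Phi> by (simp add: oracle_tm_def)

definition conc :: "store \<Rightarrow> (nat \<Rightarrow> nat) \<Rightarrow> store" where
  "conc S r j = (if bt \<le> j \<and> j < nt then (\<lambda>i. if i = 0 then 1 else 0, r (j - bt)) else S j)"

lemma seen_counter: "i < nt - bt \<Longrightarrow> seen (conc S r) (bt + i) = (if r i = 0 then 1 else 0)"
  by (auto simp: seen_def conc_def scan_def)

lemma seen_tape: "j < bt \<Longrightarrow> seen (conc S r) j = scan (S j)"
  using bt_nt by (auto simp: seen_def conc_def)

lemma conc_tape: "j < bt \<Longrightarrow> conc S r j = S j"
  by (simp add: conc_def)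

lemma act_move: "act t (scan t) Rgt = (fst t, snd t + 1)" "act t (scan t) Lft = (fst t, snd t - 1)"
  by (simp_all add: act_def scan_def)

text \<open>To check one step on a store with counters: the symbols on the counter tapes have to stay, and the head
movements there have to match the change of the counters.\<close>

lemma performI:
  assumes "\<And>j. j < bt \<Longrightarrow> act (S j) (write_of j (scan (S j)) (fst (f (seen (conc S r)) j)))
      (snd (f (seen (conc S r)) j)) = S' j"
    and "\<And>i. i < nt - bt \<Longrightarrow> fst (f (seen (conc S r)) (bt + i)) = seen (conc S r) (bt + i)"
    and "\<And>i. i < nt - bt \<Longrightarrow> r' i = (case snd (f (seen (conc S r)) (bt + i)) of
            Lft \<Rightarrow> r i - 1 | Stay \<Rightarrow> r i | Rgt \<Rightarrow> r i + 1)"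
    and "\<And>j. nt \<le> j \<Longrightarrow> S' j = S j"
  shows "perform f (conc S r) = conc S' r'"
proof
  fix j
  consider "j < bt" | "bt \<le> j" "j < nt" | "nt \<le> j" by linarith
  then show "perform f (conc S r) j = conc S' r' j"
  proof cases
    case 1
    then show ?thesis using assms(1)[of j] bt_nt by (simp add: perform_def conc_tape)
  next
    case 2
    define i where "i = j - bt"
    have i: "j = bt + i" "i < nt - bt" using 2 by (auto simp: i_def)
    have s: "seen (conc S r) (bt + i) = scan (conc S r (bt + i))" using i by (simp add: seen_def)
    obtain w d where f: "f (seen (conc S r)) (bt + i) = (w, d)" by fastforce
    have "w = scan (conc S r (bt + i))" using assms(2)[OF i(2)] s f by simp
    then have "perform f (conc S r) j = act (conc S r (bt + i)) (scan (conc S r (bt + i))) d"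
      using i 2 by (simp add: perform_def f)
    also have "\<dots> = conc S' r' j"
      using assms(3)[OF i(2)] i f by (cases d) (auto simp: act_move conc_def)
    finally show ?thesis .
  next
    case 3
    then show ?thesis using assms(4)[of j] bt_nt by (simp add: perform_def conc_def)
  qed
qed

lemma perform_shift_counter:
  assumes "i < nt - bt"
  shows "perform (shift (bt + i) Rgt) (conc S r) = conc S (r(i := Suc (r i)))"
    and "perform (shift (bt + i) Lft) (conc S r) = conc S (r(i := r i - 1))"
  using assms bt_nt by (auto intro!: performI simp: shift_def seen_tape)

lemma runs_tape_com:
  assumes "crun p r r'" "cregs p \<subseteq> {..<nt - bt}"
  shows "runs (tape_com bt p) (conc S r) (conc S r')"
  using assms
proof (induction rule: crun.induct)
  case (crun_CSeq c1 r r1 c2 r2)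
  then show ?case by (auto simp: runs_Seq_iff)
next
  case (crun_Loop_0 r i c)
  then show ?case by (auto intro!: runs_While_False simp: seen_counter)
next
  case (crun_Loop_Suc r i c r1 r2)
  then have "runs (tape_com bt c) (conc S r) (conc S r1)"
    "runs (While (\<lambda>x. x (bt + i) = 0) (tape_com bt c)) (conc S r1) (conc S r2)"
    "seen (conc S r) (bt + i) = 0"
    by (simp_all add: seen_counter)
  then show ?case using runs_While_True[of "\<lambda>x. x (bt + i) = 0"] by simp
qed (simp_all add: perform_shift_counter)

text \<open>The two initial steps mark the counter tapes and tape 4, and write the bits of 2 on tape 3. This is the code of tag 1 and precision 0, the
query for the list of cubes.\<close>

definition init1 :: "(nat \<Rightarrow> nat) \<Rightarrow> nat \<Rightarrow> nat \<times> dir" where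
  "init1 x k = (if k = 3 then (1, Rgt) else if k = 4 then (g, Stay)
     else if bt \<le> k then (1, Stay) else (x k, Stay))"

definition init2 :: "(nat \<Rightarrow> nat) \<Rightarrow> nat \<Rightarrow> nat \<times> dir" where
  "init2 x k = (if k = 3 then (2, Lft) else (x k, Stay))"

definition start_store :: "oracle_seq \<Rightarrow> bool list \<Rightarrow> store" where
  "start_store A \<pi> = (init_store A \<pi>)(3 := (\<lambda>i. if i = 0 then 1 else if i = 1 then 2 else 0, 0),
     4 := (\<lambda>i. if i = 0 then g else 0, 0))"

lemma runs_init: "runs (Seq (Op init1) (Op init2)) (init_store A \<pi>) (conc (start_store A \<pi>) (\<lambda>_. 0))"
proof -
  have "perform init2 (perform init1 (init_store A \<pi>)) j = conc (start_store A \<pi>) (\<lambda>_. 0) j" for j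
  proof -
    consider "j = 3" | "j = 4" | "bt \<le> j" "j < nt" | "j < bt" "j \<noteq> 3" "j \<noteq> 4" | "nt \<le> j"
      by linarith
    then show ?thesis
    proof cases
      case 1
      then show ?thesis using ns_ge g3 bt6 bt_nt
        by (simp add: perform_def init1_def init2_def start_store_def conc_def init_store_def
            act_def write_of_def fun_eq_iff)
    next
      case 2
      then show ?thesis using ns_ge g3 bt6 bt_nt
        by (simp add: perform_def init1_def init2_def start_store_def conc_def init_store_def
            act_def write_of_def fun_eq_iff seen_def scan_def)
    next
      case 3
      then show ?thesis using ns_ge g3 bt6 bt_nt
        by (simp add: perform_def init1_def init2_def start_store_def conc_def init_store_def
            act_def write_of_def fun_eq_iff seen_def scan_def)
    next
      case 4
      then show ?thesis using bt_nt
        by (simp add: perform_def init1_def init2_def start_store_def conc_def seen_def)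
    next
      case 5
      then show ?thesis using bt6 bt_nt by (simp add: perform_def start_store_def conc_def)
    qed
  qed
  then show ?thesis by (auto simp: runs_Seq_iff)
qed

definition read_bit :: "(nat \<Rightarrow> nat) \<Rightarrow> nat \<Rightarrow> nat \<times> dir" where
  "read_bit x k = (x k, if k = 0 \<or> k = bt \<and> x 0 = 2 then Rgt else Stay)"

definition read_input :: com where
  "read_input = While (\<lambda>x. x 0 \<noteq> 0) (Seq (tape_com bt (double 0 1 2)) (Op read_bit))"

lemma runs_read_input:
  assumes "S 0 = (\<lambda>i. if i < length \<pi> then bit_symbol (\<pi> ! i) else 0, h)" "h \<le> length \<pi>"
    "r 1 = 0" "r 2 = 0"
  shows "runs read_input (conc S r) (conc (S(0 := (fst (S 0), length \<pi>)))
     (r(0 := push_bits (r 0) (drop h \<pi>))))"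
  using assms
proof (induction "length \<pi> - h" arbitrary: S r h)
  case 0
  have "S(0 := (fst (S 0), length \<pi>)) = S" "r(0 := r 0) = r"
    using 0 by (auto simp: fun_eq_iff)
  moreover have "seen (conc S r) 0 = 0" using 0 bt6 by (subst seen_tape) (auto simp: scan_def)
  ultimately show ?case using 0 by (auto simp: read_input_def runs_While_iff)
next
  case (Suc n)
  have h: "h < length \<pi>" using Suc.hyps(2) by simp
  have s0: "seen (conc S r') 0 = bit_symbol (\<pi> ! h)" for r'
    using Suc.prems h bt6 by (subst seen_tape) (auto simp: scan_def)
  let ?r1 = "r(0 := 2 * r 0)"
  let ?r2 = "r(0 := 2 * r 0 + of_bool (\<pi> ! h))"
  let ?S = "S(0 := (fst (S 0), Suc h))"
  have 1: "runs (tape_com bt (double 0 1 2)) (conc S r) (conc S ?r1)"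
    using Suc.prems bt_nt by (intro runs_tape_com crun_double) (auto simp: cregs_double)
  have 2: "perform read_bit (conc S ?r1) = conc ?S ?r2"
  proof (rule performI)
    fix j assume "j < bt"
    then show "act (S j) (write_of j (scan (S j)) (fst (read_bit (seen (conc S ?r1)) j)))
      (snd (read_bit (seen (conc S ?r1)) j)) = ?S j"
      using Suc.prems(1) by (auto simp: read_bit_def seen_tape act_move)
  next
    fix i assume "i < nt - bt"
    then show "?r2 i = (case snd (read_bit (seen (conc S ?r1)) (bt + i)) of
            Lft \<Rightarrow> ?r1 i - 1 | Stay \<Rightarrow> ?r1 i | Rgt \<Rightarrow> ?r1 i + 1)"
      using bt6 by (auto simp: read_bit_def s0 bit_symbol_def)
  qed (use bt_nt bt6 in \<open>auto simp: read_bit_def\<close>)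
  have "runs read_input (conc ?S ?r2) (conc (?S(0 := (fst (?S 0), length \<pi>)))
     (?r2(0 := push_bits (?r2 0) (drop (Suc h) \<pi>))))"
    using Suc.prems h Suc.hyps(2) by (intro Suc.hyps(1)) auto
  also have "?r2(0 := push_bits (?r2 0) (drop (Suc h) \<pi>)) =
       r(0 := push_bits (r 0) (drop h \<pi>))"
    using Cons_nth_drop_Suc[OF h, symmetric] by simp
  also have "?S(0 := (fst (?S 0), length \<pi>)) = S(0 := (fst (S 0), length \<pi>))" by simp
  finally have 3: "runs read_input (conc ?S ?r2) (conc (S(0 := (fst (S 0), length \<pi>)))
     (r(0 := push_bits (r 0) (drop h \<pi>))))" .
  show ?case
    unfolding read_input_def
  proof (rule runs_While_True)
    show "seen (conc S r) 0 \<noteq> 0" by (simp add: s0 bit_symbol_def)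
    show "runs (Seq (tape_com bt (double 0 1 2)) (Op read_bit)) (conc S r) (conc ?S ?r2)"
      using 1 2 by (auto simp: runs_Seq_iff)
  qed (use 3 in \<open>simp add: read_input_def\<close>)
qed

text \<open>One step of \<open>\<Phi>\<close>. On tape 4 the symbols are read modulo \<open>g\<close>, and the mark of cell 0 is kept when writing.\<close>

definition sim_step :: "(nat \<Rightarrow> nat) \<Rightarrow> nat \<Rightarrow> nat \<times> dir" where
  "sim_step x k =
    (case trans \<Phi> (x 5) (x 3 # x 1 # x 4 mod g # map (\<lambda>i. x (6 + i)) [0..<work_tapes \<Phi>]) of
      (q', ws, ds) \<Rightarrow>
        if k = 1 then (ws ! 1, ds ! 1)
        else if k = 3 then (ws ! 0, ds ! 0)
        else if k = 4 then (ws ! 2 + g * (x 4 div g), ds ! 2)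
        else if k = 5 then (q', Stay)
        else if 6 \<le> k \<and> k < bt then (ws ! (k - 3), ds ! (k - 3))
        else (x k, Stay))"

definition simulates :: "store \<Rightarrow> config \<Rightarrow> bool" where
  "simulates S c \<longleftrightarrow> (case c of (q, ts) \<Rightarrow>
     length ts = num_tapes \<Phi> \<and> q < num_states \<Phi> \<and> (\<forall>t\<in>set ts. \<forall>i. fst t i < g) \<and>
     S 1 = ts ! 1 \<and> S 3 = ts ! 0 \<and>
     S 4 = (\<lambda>i. fst (ts ! 2) i + (if i = 0 then g else 0), snd (ts ! 2)) \<and>
     S 5 = (\<lambda>i. if i = 0 then q else 0, 0) \<and>
     (\<forall>i<work_tapes \<Phi>. S (6 + i) = ts ! (3 + i)))"

lemma sim_step:
  assumes sim: "simulates S (q, ts)" and q: "q \<noteq> 1"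
  shows "\<exists>S'. perform sim_step (conc S r) = conc S' r \<and> simulates S' (tm_step \<Phi> (q, ts)) \<and>
     S' 0 = S 0 \<and> S' 2 = S 2"
proof -
  note s = sim[unfolded simulates_def, simplified]
  have len: "length ts = num_tapes \<Phi>" using s by simp
  have sym: "fst (ts ! i) k < g" if "i < num_tapes \<Phi>" for i k
    using s that len nth_mem by metis
  define x where "x = seen (conc S r)"
  have x: "x j = scan (S j)" if "j < bt" for j using that by (simp add: x_def seen_tape)
  have x4: "x 4 = scan (ts ! 2) + (if snd (ts ! 2) = 0 then g else 0)"
    using s bt6 by (simp add: x scan_def)
  have x4m: "x 4 mod g = scan (ts ! 2)" "x 4 div g = (if snd (ts ! 2) = 0 then 1 else 0)"
    using sym[of 2 "snd (ts ! 2)"] g3 by (auto simp: x4 scan_def)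
  have xs: "x 3 # x 1 # x 4 mod g # map (\<lambda>i. x (6 + i)) [0..<work_tapes \<Phi>] = map scan ts" (is "?xs = _")
  proof (rule nth_equalityI)
    fix i assume "i < length ?xs"
    then have "i < 3 + work_tapes \<Phi>" by simp
    then consider "i = 0" | "i = 1" | "i = 2" | k where "i = 3 + k" "k < work_tapes \<Phi>"
      by (metis One_nat_def add_less_cancel_left leI le_Suc_ex less_Suc0 less_Suc_eq numeral_2_eq_2 numeral_3_eq_3)
    then show "?xs ! i = map scan ts ! i"
    proof cases
      case (4 k)
      have "x (6 + k) = scan (ts ! (3 + k))" using s 4 bt_work[of k] by (simp add: x)
      then show ?thesis using 4 len by (simp add: numeral_3_eq_3)
    qed (use s bt6 x4m in \<open>auto simp: x numeral_2_eq_2 numeral_3_eq_3\<close>)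
  qed (use s in auto)
  obtain q' ws ds where tr: "trans \<Phi> q (map scan ts) = (q', ws, ds)" by (metis prod_cases3)
  have "length (map scan ts) = num_tapes \<Phi> \<and> set (map scan ts) \<subseteq> {..<g}"
    using s by (auto simp: scan_def)
  then have "case trans \<Phi> q (map scan ts) of (q', ws, ds) \<Rightarrow>
      q' < num_states \<Phi> \<and> length ws = num_tapes \<Phi> \<and> set ws \<subseteq> {..<g} \<and>
      length ds = num_tapes \<Phi> \<and> ws ! 1 = map scan ts ! 1"
    by (intro \<Phi>[unfolded oracle_tm_def, THEN conjunct2, THEN conjunct2, rule_format]) (use s in auto)
  then have ok: "q' < num_states \<Phi>" "length ws = num_tapes \<Phi>" "set ws \<subseteq> {..<g}"
    "length ds = num_tapes \<Phi>" "ws ! 1 = map scan ts ! 1"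
    by (simp_all add: tr)
  have wsg: "ws ! i < g" if "i < num_tapes \<Phi>" for i
    using ok that nth_mem by (metis lessThan_iff subsetD)
  define ts' where "ts' = map (\<lambda>(t, w, d). act t w d) (zip ts (zip ws ds))"
  have ts': "ts' ! i = act (ts ! i) (ws ! i) (ds ! i)" if "i < num_tapes \<Phi>" for i
    using that ok len by (simp add: ts'_def)
  have len': "length ts' = num_tapes \<Phi>" using ok len by (simp add: ts'_def)
  have step: "tm_step \<Phi> (q, ts) = (q', ts')" using q tr by (simp add: tm_step_def ts'_def)
  have x5: "x 5 = q" using s bt6 by (simp add: x scan_def)
  have f: "sim_step x k = (if k = 1 then (ws ! 1, ds ! 1)
        else if k = 3 then (ws ! 0, ds ! 0)
        else if k = 4 then (ws ! 2 + g * (x 4 div g), ds ! 2)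
        else if k = 5 then (q', Stay)
        else if 6 \<le> k \<and> k < bt then (ws ! (k - 3), ds ! (k - 3))
        else (x k, Stay))" for k
    unfolding sim_step_def xs x5 tr by simp
  define S' where "S' = (\<lambda>j. if j < bt then act (S j) (write_of j (scan (S j)) (fst (sim_step x j)))
      (snd (sim_step x j)) else S j)"
  have "perform sim_step (conc S r) = conc S' r"
    using bt6 bt_nt by (intro performI) (auto simp: S'_def f simp flip: x_def)
  moreover have "simulates S' (q', ts')"
    unfolding simulates_def prod.case
  proof (intro conjI ballI allI impI)
    show "length ts' = num_tapes \<Phi>" "q' < num_states \<Phi>" by (fact len' ok)+
    show "fst t i < g" if t: "t \<in> set ts'" for t i
    proof -
      obtain j where "j < num_tapes \<Phi>" "t = ts' ! j" using t len' by (metis in_set_conv_nth)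
      then show ?thesis using wsg sym by (auto simp: ts' act_def)
    qed
    show "S' 1 = ts' ! 1"
      using s bt6 ok(5) len by (simp add: S'_def f ts' write_of_def)
    show "S' 3 = ts' ! 0"
      using s bt6 wsg[of 0] ns_ge by (simp add: S'_def f ts' write_of_def)
    show "S' 4 = (\<lambda>i. fst (ts' ! 2) i + (if i = 0 then g else 0), snd (ts' ! 2))"
      using s bt6 wsg[of 2] ns_ge by (auto simp: S'_def f ts' write_of_def x4m act_def fun_eq_iff split: dir.split)
    show "S' 5 = (\<lambda>i. if i = 0 then q' else 0, 0)"
      using s bt6 ok ns_ge by (auto simp: S'_def f write_of_def act_def fun_eq_iff)
    show "S' (6 + i) = ts' ! (3 + i)" if i: "i < work_tapes \<Phi>" for i
      using s bt6 bt_work[OF i] wsg[of "3 + i"] ns_ge i by (simp add: S'_def f ts' write_of_def)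
  qed
  moreover have "S' 0 = S 0" "S' 2 = S 2" using bt6 by (simp_all add: S'_def f x)
  ultimately show ?thesis unfolding step by blast
qed

definition simulation :: com where
  "simulation = While (\<lambda>x. x 5 \<noteq> 1) (Op sim_step)"

lemma runs_simulation:
  assumes "(tm_step \<Phi> ^^ t) (q, ts) = (1, ts')" "simulates S (q, ts)"
  shows "\<exists>S'. runs simulation (conc S r) (conc S' r) \<and> simulates S' (1, ts') \<and> S' 0 = S 0 \<and> S' 2 = S 2"
  using assms
proof (induction t arbitrary: q ts S)
  case 0
  have "seen (conc S r) 5 = 1" using 0 bt6 by (subst seen_tape) (auto simp: simulates_def scan_def)
  then show ?case using 0 by (auto simp: simulation_def runs_While_iff)
next
  case (Suc t)
  show ?case
  proof (cases "q = 1")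
    case True
    have "(tm_step \<Phi> ^^ n) (1, ts) = (1, ts)" for n
      by (induction n) (auto simp: tm_step_def)
    then have "ts' = ts" using Suc.prems(1) True by (metis prod.inject)
    moreover have "seen (conc S r) 5 = 1"
      using Suc.prems(2) True bt6 by (subst seen_tape) (auto simp: simulates_def scan_def)
    ultimately show ?thesis using Suc.prems True by (auto simp: simulation_def runs_While_iff)
  next
    case False
    obtain S1 where S1: "perform sim_step (conc S r) = conc S1 r"
      "simulates S1 (tm_step \<Phi> (q, ts))" "S1 0 = S 0" "S1 2 = S 2"
      using sim_step[OF Suc.prems(2) False] by blast
    obtain q1 ts1 where c1: "tm_step \<Phi> (q, ts) = (q1, ts1)" by fastforce
    have "(tm_step \<Phi> ^^ t) (q1, ts1) = (1, ts')"
      using Suc.prems(1) by (simp add: funpow_Suc_right c1 del: funpow.simps)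
    then obtain S' where S': "runs simulation (conc S1 r) (conc S' r)" "simulates S' (1, ts')"
      "S' 0 = S1 0" "S' 2 = S1 2"
      using Suc.IH S1(2) c1 by metis
    have "seen (conc S r) 5 \<noteq> 1"
      using Suc.prems(2) False bt6 by (subst seen_tape) (auto simp: simulates_def scan_def)
    then have "runs simulation (conc S r) (conc S' r)"
      unfolding simulation_def
    proof (rule runs_While_True)
      show "runs (Op sim_step) (conc S r) (conc S1 r)" using S1(1) by simp
    qed (use S'(1) in \<open>simp add: simulation_def\<close>)
    then show ?thesis using S' S1 by auto
  qed
qed

definition rewind :: com where
  "rewind = While (\<lambda>x. x 4 < g) (Op (shift 4 Lft))"

text \<open>The output of \<open>\<Phi>\<close> has its least significant bit first. It is read backwards from its end to its marked
beginning, so that doubling and adding a bit accumulates its value.\<close>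

definition to_blank :: com where
  "to_blank = While (\<lambda>x. x 4 mod g \<noteq> 0) (Op (shift 4 Rgt))"

lemma perform_shift_4:
  "perform (shift 4 Lft) (conc S r) = conc (S(4 := (fst (S 4), snd (S 4) - 1))) r"
  "perform (shift 4 Rgt) (conc S r) = conc (S(4 := (fst (S 4), snd (S 4) + 1))) r"
  using bt6 bt_nt by (auto intro!: performI simp: shift_def seen_tape act_move)

lemma runs_rewind:
  assumes "\<And>i. fst (S 4) i < g \<longleftrightarrow> i > 0"
  shows "runs rewind (conc S r) (conc (S(4 := (fst (S 4), 0))) r)"
  using assms
proof (induction "snd (S 4)" arbitrary: S)
  case 0
  have "S(4 := (fst (S 4), 0)) = S" using 0 by (metis fun_upd_triv prod.collapse)
  moreover have "\<not> seen (conc S r) 4 < g" using 0 bt6 by (subst seen_tape) (auto simp: scan_def)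
  ultimately show ?case by (auto simp: rewind_def runs_While_iff)
next
  case (Suc n)
  let ?S = "S(4 := (fst (S 4), snd (S 4) - 1))"
  have "n = snd (?S 4)" using Suc.hyps(2) by simp
  then have "runs rewind (conc ?S r) (conc (?S(4 := (fst (?S 4), 0))) r)"
    using Suc.prems by (intro Suc.hyps(1)) auto
  moreover have "seen (conc S r) 4 < g"
    using Suc.prems[of "snd (S 4)"] Suc.hyps(2) bt6 by (subst seen_tape) (auto simp: scan_def)
  moreover have "runs (Op (shift 4 Lft)) (conc S r) (conc ?S r)" by (simp add: perform_shift_4)
  ultimately show ?case unfolding rewind_def using runs_While_True by fastforce
qed

lemma runs_to_blank:
  assumes "\<And>i. i < n \<Longrightarrow> fst (S 4) i mod g \<noteq> 0" "fst (S 4) n mod g = 0" "snd (S 4) \<le> n"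
  shows "runs to_blank (conc S r) (conc (S(4 := (fst (S 4), n))) r)"
  using assms
proof (induction "n - snd (S 4)" arbitrary: S)
  case 0
  then have "S(4 := (fst (S 4), n)) = S" by (metis diff_is_0_eq fun_upd_triv le_antisym prod.collapse)
  moreover have "seen (conc S r) 4 mod g = 0"
    using 0 bt6 by (subst seen_tape) (auto simp: scan_def)
  ultimately show ?case by (auto simp: to_blank_def runs_While_iff)
next
  case (Suc m)
  let ?S = "S(4 := (fst (S 4), snd (S 4) + 1))"
  have "m = n - snd (?S 4)" using Suc.hyps(2) by simp
  then have "runs to_blank (conc ?S r) (conc (?S(4 := (fst (?S 4), n))) r)"
    using Suc.prems Suc.hyps(2) by (intro Suc.hyps(1)) auto
  moreover have "seen (conc S r) 4 mod g \<noteq> 0"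
    using Suc.prems(1)[of "snd (S 4)"] Suc.hyps(2) bt6 by (subst seen_tape) (auto simp: scan_def)
  moreover have "runs (Op (shift 4 Rgt)) (conc S r) (conc ?S r)" by (simp add: perform_shift_4)
  ultimately show ?case unfolding to_blank_def using runs_While_True by fastforce
qed

definition add_bit :: "(nat \<Rightarrow> nat) \<Rightarrow> nat \<Rightarrow> nat \<times> dir" where
  "add_bit x k = (x k, if k = bt + 1 \<and> x 4 mod g = 2 then Rgt else Stay)"

definition read_back :: com where
  "read_back = While (\<lambda>x. x 4 < g)
     (Seq (Op (shift 4 Lft)) (Seq (tape_com bt (double 1 2 3)) (Op add_bit)))"

lemma runs_read_back:
  assumes "fst (S 4) = c" "snd (S 4) = n" "\<And>i. c i < g \<longleftrightarrow> i > 0"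
    "\<And>i. i < length \<sigma> \<Longrightarrow> c i mod g = bit_symbol (\<sigma> ! i)" "n \<le> length \<sigma>" "r 2 = 0" "r 3 = 0"
  shows "runs read_back (conc S r) (conc (S(4 := (c, 0))) (r(1 := r 1 * 2 ^ n + bit_value (take n \<sigma>))))"
  using assms
proof (induction n arbitrary: S r)
  case 0
  have "S(4 := (c, 0)) = S" using 0 by (metis fun_upd_triv prod.collapse)
  moreover have "\<not> seen (conc S r) 4 < g" using 0 bt6 by (subst seen_tape) (auto simp: scan_def)
  ultimately show ?case by (auto simp: read_back_def runs_While_iff)
next
  case (Suc n)
  let ?S = "S(4 := (c, n))"
  let ?r1 = "r(1 := 2 * r 1)"
  let ?r2 = "r(1 := 2 * r 1 + of_bool (\<sigma> ! n))"
  have 1: "perform (shift 4 Lft) (conc S r) = conc ?S r"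
    using Suc.prems by (simp add: perform_shift_4)
  have 2: "runs (tape_com bt (double 1 2 3)) (conc ?S r) (conc ?S ?r1)"
    using Suc.prems bt_nt by (intro runs_tape_com crun_double) (auto simp: cregs_double)
  have s4: "seen (conc ?S r') 4 mod g = bit_symbol (\<sigma> ! n)" for r'
    using Suc.prems bt6 by (subst seen_tape) (auto simp: scan_def)
  have 3: "perform add_bit (conc ?S ?r1) = conc ?S ?r2"
  proof (rule performI)
    fix j assume "j < bt"
    then show "act (?S j) (write_of j (scan (?S j)) (fst (add_bit (seen (conc ?S ?r1)) j)))
      (snd (add_bit (seen (conc ?S ?r1)) j)) = ?S j"
      by (auto simp: add_bit_def seen_tape)
  next
    fix i assume "i < nt - bt"
    then show "?r2 i = (case snd (add_bit (seen (conc ?S ?r1)) (bt + i)) of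
            Lft \<Rightarrow> ?r1 i - 1 | Stay \<Rightarrow> ?r1 i | Rgt \<Rightarrow> ?r1 i + 1)"
      by (auto simp: add_bit_def s4 bit_symbol_def)
  qed (auto simp: add_bit_def)
  have "runs read_back (conc ?S ?r2) (conc (?S(4 := (c, 0)))
      (?r2(1 := ?r2 1 * 2 ^ n + bit_value (take n \<sigma>))))"
    using Suc.prems by (intro Suc.IH) auto
  also have "?r2(1 := ?r2 1 * 2 ^ n + bit_value (take n \<sigma>)) =
      r(1 := r 1 * 2 ^ Suc n + bit_value (take (Suc n) \<sigma>))"
    using Suc.prems(5) by (simp add: take_Suc_conv_app_nth bit_value_snoc algebra_simps)
  finally have 4: "runs read_back (conc ?S ?r2) (conc (S(4 := (c, 0)))
      (r(1 := r 1 * 2 ^ Suc n + bit_value (take (Suc n) \<sigma>))))" by (simp only: fun_upd_upd)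
  show ?case
    unfolding read_back_def
  proof (rule runs_While_True)
    show "seen (conc S r) 4 < g" using Suc.prems bt6 by (subst seen_tape) (auto simp: scan_def)
    show "runs (Seq (Op (shift 4 Lft)) (Seq (tape_com bt (double 1 2 3)) (Op add_bit)))
        (conc S r) (conc ?S ?r2)"
      using 1 2 3 by (auto simp: runs_Seq_iff)
  qed (rule 4[unfolded read_back_def])
qed

text \<open>Halving by transfer in steps of 1: register 2 is counted down, register 4 alternates between 0 and 1, and register 3 is increased
whenever register 4 returns to 0. At the end registers 3 and 4 contain the quotient and the next output bit.\<close>

definition toggle :: "(nat \<Rightarrow> nat) \<Rightarrow> nat \<Rightarrow> nat \<times> dir" where
  "toggle x k = (x k,
     if k = bt + 2 then Lft
     else if k = bt + 4 then (if x (bt + 4) = 0 then Lft else Rgt)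
     else if k = bt + 3 \<and> x (bt + 4) = 0 then Rgt else Stay)"

definition halve :: com where
  "halve = While (\<lambda>x. x (bt + 2) = 0) (Op toggle)"

lemma runs_halve:
  assumes "r 4 \<le> 1"
  shows "runs halve (conc S r)
    (conc S (r(2 := 0, 3 := r 3 + (r 2 + r 4) div 2, 4 := (r 2 + r 4) mod 2)))"
  using assms
proof (induction "r 2" arbitrary: r)
  case 0
  have "r 4 div 2 = 0" "r 4 mod 2 = r 4" using 0 by auto
  then have "r(2 := 0, 3 := r 3 + (r 2 + r 4) div 2, 4 := (r 2 + r 4) mod 2) = r"
    using 0 by (auto simp: fun_eq_iff)
  moreover have "seen (conc S r) (bt + 2) \<noteq> 0" using 0 bt_nt by (subst seen_counter) auto
  ultimately show ?case by (metis halve_def runs_While_False)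
next
  case (Suc n)
  have r4: "r 4 = 0 \<or> r 4 = 1" using Suc.prems by linarith
  let ?r = "r(2 := n, 3 := r 3 + r 4, 4 := 1 - r 4)"
  have dec: "r 2 - 1 = n" "r 2 = Suc n" using Suc.hyps(2) by auto
  have s4: "seen (conc S r) (bt + 4) = (if r 4 = 0 then 1 else 0)" using bt_nt by (subst seen_counter) auto
  have 1: "perform toggle (conc S r) = conc S ?r"
  proof (rule performI)
    fix j assume "j < bt"
    then show "act (S j) (write_of j (scan (S j)) (fst (toggle (seen (conc S r)) j)))
      (snd (toggle (seen (conc S r)) j)) = S j"
      by (auto simp: toggle_def seen_tape)
  next
    fix i assume "i < nt - bt"
    show "?r i = (case snd (toggle (seen (conc S r)) (bt + i)) of
            Lft \<Rightarrow> r i - 1 | Stay \<Rightarrow> r i | Rgt \<Rightarrow> r i + 1)"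
      using r4 dec by (auto simp: toggle_def s4)
  qed (auto simp: toggle_def)
  have "runs halve (conc S ?r) (conc S (?r(2 := 0, 3 := ?r 3 + (?r 2 + ?r 4) div 2, 4 := (?r 2 + ?r 4) mod 2)))"
    by (intro Suc.hyps(1)) auto
  also have "?r(2 := 0, 3 := ?r 3 + (?r 2 + ?r 4) div 2, 4 := (?r 2 + ?r 4) mod 2) =
      r(2 := 0, 3 := r 3 + (r 2 + r 4) div 2, 4 := (r 2 + r 4) mod 2)"
  proof -
    have "r 3 + r 4 + (n + (1 - r 4)) div 2 = r 3 + (r 2 + r 4) div 2"
      "(n + (1 - r 4)) mod 2 = (r 2 + r 4) mod 2"
      using r4 dec(2) by auto
    then show ?thesis by (auto simp: fun_eq_iff)
  qed
  finally have 2: "runs halve (conc S ?r)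
     (conc S (r(2 := 0, 3 := r 3 + (r 2 + r 4) div 2, 4 := (r 2 + r 4) mod 2)))" .
  show ?case
    unfolding halve_def
  proof (rule runs_While_True)
    show "seen (conc S r) (bt + 2) = 0" using dec bt_nt by (subst seen_counter) auto
    show "runs (Op toggle) (conc S r) (conc S ?r)" using 1 by simp
  qed (use 2 in \<open>simp add: halve_def\<close>)
qed

definition write_bit :: "(nat \<Rightarrow> nat) \<Rightarrow> nat \<Rightarrow> nat \<times> dir" where
  "write_bit x k = (if k = 2 then (if x (bt + 4) = 0 then 2 else 1, Rgt)
     else (x k, if k = bt + 4 then Lft else Stay))"

definition write_output :: com where
  "write_output = While (\<lambda>x. x (bt + 2) = 0)
     (Seq halve (Seq (Op write_bit) (tape_com bt (move 3 2))))"

lemma runs_write_output: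
  assumes "r 3 = 0" "r 4 = 0"
  shows "runs write_output (conc S r) (conc (S(2 := append_bits (S 2) (nat_string (r 2)))) (r(2 := 0)))"
  using assms
proof (induction "r 2" arbitrary: S r rule: less_induct)
  case less
  show ?case
  proof (cases "r 2 = 0")
    case True
    then have "S(2 := append_bits (S 2) (nat_string (r 2))) = S"
      by (simp add: nat_string.simps append_bits_Nil)
    moreover have "r(2 := 0) = r" using True by (auto simp: fun_eq_iff)
    moreover have "seen (conc S r) (bt + 2) \<noteq> 0" using True bt_nt by (subst seen_counter) auto
    ultimately show ?thesis by (simp only: write_output_def runs_While_iff if_False refl)
  next
    case False
    define w where "w = r 2"
    have w: "w > 0" using False by (simp add: w_def)
    have digits: "nat_string w = odd w # nat_string (w div 2)" using w by (simp add: nat_string.simps[of w])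
    let ?r1 = "r(2 := 0, 3 := w div 2, 4 := w mod 2)"
    let ?r2 = "r(2 := 0, 3 := w div 2)"
    let ?r3 = "r(2 := w div 2)"
    let ?S = "S(2 := ((fst (S 2))(snd (S 2) := bit_symbol (odd w)), Suc (snd (S 2))))"
    have 1: "runs halve (conc S r) (conc S ?r1)"
      using runs_halve[of r S] less.prems by (simp add: w_def)
    have s4: "seen (conc S ?r1) (bt + 4) = (if w mod 2 = 0 then 1 else 0)"
      using bt_nt by (subst seen_counter) auto
    have 2: "perform write_bit (conc S ?r1) = conc ?S ?r2"
    proof (rule performI)
      fix j assume "j < bt"
      then show "act (S j) (write_of j (scan (S j)) (fst (write_bit (seen (conc S ?r1)) j)))
        (snd (write_bit (seen (conc S ?r1)) j)) = ?S j"
        using ns_ge g3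
        by (auto simp: write_bit_def seen_tape s4 act_def write_of_def bit_symbol_def odd_iff_mod_2_eq_one even_iff_mod_2_eq_zero scan_def fun_eq_iff)
    next
      fix i assume "i < nt - bt"
      show "?r2 i = (case snd (write_bit (seen (conc S ?r1)) (bt + i)) of
            Lft \<Rightarrow> ?r1 i - 1 | Stay \<Rightarrow> ?r1 i | Rgt \<Rightarrow> ?r1 i + 1)"
        using bt6 less.prems by (auto simp: write_bit_def)
    qed (use bt6 bt_nt in \<open>auto simp: write_bit_def\<close>)
    have 3: "runs (tape_com bt (move 3 2)) (conc ?S ?r2) (conc ?S ?r3)"
    proof -
      have "crun (move 3 2) ?r2 (?r2(3 := 0, 2 := ?r2 2 + ?r2 3))" by (rule crun_move) simp
      also have "?r2(3 := 0, 2 := ?r2 2 + ?r2 3) = ?r3" using less.prems by (auto simp: fun_eq_iff)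
      finally have "crun (move 3 2) ?r2 ?r3" .
      then show ?thesis by (rule runs_tape_com) (use bt_nt in \<open>auto simp: move_def\<close>)
    qed
    have "runs write_output (conc ?S ?r3) (conc (?S(2 := append_bits (?S 2) (nat_string (?r3 2)))) (?r3(2 := 0)))"
      using less.prems w by (intro less.hyps) (auto simp: w_def)
    also have "?S(2 := append_bits (?S 2) (nat_string (?r3 2))) = S(2 := append_bits (S 2) (nat_string w))"
      by (simp add: digits append_bits_Cons)
    finally have 4: "runs write_output (conc ?S ?r3) (conc (S(2 := append_bits (S 2) (nat_string w))) (r(2 := 0)))"
      by (simp only: fun_upd_upd)
    show ?thesis
      unfolding write_output_def w_def[symmetric]
    proof (rule runs_While_True)
      show "seen (conc S r) (bt + 2) = 0" using False bt_nt by (subst seen_counter) auto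
      show "runs (Seq halve (Seq (Op write_bit) (tape_com bt (move 3 2)))) (conc S r) (conc ?S ?r3)"
        using 1 2 3 by (auto simp: runs_Seq_iff)
    qed (use 4 in \<open>simp add: write_output_def\<close>)
  qed
qed

end

text \<open>A machine for \<open>F (input_number \<pi>) v\<close>, where \<open>v\<close> is the list of cubes that \<open>\<Phi>\<close> finds in the oracle. The test of
\<open>valid\<close> comes first, so inputs that fail it never lead to a halt, whatever \<open>\<Phi>\<close> does. This makes
the machine prefix-free as soon as the valid inputs form a prefix-free set.\<close>

theorem machine_of_prec:
  assumes \<Phi>: "oracle_tm \<Phi>" and valid: "decidable (\<lambda>\<rho>. valid (\<rho> 0))"
    and F: "prec (\<lambda>\<rho>. F (\<rho> 1) (\<rho> 0))"
  shows "\<exists>M. oracle_tm M \<and>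
     (\<forall>A \<pi> \<sigma>. tm_computes M A \<pi> \<sigma> \<longrightarrow> valid (input_number \<pi>)) \<and>
     (\<forall>A \<pi> v. tm_outputs_at \<Phi> A 1 0 v \<longrightarrow> valid (input_number \<pi>) \<longrightarrow>
        tm_computes M A \<pi> (nat_string (F (input_number \<pi>) v)))"
proof -
  obtain pv Ev where pv: "computes_at 1 Ev pv (\<lambda>\<rho>. of_bool (\<not> valid (\<rho> 0)))"
    using prec_compile[OF decidable_not[OF valid]] by blast
  obtain pf Ef where pf: "computes_at 2 Ef pf (\<lambda>\<rho>. F (\<rho> 1) (\<rho> 0))"
    using prec_compile[OF F] by blast
  have "finite (cregs pv \<union> cregs pf)" by (simp add: finite_cregs)
  then obtain N where N: "cregs pv \<union> cregs pf \<subseteq> {..<N}"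
    by (metis finite_nat_iff_bounded)
  define bt where "bt = 6 + work_tapes \<Phi>"
  define nt where "nt = bt + N + 5"
  define ns where "ns = 2 * num_symbols \<Phi> + num_states \<Phi>"
  interpret counter_machine nt ns \<Phi> bt
  proof unfold_locales
    show "3 \<le> nt" "bt + 5 \<le> nt" by (simp_all add: nt_def bt_def)
    show "3 \<le> ns" using \<Phi> by (simp add: ns_def oracle_tm_def)
  qed (use \<Phi> in \<open>simp_all add: bt_def ns_def\<close>)
  have regs: "cregs pv \<subseteq> {..<nt - bt}" "cregs pf \<subseteq> {..<nt - bt}"
    using N by (auto simp: nt_def)
  define pre where "pre = Seq (Seq (Op init1) (Op init2))
    (Seq (tape_com bt (Inc 0)) (Seq read_input (tape_com bt pv)))"
  define post where "post = Seq simulation (Seq rewind (Seq to_blank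
     (Seq read_back (Seq (tape_com bt pf) write_output))))"
  define halt_if_valid where "halt_if_valid = While (\<lambda>x. x (bt + 1) = 0) Skip"
  define c0 where "c0 = Seq pre (Seq halt_if_valid post)"
  define S1 where "S1 A \<pi> = (start_store A \<pi>)(0 := (fst (start_store A \<pi> 0), length \<pi>))" for A \<pi>
  define r1 where "r1 \<pi> = (\<lambda>_::nat. 0)(0 := input_number \<pi>, 1 := of_bool (\<not> valid (input_number \<pi>)) :: nat)" for \<pi>
  \<comment> \<open>This part halts for every input and every oracle; what follows depends on its outcome.\<close>
  have pre: "runs pre (init_store A \<pi>) (conc (S1 A \<pi>) (r1 \<pi>))" for A \<pi>
  proof -
    let ?one = "(\<lambda>_. 0)(0 := 1) :: nat \<Rightarrow> nat"
    let ?r = "(\<lambda>_. 0)(0 := input_number \<pi>) :: nat \<Rightarrow> nat"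
    have "crun (Inc 0) (\<lambda>_. 0) ?one" using crun_Inc[of 0 "\<lambda>_. 0"] by simp
    then have 1: "runs (tape_com bt (Inc 0)) (conc (start_store A \<pi>) (\<lambda>_. 0)) (conc (start_store A \<pi>) ?one)"
      by (rule runs_tape_com) (use bt_nt in auto)
    have "runs read_input (conc (start_store A \<pi>) ?one) (conc (S1 A \<pi>)
        (?one(0 := push_bits (?one 0) (drop 0 \<pi>))))"
      unfolding S1_def by (rule runs_read_input) (auto simp: start_store_def init_store_def)
    then have 2: "runs read_input (conc (start_store A \<pi>) ?one) (conc (S1 A \<pi>) ?r)"
      by (simp add: input_number_def)
    have "layout 1 Ev (\<lambda>i. if i = 0 then input_number \<pi> else 0) ?r"
      by (auto simp: layout_def)
    then have "crun pv ?r (r1 \<pi>)"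
      using pv unfolding computes_at_def r1_def by fastforce
    then have 3: "runs (tape_com bt pv) (conc (S1 A \<pi>) ?r) (conc (S1 A \<pi>) (r1 \<pi>))"
      by (rule runs_tape_com) (rule regs)
    show ?thesis unfolding pre_def using runs_init 1 2 3 runs_Seq_iff by blast
  qed
  have seen_flag: "seen (conc (S1 A \<pi>) (r1 \<pi>)) (bt + 1) = (if valid (input_number \<pi>) then 1 else 0)" for A \<pi>
    using bt_nt by (subst seen_counter) (auto simp: r1_def)
  have halts: "valid (input_number \<pi>)" if run: "runs c0 (init_store A \<pi>) S" for A \<pi> S
  proof -
    obtain S' where S': "runs pre (init_store A \<pi>) S'" "runs (Seq halt_if_valid post) S' S"
      using run unfolding c0_def runs_Seq_iff[of pre] by blast
    then have "S' = conc (S1 A \<pi>) (r1 \<pi>)" using pre runs_deterministic by blast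
    then have "seen (conc (S1 A \<pi>) (r1 \<pi>)) (bt + 1) \<noteq> 0"
      using S'(2) by (auto simp: runs_Seq_iff halt_if_valid_def runs_While_Skip_iff)
    then show ?thesis unfolding seen_flag by (simp split: if_splits)
  qed
  have result: "\<exists>S. runs c0 (init_store A \<pi>) S \<and>
      (\<forall>i<length \<sigma>. fst (S 2) i = bit_symbol (\<sigma> ! i)) \<and> fst (S 2) (length \<sigma>) = 0"
    if out: "tm_outputs_at \<Phi> A 1 0 v" and val: "valid (input_number \<pi>)"
      and \<sigma>: "\<sigma> = nat_string (F (input_number \<pi>) v)" for A \<pi> v \<sigma>
  proof -
    define u where "u = input_number \<pi>"
    define \<tau> where "\<tau> = nat_string v"
    \<comment> \<open>The query on tape 3 is the input that the definition of \<open>decodes_data\<close> prescribes.\<close>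
    have two: "nat_string (prod_encode (1, 0)) = [False, True]"
      by (simp add: prod_encode_def triangle_def nat_string.simps)
    obtain t ts where t: "(tm_step \<Phi> ^^ t) (tm_init \<Phi> A [False, True]) = (1, ts)"
      and ts: "\<forall>i<length \<tau>. fst (ts ! 2) i = bit_symbol (\<tau> ! i)" "fst (ts ! 2) (length \<tau>) = 0"
      using out unfolding tm_outputs_at_def tm_computes_def two \<tau>_def by blast
    obtain ts0 where ts0: "tm_init \<Phi> A [False, True] = (0, ts0)" by (simp add: tm_init_def)
    have sim0: "simulates (S1 A \<pi>) (0, ts0)"
      unfolding simulates_def prod.case
    proof (intro conjI ballI allI impI)
      show "length ts0 = num_tapes \<Phi>" using ts0 by (auto simp: tm_init_def)
      show "0 < num_states \<Phi>" using \<Phi> by (simp add: oracle_tm_def)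
      show "fst x i < g" if "x \<in> set ts0" for x i
        using that ts0 g3 by (auto simp: tm_init_def bit_symbol_def nth_Cons' split: if_splits)
      show "S1 A \<pi> 1 = ts0 ! 1" "S1 A \<pi> 3 = ts0 ! 0"
        using ts0 by (auto simp: tm_init_def S1_def start_store_def init_store_def bit_symbol_def fun_eq_iff nth_Cons' less_Suc_eq)
      show "S1 A \<pi> 4 = (\<lambda>i. fst (ts0 ! 2) i + (if i = 0 then g else 0), snd (ts0 ! 2))"
        using ts0 by (auto simp: tm_init_def S1_def start_store_def init_store_def fun_eq_iff)
      show "S1 A \<pi> 5 = (\<lambda>i. if i = 0 then 0 else 0, 0)"
        by (auto simp: S1_def start_store_def init_store_def fun_eq_iff)
      show "S1 A \<pi> (6 + i) = ts0 ! (3 + i)" if "i < work_tapes \<Phi>" for i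
        using ts0 that by (auto simp: tm_init_def S1_def start_store_def init_store_def fun_eq_iff nth_Cons' nth_append)
    qed
    obtain S2 where S2: "runs simulation (conc (S1 A \<pi>) (r1 \<pi>)) (conc S2 (r1 \<pi>))"
      "simulates S2 (1, ts)" "S2 2 = S1 A \<pi> 2"
      using runs_simulation[OF t[unfolded ts0] sim0] by blast
    define c where "c = fst (S2 4)"
    have c: "c = (\<lambda>i. fst (ts ! 2) i + (if i = 0 then g else 0))"
      using S2(2) by (simp add: simulates_def c_def)
    have small: "fst (ts ! 2) i < g" for i using S2(2) by (auto simp: simulates_def)
    have c_less: "c i < g \<longleftrightarrow> i > 0" and c_mod: "c i mod g = fst (ts ! 2) i" for i
      using small[of i] by (auto simp: c)
    have bits: "c i mod g = bit_symbol (\<tau> ! i)" if "i < length \<tau>" for i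
      using that ts by (simp add: c_mod)
    let ?S3 = "S2(4 := (c, 0))"
    let ?S4 = "S2(4 := (c, length \<tau>))"
    have 1: "runs rewind (conc S2 (r1 \<pi>)) (conc ?S3 (r1 \<pi>))"
      using runs_rewind[of S2 "r1 \<pi>"] c_less by (simp add: c_def)
    have "runs to_blank (conc ?S3 (r1 \<pi>)) (conc (?S3(4 := (fst (?S3 4), length \<tau>))) (r1 \<pi>))"
      using bits ts by (intro runs_to_blank) (auto simp: c_mod bit_symbol_def)
    then have 2: "runs to_blank (conc ?S3 (r1 \<pi>)) (conc ?S4 (r1 \<pi>))" by simp
    have "runs read_back (conc ?S4 (r1 \<pi>)) (conc (?S4(4 := (c, 0)))
       ((r1 \<pi>)(1 := r1 \<pi> 1 * 2 ^ length \<tau> + bit_value (take (length \<tau>) \<tau>))))"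
      using bits c_less by (intro runs_read_back) (auto simp: r1_def)
    moreover have "(r1 \<pi>)(1 := r1 \<pi> 1 * 2 ^ length \<tau> + bit_value (take (length \<tau>) \<tau>)) = (\<lambda>_. 0)(0 := u, 1 := v)"
      using val by (auto simp: r1_def u_def \<tau>_def bit_value_nat_string fun_eq_iff)
    ultimately have 3: "runs read_back (conc ?S4 (r1 \<pi>)) (conc ?S3 ((\<lambda>_. 0)(0 := u, 1 := v)))" by simp
    let ?r = "(\<lambda>_. 0)(0 := u, 1 := v, 2 := F u v)"
    have "layout 2 Ef (\<lambda>i. if i = 0 then v else if i = 1 then u else 0) ((\<lambda>_. 0)(0 := u, 1 := v))"
      by (auto simp: layout_def less_Suc_eq numeral_2_eq_2)
    then have "crun pf ((\<lambda>_. 0)(0 := u, 1 := v)) ?r"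
      using pf unfolding computes_at_def by fastforce
    then have 4: "runs (tape_com bt pf) (conc ?S3 ((\<lambda>_. 0)(0 := u, 1 := v))) (conc ?S3 ?r)"
      by (rule runs_tape_com) (rule regs)
    have "S1 A \<pi> 2 = (\<lambda>_. 0, 0)" by (simp add: S1_def start_store_def init_store_def)
    then have blank: "?S3 2 = (\<lambda>_. 0, 0)" using S2(3) by simp
    have 6: "runs write_output (conc ?S3 ?r) (conc (?S3(2 := append_bits (?S3 2) \<sigma>)) (?r(2 := 0)))" (is "runs _ _ ?S")
      using runs_write_output[of ?r ?S3] by (simp add: \<sigma> u_def)
    have S_2: "?S 2 = append_bits (\<lambda>_. 0, 0) \<sigma>" using bt6 blank by (simp add: conc_tape)
    have 5: "runs halt_if_valid (conc (S1 A \<pi>) (r1 \<pi>)) (conc (S1 A \<pi>) (r1 \<pi>))"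
      by (auto simp: halt_if_valid_def runs_While_Skip_iff seen_flag[simplified] val)
    have "runs c0 (init_store A \<pi>) ?S"
      unfolding c0_def post_def using pre 5 S2(1) 1 2 3 4 6 runs_Seq_iff by meson
    then show ?thesis using S_2 by (intro exI[of _ ?S]) (simp add: append_bits_def)
  qed
  have "c0 \<noteq> Skip" by (simp add: c0_def)
  from com_to_tm[OF this] obtain M where M: "oracle_tm M" "\<And>A \<pi> \<sigma>. tm_computes M A \<pi> \<sigma> \<longleftrightarrow>
     (\<exists>S. runs c0 (init_store A \<pi>) S \<and>
        (\<forall>i<length \<sigma>. fst (S 2) i = bit_symbol (\<sigma> ! i)) \<and> fst (S 2) (length \<sigma>) = 0)"
    by blast
  show ?thesis
  proof (intro exI conjI allI impI)
    show "oracle_tm M" by (fact M)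
    show "valid (input_number \<pi>)" if "tm_computes M A \<pi> \<sigma>" for A \<pi> \<sigma>
      using that halts by (auto simp: M)
    show "tm_computes M A \<pi> (nat_string (F (input_number \<pi>) v))"
      if "tm_outputs_at \<Phi> A 1 0 v" "valid (input_number \<pi>)" for A \<pi> v
      using result[OF that refl] by (simp add: M)
  qed
qed

section \<open>An upper bound for Kolmogorov complexity\<close>

text \<open>A program consists of \<open>a\<close> ones, a zero and \<open>k * a\<close> bits of payload. With the leading marker of \<open>input_number\<close>, the bits in
front of the payload have the value \<open>2 ^ (a + 2) - 2\<close>. Since \<open>k\<close> is a constant of the machine, the header
costs only the fraction \<open>1 / k\<close> of the payload.\<close>

definition header_is :: "nat \<Rightarrow> nat \<Rightarrow> nat \<Rightarrow> bool" where
  "header_is k u a \<longleftrightarrow> u div 2 ^ (k * a) = 2 ^ (a + 2) - 2"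

lemma foldl_bits_bounds:
  "x * 2 ^ length \<pi> \<le> push_bits x \<pi> \<and>
   push_bits x \<pi> < Suc x * 2 ^ length \<pi>"
proof (induction \<pi> arbitrary: x)
  case (Cons b \<pi>)
  let ?y = "2 * x + of_bool b :: nat"
  have 1: "x * 2 ^ length (b # \<pi>) \<le> ?y * 2 ^ length \<pi>" by simp
  have 2: "Suc ?y * 2 ^ length \<pi> \<le> Suc x * 2 ^ length (b # \<pi>)"
  proof -
    have "Suc ?y * 2 ^ length \<pi> \<le> (2 * Suc x) * 2 ^ length \<pi>" by (rule mult_le_mono1) simp
    then show ?thesis by simp
  qed
  show ?case
    unfolding foldl_Cons
    using le_trans[OF 1 conjunct1[OF Cons.IH[of ?y]]] less_le_trans[OF conjunct2[OF Cons.IH[of ?y]] 2]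
    by (rule conjI)
qed simp

lemma input_number_bounds: "2 ^ length \<pi> \<le> input_number \<pi>" "input_number \<pi> < 2 ^ Suc (length \<pi>)"
  using foldl_bits_bounds[of 1 \<pi>] by (simp_all add: input_number_def)

lemma input_number_append_div: "input_number (\<pi> @ \<tau>) div 2 ^ length \<tau> = input_number \<pi>"
proof -
  have "input_number (\<pi> @ \<tau>) = push_bits (input_number \<pi>) \<tau>"
    by (simp add: input_number_def)
  then show ?thesis
    using foldl_bits_bounds[of "input_number \<pi>" \<tau>]
    by (intro div_nat_eqI) (auto simp: mult.commute)
qed

lemma header_length:
  assumes "header_is k (input_number \<pi>) a"
  shows "length \<pi> = (k + 1) * a + 1"
proof -
  let ?u = "input_number \<pi>" and ?p = "2 ^ (k * a) :: nat"
  have four: "4 \<le> (2::nat) ^ (a + 2)" by (simp add: power_add)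
  have q: "?u div ?p = 2 ^ (a + 2) - 2" using assms by (simp add: header_is_def)
  have "?p * (2 ^ (a + 2) - 2) \<le> ?u" using q by (metis times_div_less_eq_dividend)
  moreover have "?p * 2 ^ (a + 1) \<le> ?p * (2 ^ (a + 2) - 2)"
  proof (rule mult_le_mono2)
    have "2 \<le> (2::nat) ^ (a + 1)" "(2::nat) ^ (a + 2) = 2 * 2 ^ (a + 1)" by simp_all
    then show "2 ^ (a + 1) \<le> (2::nat) ^ (a + 2) - 2" by linarith
  qed
  ultimately have lo: "2 ^ (k * a + (a + 1)) \<le> ?u" unfolding power_add[of 2 "k * a"] by (rule le_trans[rotated])
  have "?u < ?p * (2 ^ (a + 2) - 2 + 1)" using dividend_less_times_div[of ?p ?u] by (simp add: q)
  also have "\<dots> \<le> ?p * 2 ^ (a + 2)" using four by (intro mult_le_mono2) linarith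
  finally have hi: "?u < 2 ^ (k * a + (a + 2))" by (simp only: power_add[of 2 "k * a"])
  have "(2::nat) ^ (k * a + (a + 1)) < 2 ^ Suc (length \<pi>)"
    using lo input_number_bounds(2)[of \<pi>] by linarith
  then have "k * a + (a + 1) < Suc (length \<pi>)" by (rule power_less_imp_less_exp[rotated]) simp
  moreover have "(2::nat) ^ length \<pi> < 2 ^ (k * a + (a + 2))"
    using hi input_number_bounds(1)[of \<pi>] by linarith
  then have "length \<pi> < k * a + (a + 2)" by (rule power_less_imp_less_exp[rotated]) simp
  ultimately show ?thesis by simp
qed

lemma header_unique:
  assumes "header_is k (input_number \<pi>) a" "header_is k (input_number \<pi>) b" shows "a = b"
proof -
  have "(k + 1) * a = (k + 1) * b" using header_length[OF assms(1)] header_length[OF assms(2)] by linarith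
  then show ?thesis by (simp only: mult_cancel1) simp
qed

text \<open>Suppose that a program with header \<open>b > a\<close> extends one with header \<open>a\<close>. Its first \<open>a + 1\<close> bits are ones, whereas the shorter
program has a zero as bit \<open>a + 1\<close>.\<close>

lemma header_prefix_free:
  assumes a: "header_is k (input_number \<pi>) a" and b: "header_is k (input_number \<pi>') b"
    and "prefix \<pi> \<pi>'"
  shows "\<pi> = \<pi>'"
proof -
  obtain \<tau> where \<tau>: "\<pi>' = \<pi> @ \<tau>" using assms(3) by (auto simp: prefix_def)
  have len: "(k + 1) * b + 1 = (k + 1) * a + 1 + length \<tau>"
    using header_length[OF a] header_length[OF b] by (simp add: \<tau>)
  then have "(k + 1) * a \<le> (k + 1) * b" by linarith
  then have ab: "a \<le> b" by (simp only: mult_le_cancel1)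
  have "a = b"
  proof (rule ccontr)
    assume "a \<noteq> b"
    then obtain e where e: "b = a + Suc e" using ab less_imp_Suc_add[of a b] by auto
    let ?u' = "input_number \<pi>'"
    have eq: "length \<tau> + k * a = k * b + Suc e" using len by (simp add: e algebra_simps)
    have "?u' div 2 ^ (length \<tau> + k * a) = 2 ^ (a + 2) - 2"
      using a by (simp add: power_add div_mult2_eq \<tau> input_number_append_div header_is_def)
    moreover have "?u' div 2 ^ (k * b + Suc e) = (2 ^ (b + 2) - 2) div 2 ^ Suc e"
      using b by (simp only: power_add[of 2 "k * b"] div_mult2_eq header_is_def)
    ultimately have "(2 ^ (b + 2) - 2) div 2 ^ Suc e = (2 ^ (a + 2) - 2 :: nat)" by (simp only: eq)
    moreover have "(2 ^ (b + 2) - 2) div 2 ^ Suc e = (2 ^ (a + 2) - 1 :: nat)"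
    proof (rule div_nat_eqI)
      define X where "X = (2::nat) ^ (a + 2)"
      define Y where "Y = (2::nat) ^ Suc e"
      have X: "X \<ge> 4" by (simp add: X_def power_add)
      have Y: "Y \<ge> 2" by (simp add: Y_def)
      have XY: "2 ^ (b + 2) = X * Y" by (simp add: X_def Y_def e power_add)
      have "(X - 1) * Y + Y = X * Y" using X by (simp add: algebra_simps)
      then show "2 ^ Suc e * (2 ^ (a + 2) - 1) \<le> 2 ^ (b + 2) - (2::nat)"
        using Y unfolding XY X_def[symmetric] Y_def[symmetric] by (simp add: mult.commute)
      have "4 * 2 \<le> X * Y" using X Y by (rule mult_le_mono)
      then show "2 ^ (b + 2) - 2 < 2 ^ Suc e * Suc (2 ^ (a + 2) - (1::nat))"
        using X unfolding XY X_def[symmetric] Y_def[symmetric] by (simp add: mult.commute)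
    qed
    moreover have "(2::nat) ^ (a + 2) \<ge> 4" by (simp add: power_add)
    ultimately show False by linarith
  qed
  then show ?thesis using len \<tau> by simp
qed

lemma bits_of_length:
  "w < 2 ^ n \<Longrightarrow> \<exists>ys. length ys = n \<and>
    (\<forall>x. push_bits x ys = x * 2 ^ n + (w :: nat))"
proof (induction n arbitrary: w)
  case (Suc n)
  then have "w div 2 < 2 ^ n" by auto
  then obtain ys where ys: "length ys = n"
    "\<And>x. push_bits x ys = x * 2 ^ n + w div 2"
    using Suc.IH by blast
  have "2 * (w div 2) + of_bool (odd w) = w" by (simp only: of_bool_odd_eq_mod_2 mult_div_mod_eq)
  then have "push_bits x (ys @ [odd w]) = x * 2 ^ Suc n + w" for x
    using ys(2)[of x] by (simp add: algebra_simps)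
  then show ?case using ys(1) by (intro exI[of _ "ys @ [odd w]"]) auto
qed simp

lemma program_exists:
  assumes "w < 2 ^ (k * a)"
  shows "\<exists>\<pi>. length \<pi> = (k + 1) * a + 1 \<and> header_is k (input_number \<pi>) a \<and>
    input_number \<pi> mod 2 ^ (k * a) = w \<and> a < input_number \<pi>"
proof -
  obtain ys where ys: "length ys = k * a"
    "\<And>x. push_bits x ys = x * 2 ^ (k * a) + w"
    using bits_of_length[OF assms] by blast
  have ones: "Suc (push_bits 1 (replicate n True)) = 2 ^ Suc n" for n
  proof (induction n)
    case (Suc n)
    have "replicate (Suc n) True = replicate n True @ [True]" by (simp add: replicate_append_same)
    then show ?case using Suc by (simp del: replicate_Suc)
  qed simp
  have num: "input_number (replicate a True @ False # ys) = (2 ^ (a + 2) - 2) * 2 ^ (k * a) + w"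
  proof -
    have "2 * push_bits 1 (replicate a True) = 2 ^ (a + 2) - (2::nat)"
      using ones[of a] by simp
    then show ?thesis by (simp add: input_number_def ys(2))
  qed
  have "length (replicate a True @ False # ys) = (k + 1) * a + 1" by (simp add: ys)
  moreover have "header_is k (input_number (replicate a True @ False # ys)) a"
    using assms unfolding header_is_def num by simp
  moreover have "input_number (replicate a True @ False # ys) mod 2 ^ (k * a) = w"
    using assms unfolding num by simp
  moreover have "a < input_number (replicate a True @ False # ys)"
  proof -
    have "a < (2::nat) ^ a" by simp
    also have "\<dots> \<le> 2 ^ ((k + 1) * a + 1)" by (rule power_increasing) auto
    also have "\<dots> \<le> input_number (replicate a True @ False # ys)"
      using input_number_bounds(1)[of "replicate a True @ False # ys"] by (simp add: ys)
    finally show ?thesis .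
  qed
  ultimately show ?thesis by blast
qed

text \<open>Every number that is primitive recursive in the list of cubes, in \<open>a\<close> and in a payload of \<open>k * a\<close> bits has
complexity at most \<open>(k + 1) * a\<close>, up to a constant that depends on the function and on \<open>k\<close>.\<close>

theorem kolm_upper_bound:
  assumes U: "universal_prefix_tm U" and \<Phi>: "oracle_tm \<Phi>"
    and G: "prec (\<lambda>\<rho>. G (\<rho> 0) (\<rho> 1) (\<rho> 2))"
  shows "\<exists>c. \<forall>A v a w. tm_outputs_at \<Phi> A 1 0 v \<longrightarrow> w < 2 ^ (k * a) \<longrightarrow>
    kolm U A (nat_string (G a w v)) \<le> c + (k + 1) * a"
proof -
  define valid where "valid u \<longleftrightarrow> (\<exists>a<u. header_is k u a)" for u
  define header where "header u = (\<Sum>a<u. of_bool (header_is k u a) * a)" for u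
  define F where "F u v = G (header u) (u mod 2 ^ (k * header u)) v" for u v
  have dec: "decidable (\<lambda>\<rho>. valid (\<rho> 0))"
    unfolding valid_def header_is_def by (intro prec_intros)
  have hd: "prec (\<lambda>\<rho>. header (\<rho> 0))"
    unfolding header_def header_is_def by (intro prec_intros)
  have hd1: "prec (\<lambda>\<rho>. header (\<rho> 1))" by (rule prec_comp1[OF hd prec_var])
  have arg: "prec (\<lambda>\<rho>. \<rho> 1 mod 2 ^ (k * header (\<rho> 1)))" by (intro prec_intros hd1)
  have "prec (\<lambda>\<rho>. F (\<rho> 1) (\<rho> 0))"
    using prec_comp[OF G, of "\<lambda>i. if i = 0 then (\<lambda>\<rho>. header (\<rho> 1))
        else if i = 1 then (\<lambda>\<rho>. \<rho> 1 mod 2 ^ (k * header (\<rho> 1))) else (\<lambda>\<rho>. \<rho> 0)"] hd1 arg prec_var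
    by (simp add: F_def)
  from machine_of_prec[OF \<Phi> dec this] obtain M where M: "oracle_tm M"
    "\<And>A \<pi> \<sigma>. tm_computes M A \<pi> \<sigma> \<Longrightarrow> valid (input_number \<pi>)"
    "\<And>A \<pi> v. tm_outputs_at \<Phi> A 1 0 v \<Longrightarrow> valid (input_number \<pi>) \<Longrightarrow>
        tm_computes M A \<pi> (nat_string (F (input_number \<pi>) v))" by blast
  have "prefix_tm M"
    unfolding prefix_tm_def using M(1,2) header_prefix_free unfolding valid_def by blast
  then obtain \<rho> where \<rho>: "\<And>A \<pi> \<sigma>. tm_computes U A (\<rho> @ \<pi>) \<sigma> \<longleftrightarrow> tm_computes M A \<pi> \<sigma>"
    using U unfolding universal_prefix_tm_def by blast
  have "kolm U A (nat_string (G a w v)) \<le> length \<rho> + 1 + (k + 1) * a"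
    if out: "tm_outputs_at \<Phi> A 1 0 v" and w: "w < 2 ^ (k * a)" for A v a w
  proof -
    obtain \<pi> where \<pi>: "length \<pi> = (k + 1) * a + 1" "header_is k (input_number \<pi>) a"
      "input_number \<pi> mod 2 ^ (k * a) = w" "a < input_number \<pi>"
      using program_exists[OF w] by blast
    have "header (input_number \<pi>) = a"
      unfolding header_def using \<pi>(2,4) header_unique by (intro sum_pick) blast+
    then have "tm_computes M A \<pi> (nat_string (G a w v))"
      using M(3)[OF out, of \<pi>] \<pi> by (auto simp: valid_def F_def)
    then have "\<exists>\<pi>'. length \<pi>' = length (\<rho> @ \<pi>) \<and> tm_computes U A \<pi>' (nat_string (G a w v))"
      using \<rho> by blast
    then have "kolm U A (nat_string (G a w v)) \<le> length (\<rho> @ \<pi>)"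
      unfolding kolm_def by (rule Least_le)
    then show ?thesis by (simp add: \<pi>(1))
  qed
  then show ?thesis by blast
qed

section \<open>The enumeration of bad directions\<close>

lemma prec_comp5:
  assumes "prec (\<lambda>\<sigma>. F (\<sigma> 0) (\<sigma> 1) (\<sigma> 2) (\<sigma> 3) (\<sigma> 4))"
    "prec f" "prec g" "prec h" "prec i" "prec j"
  shows "prec (\<lambda>\<rho>. F (f \<rho>) (g \<rho>) (h \<rho>) (i \<rho>) (j \<rho>))"
  using prec_comp[OF assms(1), of "\<lambda>c. if c = 0 then f else if c = 1 then g else if c = 2 then h
     else if c = 3 then i else j"] assms by simp

text \<open>Directions on the grid are numbered by their digits in base \<open>b\<close>, one digit for each coordinate.\<close>

definition digit :: "nat \<Rightarrow> nat \<Rightarrow> nat \<Rightarrow> nat" where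
  "digit b z c = z div b ^ c mod b"

lemma digit_0 [simp]: "digit b z 0 = z mod b"
  and digit_Suc [simp]: "digit b z (Suc c) = digit b (z div b) c"
  by (simp_all add: digit_def div_mult2_eq)

lemma digits_inject:
  "z < b ^ d \<Longrightarrow> z' < b ^ d \<Longrightarrow> (\<And>c. c < d \<Longrightarrow> digit b z c = digit b z' c) \<Longrightarrow> z = z'"
proof (induction d arbitrary: z z')
  case (Suc d)
  have "z div b < b ^ d" "z' div b < b ^ d"
    using Suc.prems by (simp_all add: less_mult_imp_div_less mult.commute)
  moreover have "digit b (z div b) c = digit b (z' div b) c" if "c < d" for c
    using Suc.prems(3)[of "Suc c"] that by simp
  ultimately have "z div b = z' div b" by (rule Suc.IH)
  moreover have "z mod b = z' mod b" using Suc.prems(3)[of 0] by simp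
  ultimately show ?case by (metis div_mult_mod_eq)
qed simp

lemma digits_exist:
  "(\<And>c. c < d \<Longrightarrow> y c < b) \<Longrightarrow> \<exists>z < b ^ d. \<forall>c<d. digit b z c = y c"
proof (induction d arbitrary: y)
  case (Suc d)
  have "\<exists>z < b ^ d. \<forall>c<d. digit b z c = y (Suc c)"
    by (rule Suc.IH) (simp add: Suc.prems)
  then obtain z where z: "z < b ^ d" "\<And>c. c < d \<Longrightarrow> digit b z c = y (Suc c)" by blast
  have y0: "y 0 < b" using Suc.prems[of 0] by simp
  have "b * z + y 0 < b ^ Suc d"
  proof -
    have "b * z + y 0 < b * Suc z" using y0 by simp
    also have "\<dots> \<le> b * b ^ d" using z(1) by (intro mult_le_mono2) simp
    finally show ?thesis by simp
  qed
  moreover have "digit b (b * z + y 0) c = y c" if "c < Suc d" for c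
    using that y0 z(2) by (cases c) (auto simp: div_add1_eq)
  ultimately show ?case by blast
qed auto

abbreviation code_tail :: "nat \<Rightarrow> nat" where
  "code_tail w \<equiv> snd (prod_decode (w - 1))"

text \<open>The list of cubes may contain repetitions. Pairs of cubes are therefore counted through membership.\<close>

definition code_mem :: "nat \<Rightarrow> nat \<Rightarrow> bool" where
  "code_mem v x \<longleftrightarrow> (\<exists>i<v. ((\<lambda>w. code_tail w) ^^ i) v \<noteq> 0 \<and> code_nth v i = x)"

lemma length_le_list_encode: "length xs \<le> list_encode xs"
proof (induction xs)
  case (Cons x xs)
  then show ?case using le_prod_encode_2[of "list_encode xs" x] by simp
qed simp

lemma mem_less_list_encode: "x \<in> set xs \<Longrightarrow> x < list_encode xs"
proof (induction xs)
  case (Cons y xs)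
  then show ?case using le_prod_encode_2[of "list_encode xs" y] le_prod_encode_1[of y "list_encode xs"]
    by (auto simp: less_Suc_eq_le)
qed simp

lemma code_mem_list_encode: "code_mem (list_encode xs) x \<longleftrightarrow> x \<in> set xs"
proof
  assume "code_mem (list_encode xs) x"
  then obtain i where i: "((\<lambda>w. code_tail w) ^^ i) (list_encode xs) \<noteq> 0" "code_nth (list_encode xs) i = x"
    by (auto simp: code_mem_def)
  have "i < length xs"
  proof (rule ccontr)
    assume "\<not> i < length xs"
    then obtain e where e: "i = e + length xs" by (metis add.commute le_Suc_ex not_less)
    have "prod_encode (0, 0) = 0" by (simp add: prod_encode_def)
    then have z: "snd (prod_decode 0) = 0" by (metis prod_encode_inverse snd_conv)
    have "((\<lambda>w. code_tail w) ^^ n) 0 = 0" for n by (induction n) (auto simp: z)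
    then have "((\<lambda>w. code_tail w) ^^ i) (list_encode xs) = 0"
      unfolding e funpow_add o_apply using funpow_drop_list_encode[of "length xs" xs] by simp
    then show False using i by simp
  qed
  then show "x \<in> set xs" using i(2) code_nth_list_encode by fastforce
next
  assume "x \<in> set xs"
  then obtain i where i: "i < length xs" "xs ! i = x" by (auto simp: in_set_conv_nth)
  have "drop i xs = xs ! i # drop (Suc i) xs" by (simp only: Cons_nth_drop_Suc[OF i(1)])
  then have "((\<lambda>w. code_tail w) ^^ i) (list_encode xs) \<noteq> 0"
    using i funpow_drop_list_encode[of i xs] by simp
  moreover have "i < list_encode xs" using i length_le_list_encode[of xs] by linarith
  ultimately show "code_mem (list_encode xs) x"
    using i code_nth_list_encode unfolding code_mem_def by blast
qed

text \<open>With \<open>b = 2 * M\<close>, digit \<open>y\<close> stands for the coordinate \<open>(2 * y + 1 - b) / M\<close>. Odd numerators over the power of two \<open>M\<close>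
are fractions in lowest terms, as \<open>rat_code\<close> requires. All quantities are kept in the natural numbers by adding \<open>b\<close>
to the numerators and by moving negative terms to the other side.\<close>

definition numerator_shift :: "nat \<Rightarrow> nat \<Rightarrow> nat \<Rightarrow> nat" where
  "numerator_shift b z c = 2 * digit b z c + 1"

text \<open>Arithmetical versions of the notions \<open>close_pairs\<close>, \<open>near_sphere\<close> and \<open>bad_directions\<close> below. The coordinates
of the cubes are nonnegative, so \<open>int_encode\<close> doubles them. In \<open>code_shell\<close> everything is multiplied by 4, because \<open>b\<close> is
twice the denominator \<open>M\<close>.\<close>

definition code_pairs :: "nat \<Rightarrow> nat \<Rightarrow> nat \<Rightarrow> nat \<Rightarrow> nat \<Rightarrow> nat" where
  "code_pairs d b s v z = (\<Sum>x<v. \<Sum>y<v. of_bool (code_mem v x \<and> code_mem v y \<and>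
     (\<forall>c<d. code_nth x c div 2 div s = code_nth y c div 2 div s) \<and>
     (\<Sum>c<d. code_nth x c div 2 * numerator_shift b z c + code_nth y c div 2 * b)
       \<le> (\<Sum>c<d. code_nth y c div 2 * numerator_shift b z c + code_nth x c div 2 * b) + b \<and>
     (\<Sum>c<d. code_nth y c div 2 * numerator_shift b z c + code_nth x c div 2 * b)
       \<le> (\<Sum>c<d. code_nth x c div 2 * numerator_shift b z c + code_nth y c div 2 * b) + b))"

definition code_shell :: "nat \<Rightarrow> nat \<Rightarrow> nat \<Rightarrow> bool" where
  "code_shell d b z \<longleftrightarrow>
     4 * (\<Sum>c<d. numerator_shift b z c * numerator_shift b z c + b * b)
       \<le> 4 * (\<Sum>c<d. 2 * b * numerator_shift b z c) + b * b + 6 * d * b \<and>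
     4 * (\<Sum>c<d. 2 * b * numerator_shift b z c) + b * b
       \<le> 4 * (\<Sum>c<d. numerator_shift b z c * numerator_shift b z c + b * b) + 6 * d * b"

definition code_bad :: "nat \<Rightarrow> nat \<Rightarrow> nat \<Rightarrow> nat \<Rightarrow> nat \<Rightarrow> nat \<Rightarrow> bool" where
  "code_bad d b s T v z \<longleftrightarrow> code_shell d b z \<and> T \<le> code_pairs d b s v z"

definition code_output :: "nat \<Rightarrow> nat \<Rightarrow> nat \<Rightarrow> nat" where
  "code_output d b z = down (\<lambda>c r. Suc (prod_encode (prod_encode
     (if b \<le> numerator_shift b z c then 2 * (numerator_shift b z c - b)
      else 2 * (b - numerator_shift b z c) - 1, b), r))) d 0"

definition nth_bad :: "nat \<Rightarrow> nat \<Rightarrow> nat \<Rightarrow> nat \<Rightarrow> nat \<Rightarrow> nat \<Rightarrow> nat" where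
  "nth_bad d b s T v j = (\<Sum>z<b ^ d. of_bool (code_bad d b s T v z \<and>
     (\<Sum>z'<z. of_bool (code_bad d b s T v z')) = j) * z)"

definition decoder :: "nat \<Rightarrow> nat \<Rightarrow> nat \<Rightarrow> nat \<Rightarrow> nat \<Rightarrow> nat \<Rightarrow> nat" where
  "decoder d n m t j v =
     code_output d (2 ^ (n + d + 1)) (nth_bad d (2 ^ (n + d + 1)) (2 ^ (n - m)) (2 ^ t) v j)"

lemma prec_numerator_shift [prec_intros]:
  "prec f \<Longrightarrow> prec g \<Longrightarrow> prec h \<Longrightarrow> prec (\<lambda>\<rho>. numerator_shift (f \<rho>) (g \<rho>) (h \<rho>))"
  unfolding numerator_shift_def digit_def by (intro prec_intros)

lemma prec_code_mem [prec_intros]: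
  assumes "prec f" "prec g" shows "decidable (\<lambda>\<rho>. code_mem (f \<rho>) (g \<rho>))"
proof -
  have "prec (\<lambda>\<sigma>. of_bool (code_mem (\<sigma> 0) (\<sigma> 1)))"
    unfolding code_mem_def by (intro prec_intros)
  from prec_comp2[OF this assms] show ?thesis .
qed

lemma prec_code_bad:
  "decidable (\<lambda>\<sigma>. code_bad d (\<sigma> 0) (\<sigma> 1) (\<sigma> 2) (\<sigma> 3) (\<sigma> 4))"
  unfolding code_bad_def code_shell_def code_pairs_def by (intro prec_intros)

lemma prec_nth_bad:
  "prec (\<lambda>\<sigma>. nth_bad d (\<sigma> 0) (\<sigma> 1) (\<sigma> 2) (\<sigma> 3) (\<sigma> 4))"
  unfolding nth_bad_def by (intro prec_intros prec_comp5[OF prec_code_bad])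

lemma prec_code_output [prec_intros]:
  assumes "prec f" "prec g" shows "prec (\<lambda>\<rho>. code_output d (f \<rho>) (g \<rho>))"
proof -
  have "prec (\<lambda>\<sigma>. code_output d (\<sigma> 0) (\<sigma> 1))"
    unfolding code_output_def by (intro prec_intros)
  from prec_comp2[OF this assms] show ?thesis .
qed

lemma prec_decoder:
  assumes "prec n" "prec m" "prec t" "prec j" "prec v"
  shows "prec (\<lambda>\<rho>. decoder d (n \<rho>) (m \<rho>) (t \<rho>) (j \<rho>) (v \<rho>))"
  unfolding decoder_def using assms by (intro prec_intros prec_comp5[OF prec_nth_bad])

text \<open>The coordinates in the order in which \<open>vec_code\<close> lists them.\<close>

definition coords :: "'d::{finite,wellorder} list" where
  "coords = sorted_list_of_set UNIV"

lemma length_coords: "length (coords :: 'd::{finite,wellorder} list) = CARD('d)"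
  and distinct_coords: "distinct (coords :: 'd list)"
  and set_coords: "set (coords :: 'd list) = UNIV"
  by (simp_all add: coords_def)

lemma coords_bij: "bij_betw (\<lambda>c. coords ! c) {..<CARD('d)} (UNIV :: 'd::{finite,wellorder} set)"
  using bij_betw_nth[OF distinct_coords[where 'd = 'd], of "{..<CARD('d)}" UNIV]
  by (simp add: length_coords set_coords)

lemma coords_cases:
  fixes i :: "'d::{finite,wellorder}"
  obtains c where "c < CARD('d)" "coords ! c = i"
  using bij_betw_imp_surj_on[OF coords_bij[where 'd = 'd]] by (metis UNIV_I imageE lessThan_iff)

lemma sum_coords: "(\<Sum>c<CARD('d). f (coords ! c)) = (\<Sum>i\<in>(UNIV :: 'd::{finite,wellorder} set). f i)"
  by (rule sum.reindex_bij_betw[OF coords_bij])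

lemma all_coords: "(\<forall>c<CARD('d). P (coords ! c)) \<longleftrightarrow> (\<forall>i :: 'd::{finite,wellorder}. P i)"
  by (metis coords_cases)

lemma vec_code_coords: "vec_code f (v :: 'a^'d::{finite,wellorder}) = list_encode (map (\<lambda>i. f (v $ i)) coords)"
  by (simp add: vec_code_def coords_def)

lemma vec_code_inject:
  fixes x y :: "'a^'d::{finite,wellorder}"
  assumes "inj f" "vec_code f x = vec_code f y" shows "x = y"
proof -
  have "map (\<lambda>i. f (x $ i)) coords = map (\<lambda>i. f (y $ i)) (coords :: 'd list)"
    using assms(2) unfolding vec_code_coords by (metis list_encode_inverse)
  then show ?thesis using assms(1) by (auto simp: vec_eq_iff set_coords inj_def)
qed

definition numerators :: "nat \<Rightarrow> nat \<Rightarrow> int^'d::{finite,wellorder}" where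
  "numerators b z = (\<chi> i. int (numerator_shift b z (inv_into {..<CARD('d)} (\<lambda>c. coords ! c) i)) - int b)"

lemma numerators_coord:
  "c < CARD('d) \<Longrightarrow> (numerators b z :: int^'d::{finite,wellorder}) $ (coords ! c) = int (numerator_shift b z c) - int b"
  using bij_betw_inv_into_left[OF coords_bij[where 'd = 'd], of c] by (simp add: numerators_def)

definition direction_box :: "nat \<Rightarrow> (int^'d) set" where
  "direction_box b = {a. \<forall>i. odd (a $ i) \<and> \<bar>a $ i\<bar> < int b}"

text \<open>With \<open>b = 2 * M\<close> the condition reads \<open>| |a|^2 - M^2 | \<le> 3 * d * M\<close>: the point \<open>a / M\<close> is within \<open>O(1 / M)\<close> of the unit sphere.\<close>

definition near_sphere :: "nat \<Rightarrow> (int^'d) \<Rightarrow> bool" where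
  "near_sphere b a \<longleftrightarrow> \<bar>4 * (\<Sum>i\<in>UNIV. (a $ i)\<^sup>2) - (int b)\<^sup>2\<bar> \<le> 6 * int CARD('d) * int b"

text \<open>The pairs in a common cell of side \<open>s\<close> whose projections in the direction of \<open>a\<close> nearly agree. For \<open>C = b = 2 * M\<close> the
projections to the direction \<open>a / M\<close> differ by at most 2, in units of the side \<open>\<delta>\<close> of the cubes.\<close>

definition close_pairs :: "int \<Rightarrow> int \<Rightarrow> (int^'d) set \<Rightarrow> int^'d \<Rightarrow> ((int^'d) \<times> (int^'d)) set" where
  "close_pairs C s K a = {(x, y) \<in> K \<times> K. (\<forall>i. x $ i div s = y $ i div s) \<and>
     \<bar>\<Sum>i\<in>UNIV. (x $ i - y $ i) * a $ i\<bar> \<le> C}"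

definition bad_directions :: "nat \<Rightarrow> int \<Rightarrow> nat \<Rightarrow> (int^'d) set \<Rightarrow> (int^'d) set" where
  "bad_directions b s T K = {a \<in> direction_box b. near_sphere b a \<and> T \<le> card (close_pairs (int b) s K a)}"

lemma numerators_in_box:
  assumes "even b" "0 < b"
  shows "(numerators b z :: int^'d::{finite,wellorder}) \<in> direction_box b"
proof -
  have "odd ((numerators b z :: int^'d::_) $ (coords ! c)) \<and> \<bar>(numerators b z :: int^'d::_) $ (coords ! c)\<bar> < int b"
    if "c < CARD('d)" for c
  proof -
    have "digit b z c < b" using assms by (simp add: digit_def)
    then show ?thesis using assms that by (auto simp: numerators_coord numerator_shift_def)
  qed
  then show ?thesis unfolding direction_box_def by (simp flip: all_coords)
qed

lemma numerators_inject:
  assumes "(numerators b z :: int^'d::{finite,wellorder}) = numerators b z'" "z < b ^ CARD('d)" "z' < b ^ CARD('d)"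
  shows "z = z'"
proof (rule digits_inject[OF assms(2,3)])
  fix c assume "c < CARD('d)"
  then show "digit b z c = digit b z' c"
    using numerators_coord[of c b z, where 'd = 'd] numerators_coord[of c b z', where 'd = 'd] assms(1)
    by (simp add: numerator_shift_def)
qed

lemma numerators_surj:
  assumes "even b" and a: "(a :: int^'d::{finite,wellorder}) \<in> direction_box b"
  shows "\<exists>z < b ^ CARD('d). numerators b z = a"
proof -
  define y where "y c = nat ((a $ (coords ! c) + int b - 1) div 2)" for c
  have ai: "odd (a $ i)" "\<bar>a $ i\<bar> < int b" for i using a by (auto simp: direction_box_def)
  have y: "2 * int (y c) + 1 = a $ (coords ! c) + int b" for c
  proof -
    have "even (a $ (coords ! c) + int b - 1)" using ai(1) assms(1) by simp
    moreover have "0 \<le> a $ (coords ! c) + int b - 1" using ai(2)[of "coords ! c"] by linarith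
    ultimately show ?thesis unfolding y_def by (simp add: pos_imp_zdiv_nonneg_iff)
  qed
  have "y c < b" for c using y[of c] ai(2)[of "coords ! c"] by linarith
  then obtain z where z: "z < b ^ CARD('d)" "\<forall>c<CARD('d). digit b z c = y c"
    using digits_exist[of "CARD('d)" y b] by blast
  have "(numerators b z :: int^'d::_) $ (coords ! c) = a $ (coords ! c)" if "c < CARD('d)" for c
    using y[of c] z(2) that by (simp add: numerators_coord numerator_shift_def)
  then have "numerators b z = a" unfolding vec_eq_iff by (simp flip: all_coords)
  then show ?thesis using z(1) by blast
qed

lemma code_shell_iff:
  "code_shell CARD('d) b z \<longleftrightarrow> near_sphere b (numerators b z :: int^'d::{finite,wellorder})"
proof -
  let ?\<alpha> = "\<lambda>c. int (numerator_shift b z c)"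
  let ?d = "CARD('d)"
  have "(\<Sum>i\<in>UNIV. ((numerators b z :: int^'d::_) $ i)\<^sup>2) = (\<Sum>c<?d. (?\<alpha> c - int b)\<^sup>2)"
    unfolding sum_coords[symmetric] by (rule sum.cong) (auto simp: numerators_coord)
  also have "\<dots> = (\<Sum>c<?d. ?\<alpha> c * ?\<alpha> c + int b * int b) - (\<Sum>c<?d. 2 * int b * ?\<alpha> c)"
    by (simp add: power2_eq_square algebra_simps sum.distrib sum_subtractf)
  finally have eq: "(\<Sum>i\<in>UNIV. ((numerators b z :: int^'d::_) $ i)\<^sup>2) =
      int (\<Sum>c<?d. numerator_shift b z c * numerator_shift b z c + b * b) - int (\<Sum>c<?d. 2 * b * numerator_shift b z c)"
    by simp
  have arith: "4 * X \<le> 4 * Y + c + e \<and> 4 * Y + c \<le> 4 * X + e \<longleftrightarrow>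
      4 * (X - Y) - c \<le> e \<and> - (4 * (X - Y) - c) \<le> e" for X Y c e :: int
    by auto
  show ?thesis
    unfolding code_shell_def near_sphere_def eq
    unfolding zle_int[symmetric] power2_eq_square
    by (simp only: of_nat_add of_nat_mult of_nat_numeral abs_le_iff arith)
qed

lemma code_pairs_eq:
  fixes ks :: "(int^'d::{finite,wellorder}) list"
  assumes nonneg: "\<And>k i. k \<in> set ks \<Longrightarrow> 0 \<le> k $ i"
  defines "v \<equiv> list_encode (map (vec_code int_encode) ks)"
  shows "code_pairs CARD('d) b s v z = card (close_pairs (int b) (int s) (set ks) (numerators b z))"
proof -
  let ?d = "CARD('d)"
  let ?e = "vec_code int_encode :: int^'d::_ \<Rightarrow> nat"
  have mem: "code_mem v x \<longleftrightarrow> x \<in> ?e ` set ks" for x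
    by (simp add: v_def code_mem_list_encode)
  have coord: "int (code_nth (?e k) c div 2) = k $ (coords ! c)" if "k \<in> set ks" "c < ?d" for k c
    using that nonneg[of k "coords ! c"]
    by (simp add: vec_code_coords code_nth_list_encode length_coords int_encode_def sum_encode_def)
  define Q where "Q x y \<longleftrightarrow> (\<forall>c<?d. code_nth x c div 2 div s = code_nth y c div 2 div s) \<and>
     (\<Sum>c<?d. code_nth x c div 2 * numerator_shift b z c + code_nth y c div 2 * b)
       \<le> (\<Sum>c<?d. code_nth y c div 2 * numerator_shift b z c + code_nth x c div 2 * b) + b \<and>
     (\<Sum>c<?d. code_nth y c div 2 * numerator_shift b z c + code_nth x c div 2 * b)
       \<le> (\<Sum>c<?d. code_nth x c div 2 * numerator_shift b z c + code_nth y c div 2 * b) + b" for x y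
  have Q: "Q (?e k) (?e l) \<longleftrightarrow> (k, l) \<in> close_pairs (int b) (int s) (set ks) (numerators b z)"
    if kl: "k \<in> set ks" "l \<in> set ks" for k l
  proof -
    have 1: "(\<forall>c<?d. code_nth (?e k) c div 2 div s = code_nth (?e l) c div 2 div s) \<longleftrightarrow>
       (\<forall>i. k $ i div int s = l $ i div int s)"
      unfolding all_coords[symmetric, of "\<lambda>i. k $ i div int s = l $ i div int s"]
      using kl by (simp add: coord[symmetric] zdiv_int[symmetric])
    let ?X = "\<Sum>c<?d. code_nth (?e k) c div 2 * numerator_shift b z c + code_nth (?e l) c div 2 * b"
    let ?Y = "\<Sum>c<?d. code_nth (?e l) c div 2 * numerator_shift b z c + code_nth (?e k) c div 2 * b"
    have "(\<Sum>i\<in>UNIV. (k $ i - l $ i) * (numerators b z :: int^'d::_) $ i) =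
       (\<Sum>c<?d. (k $ (coords ! c) - l $ (coords ! c)) * (int (numerator_shift b z c) - int b))"
      unfolding sum_coords[symmetric] by (rule sum.cong) (auto simp: numerators_coord)
    also have "\<dots> = (\<Sum>c<?d. int (code_nth (?e k) c div 2 * numerator_shift b z c + code_nth (?e l) c div 2 * b)
        - int (code_nth (?e l) c div 2 * numerator_shift b z c + code_nth (?e k) c div 2 * b))"
      by (rule sum.cong) (use kl in \<open>auto simp: coord algebra_simps simp del: of_nat_div\<close>)
    also have "\<dots> = int ?X - int ?Y" by (simp only: sum_subtractf of_nat_sum)
    finally have "\<bar>\<Sum>i\<in>UNIV. (k $ i - l $ i) * (numerators b z :: int^'d::_) $ i\<bar> \<le> int b \<longleftrightarrow>
        ?X \<le> ?Y + b \<and> ?Y \<le> ?X + b" by linarith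
    then show ?thesis using kl 1 unfolding Q_def close_pairs_def by simp
  qed
  have inj: "inj_on (map_prod ?e ?e) (close_pairs (int b) (int s) (set ks) (numerators b z))"
    using vec_code_inject[OF inj_int_encode] by (auto simp: inj_on_def)
  have fin: "?e ` set ks \<subseteq> {..<v}"
    using mem_less_list_encode[of _ "map ?e ks"] by (auto simp: v_def)
  have "code_pairs ?d b s v z = (\<Sum>x<v. \<Sum>y<v. of_bool (x \<in> ?e ` set ks \<and> y \<in> ?e ` set ks \<and> Q x y))"
    unfolding code_pairs_def Q_def mem ..
  also have "\<dots> = (\<Sum>p\<in>{..<v} \<times> {..<v}. of_bool (fst p \<in> ?e ` set ks \<and> snd p \<in> ?e ` set ks \<and> Q (fst p) (snd p)))"
    unfolding sum.cartesian_product by (rule sum.cong) (auto simp only: case_prod_beta)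
  also have "\<dots> = card (({..<v} \<times> {..<v}) \<inter>
      {p. fst p \<in> ?e ` set ks \<and> snd p \<in> ?e ` set ks \<and> Q (fst p) (snd p)})"
    by (subst sum_of_bool_eq) simp_all
  also have "({..<v} \<times> {..<v}) \<inter>
      {p. fst p \<in> ?e ` set ks \<and> snd p \<in> ?e ` set ks \<and> Q (fst p) (snd p)} =
     map_prod ?e ?e ` close_pairs (int b) (int s) (set ks) (numerators b z)" (is "?L = ?R")
  proof (intro set_eqI iffI)
    fix p assume "p \<in> ?L"
    then obtain k l where "k \<in> set ks" "l \<in> set ks" "p = (?e k, ?e l)" "Q (?e k) (?e l)"
      by (cases p) auto
    then show "p \<in> ?R" using Q by force
  next
    fix p assume "p \<in> ?R"
    then obtain k l where kl: "(k, l) \<in> close_pairs (int b) (int s) (set ks) (numerators b z)"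
      and p: "p = (?e k, ?e l)" by auto
    then have "k \<in> set ks" "l \<in> set ks" by (auto simp: close_pairs_def)
    then show "p \<in> ?L" using kl p Q fin by auto
  qed
  also have "card \<dots> = card (close_pairs (int b) (int s) (set ks) (numerators b z))"
    by (rule card_image[OF inj])
  finally show ?thesis .
qed

lemma down_list_encode:
  "down (\<lambda>c r. Suc (prod_encode (f c, r))) n (list_encode xs) = list_encode (map f [0..<n] @ xs)"
proof (induction n arbitrary: xs)
  case (Suc n)
  have "Suc (prod_encode (f n, list_encode xs)) = list_encode (f n # xs)" by simp
  then show ?case using Suc[of "f n # xs"] by (simp del: list_encode.simps)
qed simp

lemma int_encode_of_nat: "int_encode (int x) = 2 * x"
  by (simp add: int_encode_def sum_encode_def)

lemma int_encode_diff:
  "int_encode (int x - int b) = (if b \<le> x then 2 * (x - b) else 2 * (b - x) - 1)"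
  by (auto simp: int_encode_def sum_encode_def nat_diff_distrib Suc_diff_Suc nat_eq_iff)

lemma rat_code_dyadic:
  assumes "odd a"
  shows "rat_code (of_int a / 2 ^ N) = prod_encode (int_encode a, 2 ^ (N + 1))"
proof -
  have "(of_int a / 2 ^ N :: rat) = Fract a (2 ^ N)"
    by (simp add: Fract_of_int_quotient)
  moreover have "coprime a (2 ^ N)" using assms by (simp add: coprime_right_2_iff_odd)
  ultimately have "quotient_of (of_int a / 2 ^ N) = (a, 2 ^ N)"
    by (simp add: quotient_of_Fract normalize_stable)
  moreover have "int_encode (2 ^ N) = 2 ^ (N + 1)" using int_encode_of_nat[of "2 ^ N"] by simp
  ultimately show ?thesis by (simp add: rat_code_def)
qed

lemma code_output_eq:
  fixes N :: nat
  defines "b \<equiv> 2 ^ (N + 1)"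
  shows "code_output CARD('d) b z =
     vec_code rat_code (\<chi> i. (of_int ((numerators b z :: int^'d::{finite,wellorder}) $ i) / 2 ^ N :: rat))"
proof -
  let ?a = "numerators b z :: int^'d::_"
  let ?f = "\<lambda>c. prod_encode
     (if b \<le> numerator_shift b z c then 2 * (numerator_shift b z c - b)
      else 2 * (b - numerator_shift b z c) - 1, b)"
  have "code_output CARD('d) b z = list_encode (map ?f [0..<CARD('d)])"
    using down_list_encode[of _ "CARD('d)" "[]"] by (simp add: code_output_def)
  also have "map ?f [0..<CARD('d)] =
     map (\<lambda>i. rat_code ((\<chi> i. of_int (?a $ i) / 2 ^ N) $ i)) coords"
  proof (rule nth_equalityI)
    fix c assume "c < length (map ?f [0..<CARD('d)])"
    then have c: "c < CARD('d)" by simp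
    have "?a \<in> direction_box b" by (rule numerators_in_box) (simp_all add: b_def)
    then have "odd (?a $ (coords ! c))" by (simp add: direction_box_def)
    from rat_code_dyadic[OF this, of N]
    have "rat_code (of_int (?a $ (coords ! c)) / 2 ^ N) =
        prod_encode (if b \<le> numerator_shift b z c then 2 * (numerator_shift b z c - b)
      else 2 * (b - numerator_shift b z c) - 1, b)"
      unfolding numerators_coord[OF c] int_encode_diff by (simp add: b_def)
    then show "map ?f [0..<CARD('d)] ! c =
      map (\<lambda>i. rat_code ((\<chi> i. of_int (?a $ i) / 2 ^ N) $ i)) coords ! c"
      using c by (simp add: length_coords)
  qed (simp add: length_coords)
  finally show ?thesis by (simp add: vec_code_coords)
qed

lemma finite_direction_box: "finite (direction_box b :: (int^'d) set)"
proof -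
  have "direction_box b \<subseteq> (vec_lambda ` (UNIV \<rightarrow>\<^sub>E {- int b..int b}) :: (int^'d) set)"
  proof
    fix a :: "int^'d" assume "a \<in> direction_box b"
    then have "\<bar>a $ i\<bar> < int b" for i by (auto simp: direction_box_def)
    then have "- int b \<le> a $ i \<and> a $ i \<le> int b" for i by (meson abs_le_iff less_imp_le minus_le_iff)
    then have "vec_nth a \<in> UNIV \<rightarrow>\<^sub>E {- int b..int b}" by (auto simp: PiE_def)
    then show "a \<in> vec_lambda ` (UNIV \<rightarrow>\<^sub>E {- int b..int b})" by (metis image_eqI vec_nth_inverse)
  qed
  then show ?thesis by (rule finite_subset) (auto intro!: finite_imageI finite_PiE)
qed

lemma finite_bad_directions: "finite (bad_directions b s T K)"
  by (rule finite_subset[OF _ finite_direction_box[of b]]) (auto simp: bad_directions_def)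

lemma sum_of_bool_lessThan: "(\<Sum>z<n. of_bool (P z)) = card {z. z < (n :: nat) \<and> P z}"
  by (simp add: Int_def)

text \<open>The index \<open>j\<close> of a bad direction is the number of bad directions with a smaller number \<open>z\<close>.\<close>

theorem decoder_selects:
  fixes ks :: "(int^'d::{finite,wellorder}) list"
  assumes nonneg: "\<And>k i. k \<in> set ks \<Longrightarrow> 0 \<le> k $ i"
    and a: "a \<in> bad_directions (2 ^ (n + CARD('d) + 1)) (2 ^ (n - m)) (2 ^ t) (set ks)"
  shows "\<exists>j < card (bad_directions (2 ^ (n + CARD('d) + 1)) (2 ^ (n - m)) (2 ^ t) (set ks)).
    decoder CARD('d) n m t j (list_encode (map (vec_code int_encode) ks)) =
      vec_code rat_code (\<chi> i. (of_int (a $ i) / 2 ^ (n + CARD('d)) :: rat))"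
proof -
  define b :: nat where "b = 2 ^ (n + CARD('d) + 1)"
  define v where "v = list_encode (map (vec_code int_encode) ks)"
  define B where "B = bad_directions b (2 ^ (n - m)) (2 ^ t) (set ks)"
  have b: "even b" "0 < b" by (simp_all add: b_def)
  define bad where "bad z \<longleftrightarrow> code_bad CARD('d) b (2 ^ (n - m)) (2 ^ t) v z" for z
  have bad_iff: "bad z \<longleftrightarrow> numerators b z \<in> B" for z
    using code_pairs_eq[OF nonneg, of ks b "2 ^ (n - m)" z] numerators_in_box[OF b, of z, where 'd = 'd]
    by (simp add: bad_def code_bad_def code_shell_iff[where 'd = 'd] B_def bad_directions_def v_def)
  have aB: "a \<in> B" using a by (simp add: B_def b_def)
  then have "a \<in> direction_box b" by (simp add: B_def bad_directions_def)
  then obtain z where z: "z < b ^ CARD('d)" "numerators b z = a"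
    using numerators_surj[OF b(1)] by blast
  define j where "j = card {z'. z' < z \<and> bad z'}"
  have "j < card {z'. z' < b ^ CARD('d) \<and> bad z'}"
    unfolding j_def using z bad_iff aB by (intro psubset_card_mono) auto
  also have "\<dots> \<le> card B"
    using bad_iff by (intro card_inj_on_le[of "numerators b"])
      (auto simp: inj_on_def numerators_inject B_def finite_bad_directions)
  finally have j: "j < card B" .
  have "nth_bad CARD('d) b (2 ^ (n - m)) (2 ^ t) v j = z"
    unfolding nth_bad_def bad_def[symmetric] sum_of_bool_lessThan
  proof (rule sum_pick[OF z(1)])
    fix y assume "y < b ^ CARD('d)"
    have mono: "card {z'. z' < x \<and> bad z'} < card {z'. z' < x' \<and> bad z'}" if "x < x'" "bad x" for x x'
      using that by (intro psubset_card_mono) auto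
    show "(bad y \<and> card {z'. z' < y \<and> bad z'} = j) = (y = z)"
      using mono[of y z] mono[of z y] bad_iff[of z] z(2) aB unfolding j_def
      by (metis less_irrefl linorder_neqE_nat)
  qed
  then have "decoder CARD('d) n m t j v = code_output CARD('d) b z"
    by (simp add: decoder_def b_def)
  also have "\<dots> = vec_code rat_code (\<chi> i. (of_int (a $ i) / 2 ^ (n + CARD('d)) :: rat))"
    using code_output_eq[of "n + CARD('d)" z, where 'd = 'd] z(2) by (simp add: b_def)
  finally show ?thesis using j unfolding B_def b_def v_def by blast
qed

section \<open>The number of bad directions\<close>

definition int_box :: "nat \<Rightarrow> (int^'d) set" where
  "int_box H = {v. \<forall>i. \<bar>v $ i\<bar> \<le> int H}"

lemma int_box_finite_card: "finite (int_box H :: (int^'d) set)"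
  "card (int_box H :: (int^'d) set) = (2 * H + 1) ^ CARD('d)"
proof -
  have "(int_box H :: (int^'d) set) = vec_lambda ` (UNIV \<rightarrow>\<^sub>E {- int H..int H})"
  proof (intro set_eqI iffI)
    fix v :: "int^'d" assume "v \<in> int_box H"
    then have "vec_nth v \<in> UNIV \<rightarrow>\<^sub>E {- int H..int H}" by (force simp: int_box_def abs_le_iff)
    then show "v \<in> vec_lambda ` (UNIV \<rightarrow>\<^sub>E {- int H..int H})" by (metis image_eqI vec_nth_inverse)
  next
    fix v :: "int^'d" assume "v \<in> vec_lambda ` (UNIV \<rightarrow>\<^sub>E {- int H..int H})"
    then show "v \<in> int_box H" by (auto simp: int_box_def PiE_def Pi_def abs_le_iff minus_le_iff)
  qed
  moreover have "inj_on vec_lambda (UNIV \<rightarrow>\<^sub>E {- int H..int H} :: ('d \<Rightarrow> int) set)"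
    by (auto simp: inj_on_def vec_lambda_inject)
  moreover have "card (UNIV \<rightarrow>\<^sub>E {- int H..int H} :: ('d \<Rightarrow> int) set) = (2 * H + 1) ^ CARD('d)"
  proof -
    have "card {- int H..int H} = 2 * H + 1" by (simp add: nat_eq_iff)
    then show ?thesis by (simp add: card_PiE)
  qed
  ultimately show "finite (int_box H :: (int^'d) set)"
    "card (int_box H :: (int^'d) set) = (2 * H + 1) ^ CARD('d)"
    by (auto simp: card_image intro!: finite_imageI finite_PiE)
qed

text \<open>A slab \<open>|w \<bullet> v| \<le> c * M\<close> takes up a proportion of about \<open>1 / r\<close> of the box, where \<open>r = |w_p|\<close>. Indeed, \<open>r\<close> translates
of the slab by multiples of \<open>h\<close> in direction \<open>p\<close> are disjoint if \<open>h * r > 2 * c * M\<close>, and with \<open>h\<close>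
minimal they all fit in a box of comparable size.\<close>

lemma slab_count:
  fixes w :: "int^'d" and M c :: nat
  assumes M: "1 \<le> M" and R: "\<bar>w $ p\<bar> \<le> int M"
  shows "card {v \<in> int_box (4 * M). \<bar>\<Sum>i\<in>UNIV. w $ i * v $ i\<bar> \<le> int (c * M)} * max 1 (nat \<bar>w $ p\<bar>)
     \<le> ((4 * c + 11) * M) ^ CARD('d)"
proof -
  define H where "H = (2 * c + 5) * M"
  define S where "S = {v \<in> int_box (4 * M). \<bar>\<Sum>i\<in>UNIV. w $ i * v $ i\<bar> \<le> int (c * M)}"
  define r where "r = nat \<bar>w $ p\<bar>"
  have finS: "finite S" unfolding S_def using int_box_finite_card(1) by (rule finite_subset[rotated]) auto
  have "2 * H + 1 \<le> (4 * c + 11) * M" using M by (simp add: H_def algebra_simps)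
  then have box: "card (int_box H :: (int^'d) set) \<le> ((4 * c + 11) * M) ^ CARD('d)"
    unfolding int_box_finite_card(2) by (rule power_mono) simp
  have "card S * max 1 r \<le> card (int_box H :: (int^'d) set)"
  proof (cases "r = 0")
    case True
    have "S \<subseteq> int_box H" by (auto simp: S_def int_box_def H_def algebra_simps intro: order_trans)
    then show ?thesis using True card_mono[OF int_box_finite_card(1)] by simp
  next
    case False
    \<comment> \<open>The least shift that makes the translates disjoint.\<close>
    define h where "h = (2 * c * M) div r + 1"
    have hr: "2 * c * M < h * r" using False by (simp add: h_def dividend_less_div_times)
    have hr': "h * r \<le> (2 * c + 1) * M"
    proof -
      have "h * r = (2 * c * M) div r * r + r" by (simp add: h_def)
      also have "\<dots> \<le> 2 * c * M + r" by (simp add: div_times_less_eq_dividend)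
      finally show ?thesis using R by (simp add: r_def algebra_simps)
    qed
    define f where "f = (\<lambda>(v :: int^'d, \<tau> :: nat). v + axis p (int (\<tau> * h)))"
    have dot: "(\<Sum>i\<in>UNIV. w $ i * f (v, \<tau>) $ i) = (\<Sum>i\<in>UNIV. w $ i * v $ i) + w $ p * int (\<tau> * h)" for v \<tau>
    proof -
      have "(\<Sum>i\<in>UNIV. w $ i * f (v, \<tau>) $ i) =
          (\<Sum>i\<in>UNIV. w $ i * v $ i + (if i = p then w $ p * int (\<tau> * h) else 0))"
        by (rule sum.cong) (auto simp: f_def axis_def algebra_simps)
      then show ?thesis by (simp add: sum.distrib)
    qed
    have "inj_on f (S \<times> {..<r})"
    proof (rule inj_onI, clarify)
      fix v \<tau> v' \<tau>' assume vS: "v \<in> S" "v' \<in> S" and eq: "f (v, \<tau>) = f (v', \<tau>')"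
      have e: "(\<Sum>i\<in>UNIV. w $ i * v $ i) + w $ p * int (\<tau> * h) =
          (\<Sum>i\<in>UNIV. w $ i * v' $ i) + w $ p * int (\<tau>' * h)"
        using dot[of v \<tau>] dot[of v' \<tau>'] eq by simp
      have "\<tau> = \<tau>'"
      proof (rule ccontr)
        assume ne: "\<tau> \<noteq> \<tau>'"
        have "\<bar>w $ p * int h * (int \<tau> - int \<tau>')\<bar> \<le> 2 * int (c * M)"
        proof -
          have "w $ p * int h * (int \<tau> - int \<tau>') = (\<Sum>i\<in>UNIV. w $ i * v' $ i) - (\<Sum>i\<in>UNIV. w $ i * v $ i)"
            using e by (simp add: algebra_simps)
          moreover have "\<bar>\<Sum>i\<in>UNIV. w $ i * v $ i\<bar> \<le> int (c * M)" "\<bar>\<Sum>i\<in>UNIV. w $ i * v' $ i\<bar> \<le> int (c * M)"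
            using vS by (auto simp: S_def)
          ultimately show ?thesis by linarith
        qed
        moreover have "int h * int r * 1 \<le> \<bar>w $ p * int h * (int \<tau> - int \<tau>')\<bar>"
        proof -
          have "\<bar>w $ p * int h * (int \<tau> - int \<tau>')\<bar> = int h * int r * \<bar>int \<tau> - int \<tau>'\<bar>"
            by (simp add: abs_mult r_def)
          moreover have "1 \<le> \<bar>int \<tau> - int \<tau>'\<bar>" using ne by linarith
          ultimately show ?thesis by (metis mult_left_mono of_nat_0_le_iff of_nat_mult)
        qed
        moreover have "2 * int (c * M) < int h * int r" using hr by (metis mult.assoc of_nat_less_iff of_nat_mult of_nat_numeral)
        ultimately show False by linarith
      qed
      then show "v = v' \<and> \<tau> = \<tau>'" using eq by (simp add: f_def)
    qed
    moreover have "f ` (S \<times> {..<r}) \<subseteq> int_box H"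
    proof clarify
      fix v \<tau> assume v: "v \<in> S" and \<tau>: "\<tau> < r"
      have "\<tau> * h \<le> (2 * c + 1) * M"
        using \<tau> hr' by (metis le_trans less_imp_le mult.commute mult_le_mono2)
      then have "\<bar>f (v, \<tau>) $ i\<bar> \<le> int (4 * M) + int ((2 * c + 1) * M)" for i
      proof -
        have "\<bar>v $ i\<bar> \<le> int (4 * M)" using v by (simp add: S_def int_box_def)
        moreover have "0 \<le> axis p (int (\<tau> * h)) $ i" "axis p (int (\<tau> * h)) $ i \<le> int ((2 * c + 1) * M)"
          using \<open>\<tau> * h \<le> (2 * c + 1) * M\<close> unfolding axis_def by (simp_all add: of_nat_le_iff del: of_nat_mult of_nat_add)
        ultimately show ?thesis by (simp add: f_def del: of_nat_mult of_nat_add)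
      qed
      also have "int (4 * M) + int ((2 * c + 1) * M) = int H" by (simp add: H_def algebra_simps)
      finally show "f (v, \<tau>) \<in> int_box H" by (simp add: int_box_def)
    qed
    ultimately have "card (S \<times> {..<r}) \<le> card (int_box H :: (int^'d) set)"
      using int_box_finite_card(1) by (rule card_inj_on_le)
    then show ?thesis using False by (simp add: card_cartesian_product max_def)
  qed
  then show ?thesis using box unfolding S_def r_def by (rule le_trans)
qed

text \<open>Bad directions lie near the unit sphere, where slabs are awkward to count. But being bad is invariant under
dilations, up to constants. So each bad direction yields \<open>M\<close> bad points in the full box by the dilations
\<open>1 + l / M\<close>, \<open>l < M\<close>, and it is enough to count bad points of the box.\<close>

definition dilate :: "nat \<Rightarrow> nat \<Rightarrow> int^'d \<Rightarrow> int^'d" where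
  "dilate M l a = (\<chi> i. a $ i + (int l * a $ i) div int M)"

lemma dilate_inject:
  assumes "dilate M l a = dilate M l a'" "1 \<le> M" shows "a = a'"
proof -
  have "x = y" if "x + int l * x div int M = y + int l * y div int M" for x y
  proof -
    have mono: "u + int l * u div int M < u' + int l * u' div int M" if "u < u'" for u u'
    proof -
      have "int l * u div int M \<le> int l * u' div int M"
        using that assms(2) by (intro zdiv_mono1 mult_left_mono) auto
      then show ?thesis using that by linarith
    qed
    show ?thesis using that mono[of x y] mono[of y x] by linarith
  qed
  note inj = this
  show ?thesis
    unfolding vec_eq_iff
  proof
    fix i
    have "dilate M l a $ i = dilate M l a' $ i" using assms(1) by simp
    then show "a $ i = a' $ i" using inj[of "a $ i" "a' $ i"] by (simp add: dilate_def)
  qed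
qed

lemma close_pairs_dilate:
  fixes a :: "int^'d"
  assumes M: "1 \<le> M" and l: "l < M" and K: "\<And>x y i. x \<in> K \<Longrightarrow> y \<in> K \<Longrightarrow> \<bar>x $ i - y $ i\<bar> \<le> int M"
  shows "close_pairs (int (2 * M)) s K a \<subseteq> close_pairs (int ((CARD('d) + 4) * M)) s K (dilate M l a)"
proof clarify
  fix x y assume xy: "(x, y) \<in> close_pairs (int (2 * M)) s K a"
  then have mem: "x \<in> K" "y \<in> K" "\<forall>i. x $ i div s = y $ i div s"
    and le: "\<bar>\<Sum>i\<in>UNIV. (x $ i - y $ i) * a $ i\<bar> \<le> int (2 * M)"
    by (auto simp: close_pairs_def)
  let ?w = "\<lambda>i. x $ i - y $ i"
  let ?m = "\<lambda>i. (int l * a $ i) mod int M"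
  have "int M * (\<Sum>i\<in>UNIV. ?w i * dilate M l a $ i) =
      (\<Sum>i\<in>UNIV. (int M + int l) * (?w i * a $ i) - ?w i * ?m i)"
    unfolding sum_distrib_left
  proof (rule sum.cong)
    fix i
    have "int M * ((int l * a $ i) div int M) = int l * a $ i - ?m i"
      by (simp add: minus_mod_eq_mult_div)
    then have "int M * dilate M l a $ i = (int M + int l) * a $ i - ?m i"
      by (simp add: dilate_def algebra_simps)
    then have "?w i * (int M * dilate M l a $ i) = ?w i * ((int M + int l) * a $ i - ?m i)" by simp
    then show "int M * (?w i * dilate M l a $ i) = (int M + int l) * (?w i * a $ i) - ?w i * ?m i"
      by (simp only: mult.left_commute right_diff_distrib)
  qed simp
  also have "\<dots> = (int M + int l) * (\<Sum>i\<in>UNIV. ?w i * a $ i) - (\<Sum>i\<in>UNIV. ?w i * ?m i)"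
    by (simp add: sum_subtractf sum_distrib_left)
  finally have eq: "int M * (\<Sum>i\<in>UNIV. ?w i * dilate M l a $ i) =
      (int M + int l) * (\<Sum>i\<in>UNIV. ?w i * a $ i) - (\<Sum>i\<in>UNIV. ?w i * ?m i)" .
  have 1: "\<bar>(int M + int l) * (\<Sum>i\<in>UNIV. ?w i * a $ i)\<bar> \<le> (2 * int M) * (2 * int M)"
    unfolding abs_mult using le l by (intro mult_mono) auto
  have "\<bar>\<Sum>i\<in>UNIV. ?w i * ?m i\<bar> \<le> (\<Sum>i\<in>(UNIV :: 'd set). int M * int M)"
  proof (rule order_trans[OF sum_abs sum_mono])
    fix i
    show "\<bar>?w i * ?m i\<bar> \<le> int M * int M"
      unfolding abs_mult using K[OF mem(1,2), of i] M by (intro mult_mono) (auto simp: less_imp_le)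
  qed
  then have 2: "\<bar>\<Sum>i\<in>UNIV. ?w i * ?m i\<bar> \<le> int CARD('d) * (int M * int M)" by simp
  have "int M * \<bar>\<Sum>i\<in>UNIV. ?w i * dilate M l a $ i\<bar> = \<bar>int M * (\<Sum>i\<in>UNIV. ?w i * dilate M l a $ i)\<bar>"
    by (simp add: abs_mult)
  also have "\<dots> \<le> (2 * int M) * (2 * int M) + int CARD('d) * (int M * int M)"
    unfolding eq using 1 2 by linarith
  also have "\<dots> = int M * int ((CARD('d) + 4) * M)" by (simp add: algebra_simps)
  finally have "\<bar>\<Sum>i\<in>UNIV. ?w i * dilate M l a $ i\<bar> \<le> int ((CARD('d) + 4) * M)"
    using M by (simp add: mult_le_cancel_left_pos)
  then show "(x, y) \<in> close_pairs (int ((CARD('d) + 4) * M)) s K (dilate M l a)"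
    using mem by (auto simp: close_pairs_def)
qed

definition real_vec :: "int^'d \<Rightarrow> real^'d" where
  "real_vec a = (\<chi> i. real_of_int (a $ i))"

lemma norm_real_vec_sq: "(norm (real_vec a))\<^sup>2 = real_of_int (\<Sum>i\<in>UNIV. (a $ i)\<^sup>2)"
  by (simp add: norm_vec_def L2_set_def real_vec_def sum_nonneg)

lemma norm_le_card_bound:
  assumes "\<And>i. \<bar>x $ i\<bar> \<le> c" shows "norm (x :: real^'d) \<le> real CARD('d) * c"
proof -
  have "norm x \<le> (\<Sum>i\<in>UNIV. \<bar>x $ i\<bar>)" by (rule norm_le_l1_cart)
  also have "\<dots> \<le> (\<Sum>i\<in>(UNIV :: 'd set). c)" by (rule sum_mono) (rule assms)
  finally show ?thesis by simp
qed

lemma near_sphere_norm: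
  fixes a :: "int^'d"
  assumes M: "1 \<le> M" and "near_sphere (2 * M) a"
  shows "\<bar>norm (real_vec a) - real M\<bar> \<le> 3 * real CARD('d)"
proof -
  let ?r = "norm (real_vec a)"
  have "\<bar>(\<Sum>i\<in>UNIV. (a $ i)\<^sup>2) - (int M)\<^sup>2\<bar> \<le> 3 * int CARD('d) * int M"
    using assms(2) unfolding near_sphere_def by (simp add: power2_eq_square abs_le_iff)
  then have "real_of_int \<bar>(\<Sum>i\<in>UNIV. (a $ i)\<^sup>2) - (int M)\<^sup>2\<bar> \<le> real_of_int (3 * int CARD('d) * int M)"
    by (rule of_int_le_iff[THEN iffD2])
  then have "\<bar>?r\<^sup>2 - (real M)\<^sup>2\<bar> \<le> 3 * real CARD('d) * real M"
    unfolding norm_real_vec_sq by simp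
  moreover have "?r\<^sup>2 - (real M)\<^sup>2 = (?r - real M) * (?r + real M)"
    by (simp add: power2_eq_square algebra_simps)
  ultimately have "\<bar>?r - real M\<bar> * (?r + real M) \<le> 3 * real CARD('d) * real M"
    by (simp add: abs_mult)
  moreover have "\<bar>?r - real M\<bar> * real M \<le> \<bar>?r - real M\<bar> * (?r + real M)"
    by (intro mult_left_mono) auto
  ultimately have "\<bar>?r - real M\<bar> * real M \<le> (3 * real CARD('d)) * real M" by linarith
  then show ?thesis using M by (simp add: mult_le_cancel_right)
qed

lemma dilate_norm:
  fixes a :: "int^'d"
  assumes M: "1 \<le> M" and l: "l < M" and "near_sphere (2 * M) a"
  shows "\<bar>norm (real_vec (dilate M l a)) - (real M + real l)\<bar> \<le> 7 * real CARD('d)"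
proof -
  let ?d = "real CARD('d)" and ?q = "1 + real l / real M" and ?r = "norm (real_vec a)"
  have q: "0 \<le> ?q" "?q \<le> 2" using M l by (simp_all add: divide_le_eq)
  have "\<bar>(real_vec (dilate M l a) - ?q *\<^sub>R real_vec a) $ i\<bar> \<le> 1" for i
  proof -
    let ?u = "int l * a $ i"
    have "real_of_int (?u div int M) = real_of_int ?u / real M - real_of_int (?u mod int M) / real M"
    proof -
      have "?u = int M * (?u div int M) + ?u mod int M" by simp
      then have "real_of_int ?u = real M * real_of_int (?u div int M) + real_of_int (?u mod int M)"
        by (metis of_int_add of_int_mult of_int_of_nat_eq)
      then show ?thesis using M by (simp add: field_simps)
    qed
    then have "(real_vec (dilate M l a) - ?q *\<^sub>R real_vec a) $ i = - (real_of_int (?u mod int M) / real M)"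
      by (simp add: real_vec_def dilate_def algebra_simps)
    moreover have "0 \<le> real_of_int (?u mod int M)" "real_of_int (?u mod int M) \<le> real M"
    proof -
      have "0 \<le> ?u mod int M" "?u mod int M < int M" using M by simp_all
      then show "0 \<le> real_of_int (?u mod int M)" "real_of_int (?u mod int M) \<le> real M" by linarith+
    qed
    ultimately show ?thesis using M by (simp add: divide_le_eq)
  qed
  then have "norm (real_vec (dilate M l a) - ?q *\<^sub>R real_vec a) \<le> ?d * 1"
    by (rule norm_le_card_bound)
  moreover have "\<bar>norm (real_vec (dilate M l a)) - norm (?q *\<^sub>R real_vec a)\<bar> \<le>
      norm (real_vec (dilate M l a) - ?q *\<^sub>R real_vec a)" by (rule norm_triangle_ineq3)
  moreover have "norm (?q *\<^sub>R real_vec a) = ?q * ?r" using q by simp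
  moreover have "\<bar>?q * ?r - (real M + real l)\<bar> \<le> 6 * ?d"
  proof -
    have "?q * ?r - (real M + real l) = ?q * (?r - real M)" using M by (simp add: field_simps)
    then have "\<bar>?q * ?r - (real M + real l)\<bar> = ?q * \<bar>?r - real M\<bar>" using q by (simp add: abs_mult)
    also have "\<dots> \<le> 2 * (3 * ?d)" using q near_sphere_norm[OF M assms(3)] by (intro mult_mono) auto
    finally show ?thesis by simp
  qed
  ultimately show ?thesis by linarith
qed

text \<open>The dilations of all bad directions overlap boundedly often. The norm of \<open>dilate M l a\<close> determines \<open>l\<close> up to
\<open>O(d)\<close> choices because \<open>a / M\<close> is near the unit sphere, and \<open>dilate M l\<close> is injective.\<close>

lemma dilation_count:
  fixes K :: "(int^'d) set"
  assumes M: "1 \<le> M" and K: "\<And>x y i. x \<in> K \<Longrightarrow> y \<in> K \<Longrightarrow> \<bar>x $ i - y $ i\<bar> \<le> int M" and fin: "finite K"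
  shows "card (bad_directions (2 * M) s T K) * M \<le>
    card {v \<in> int_box (4 * M). T \<le> card (close_pairs (int ((CARD('d) + 4) * M)) s K v)} * (14 * CARD('d) + 4)"
proof -
  let ?d = "CARD('d)"
  let ?F = "{v \<in> int_box (4 * M). T \<le> card (close_pairs (int ((?d + 4) * M)) s K v)}"
  \<comment> \<open>The second component records which of the boundedly many values of \<open>l\<close> is the right one.\<close>
  define g where "g = (\<lambda>(a :: int^'d, l). (dilate M l a, nat (int l + int M + 7 * int ?d + 1 - \<lfloor>norm (real_vec (dilate M l a))\<rfloor>)))"
  let ?B = "bad_directions (2 * M) s T K"
  have range: "0 \<le> int l + int M + 7 * int ?d + 1 - \<lfloor>norm (real_vec (dilate M l a))\<rfloor>"
    "int l + int M + 7 * int ?d + 1 - \<lfloor>norm (real_vec (dilate M l a))\<rfloor> < int (14 * ?d + 4)"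
    if "a \<in> ?B" "l < M" for a l
  proof -
    have "near_sphere (2 * M) a" using that by (simp add: bad_directions_def)
    from dilate_norm[OF M that(2) this]
    have "norm (real_vec (dilate M l a)) \<le> of_int (int l + int M + 7 * int ?d)"
      "of_int (int l + int M - 7 * int ?d) \<le> norm (real_vec (dilate M l a))"
      by (auto simp: abs_le_iff)
    then have "\<lfloor>norm (real_vec (dilate M l a))\<rfloor> \<le> int l + int M + 7 * int ?d"
      "int l + int M - 7 * int ?d \<le> \<lfloor>norm (real_vec (dilate M l a))\<rfloor>"
      by (linarith, simp add: le_floor_iff)
    then show "0 \<le> int l + int M + 7 * int ?d + 1 - \<lfloor>norm (real_vec (dilate M l a))\<rfloor>"
      "int l + int M + 7 * int ?d + 1 - \<lfloor>norm (real_vec (dilate M l a))\<rfloor> < int (14 * ?d + 4)" by auto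
  qed
  have "inj_on g (?B \<times> {..<M})"
  proof (rule inj_onI, clarify)
    fix a l a' l' assume a: "a \<in> ?B" "l < M" and a': "a' \<in> ?B" "l' < M" and eq: "g (a, l) = g (a', l')"
    have d: "dilate M l a = dilate M l' a'" using eq by (simp add: g_def)
    have "l = l'" using eq range[of a l] range[of a' l'] a a' by (simp add: g_def d)
    then show "a = a' \<and> l = l'" using dilate_inject d M by blast
  qed
  moreover have "g ` (?B \<times> {..<M}) \<subseteq> ?F \<times> {..<14 * ?d + 4}"
  proof (rule image_subsetI)
    fix p assume "p \<in> ?B \<times> {..<M}"
    then obtain a l where p: "p = (a, l)" and a: "a \<in> ?B" and l: "l < M" by auto
    have "dilate M l a \<in> int_box (4 * M)"
    proof -
      have "\<bar>dilate M l a $ i\<bar> \<le> int (4 * M)" for i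
      proof -
        have ai: "\<bar>a $ i\<bar> < 2 * int M" using a by (simp add: bad_directions_def direction_box_def)
        have "\<bar>int l * a $ i\<bar> \<le> int M * \<bar>a $ i\<bar>" unfolding abs_mult using l by (intro mult_right_mono) auto
        also have "\<dots> \<le> int M * (2 * int M - 1)" using ai by (intro mult_left_mono) auto
        finally have "int l * a $ i \<le> int M * (2 * int M - 1)" "int M * - (2 * int M - 1) \<le> int l * a $ i"
          unfolding mult_minus_right by linarith+
        then have "(int l * a $ i) div int M \<le> (int M * (2 * int M - 1)) div int M"
          "(int M * - (2 * int M - 1)) div int M \<le> (int l * a $ i) div int M"
          using M by (simp_all only: zdiv_mono1 of_nat_0_less_iff less_eq_Suc_le One_nat_def)
        moreover have cancel: "(int M * X) div int M = X" for X using M by simp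
        ultimately have "\<bar>(int l * a $ i) div int M\<bar> \<le> 2 * int M - 1"
          unfolding cancel by linarith
        then show ?thesis using ai by (simp add: dilate_def)
      qed
      then show ?thesis by (simp add: int_box_def)
    qed
    moreover have "T \<le> card (close_pairs (int ((?d + 4) * M)) s K (dilate M l a))"
    proof -
      have "finite (close_pairs (int ((?d + 4) * M)) s K (dilate M l a))"
        by (rule finite_subset[of _ "K \<times> K"]) (auto simp: close_pairs_def fin)
      then have "card (close_pairs (int (2 * M)) s K a) \<le> card (close_pairs (int ((?d + 4) * M)) s K (dilate M l a))"
        by (rule card_mono) (rule close_pairs_dilate[OF M l K])
      then show ?thesis using a by (simp add: bad_directions_def)
    qed
    ultimately show "g p \<in> ?F \<times> {..<14 * ?d + 4}"
      using range[OF a l] by (simp add: g_def p nat_less_iff)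
  qed
  moreover have "finite (?F \<times> {..<14 * ?d + 4})" by (intro finite_cartesian_product finite_subset[OF _ int_box_finite_card(1)[of "4 * M"]]) auto
  ultimately have "card (?B \<times> {..<M}) \<le> card (?F \<times> {..<14 * ?d + 4})" by (rule card_inj_on_le)
  then show ?thesis by (simp add: card_cartesian_product)
qed

text \<open>The distance in the maximum norm.\<close>

definition gap :: "int^'d \<Rightarrow> int^'d \<Rightarrow> nat" where
  "gap x y = Max (range (\<lambda>i. nat \<bar>x $ i - y $ i\<bar>))"

lemma gap_ge: "\<bar>x $ i - y $ i\<bar> \<le> int (gap x y)"
proof -
  have "nat \<bar>x $ i - y $ i\<bar> \<le> gap x y" unfolding gap_def by (rule Max_ge) auto
  then show ?thesis by simp
qed

lemma gap_attained: "\<exists>i. gap x y = nat \<bar>x $ i - y $ i\<bar>"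
proof -
  have "gap x y \<in> range (\<lambda>i. nat \<bar>x $ i - y $ i\<bar>)" unfolding gap_def by (rule Max_in) auto
  then show ?thesis by auto
qed

lemma gap_less_of_same_cell:
  assumes "\<forall>i. x $ i div int N = y $ i div int N" "0 < N" shows "gap x y < N"
proof -
  obtain i where i: "gap x y = nat \<bar>x $ i - y $ i\<bar>" using gap_attained by blast
  have "x $ i = int N * (x $ i div int N) + x $ i mod int N" "y $ i = int N * (y $ i div int N) + y $ i mod int N"
    by simp_all
  then have "x $ i - y $ i = x $ i mod int N - y $ i mod int N" using assms(1) by (metis add_diff_cancel_left)
  moreover have "0 \<le> x $ i mod int N" "x $ i mod int N < int N" "0 \<le> y $ i mod int N" "y $ i mod int N < int N"
    using assms(2) by simp_all
  ultimately have "\<bar>x $ i - y $ i\<bar> < int N" by linarith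
  then show ?thesis using i by linarith
qed

definition same_cell :: "int \<Rightarrow> (int^'d) set \<Rightarrow> ((int^'d) \<times> (int^'d)) set" where
  "same_cell s K = {(x, y) \<in> K \<times> K. \<forall>i. x $ i div s = y $ i div s}"

text \<open>Exchanging the order of counting, the number of points \<open>v\<close> for which a given pair is close is bounded by
\<open>slab_count\<close> for the coordinate in which the pair is furthest apart.\<close>

lemma energy_bound:
  fixes K :: "(int^'d) set"
  assumes M: "1 \<le> M" and K: "\<And>x y i. x \<in> K \<Longrightarrow> y \<in> K \<Longrightarrow> \<bar>x $ i - y $ i\<bar> \<le> int M" and fin: "finite K"
  shows "real (\<Sum>v\<in>int_box (4 * M). card (close_pairs (int (c * M)) s K v)) \<le>
     (real ((4 * c + 11) * M)) ^ CARD('d) * (\<Sum>(x, y)\<in>same_cell s K. 1 / real (max 1 (gap x y)))"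
proof -
  let ?Q = "\<lambda>v p. \<bar>\<Sum>i\<in>UNIV. (fst p $ i - snd p $ i) * v $ i\<bar> \<le> int (c * M)"
  let ?B = "int_box (4 * M) :: (int^'d) set"
  let ?C = "(real ((4 * c + 11) * M)) ^ CARD('d)"
  have finP: "finite (same_cell s K)"
    by (rule finite_subset[of _ "K \<times> K"]) (auto simp: same_cell_def fin)
  have "(\<Sum>v\<in>?B. card (close_pairs (int (c * M)) s K v)) = (\<Sum>v\<in>?B. \<Sum>p\<in>same_cell s K. of_bool (?Q v p))"
  proof (rule sum.cong[OF refl])
    fix v :: "int^'d"
    have "close_pairs (int (c * M)) s K v = same_cell s K \<inter> {p. ?Q v p}"
      by (auto simp: close_pairs_def same_cell_def)
    then show "card (close_pairs (int (c * M)) s K v) = (\<Sum>p\<in>same_cell s K. of_bool (?Q v p))"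
      using finP by simp
  qed
  also have "\<dots> = (\<Sum>p\<in>same_cell s K. \<Sum>v\<in>?B. of_bool (?Q v p))" by (rule sum.swap)
  also have "\<dots> = (\<Sum>p\<in>same_cell s K. card {v \<in> ?B. ?Q v p})"
    using int_box_finite_card(1)[of "4 * M", where 'd = 'd] by (intro sum.cong refl) (simp add: Int_def)
  finally have "real (\<Sum>v\<in>?B. card (close_pairs (int (c * M)) s K v)) =
      (\<Sum>p\<in>same_cell s K. real (card {v \<in> ?B. ?Q v p}))" by simp
  also have "\<dots> \<le> (\<Sum>(x, y)\<in>same_cell s K. ?C * (1 / real (max 1 (gap x y))))"
  proof (rule sum_mono, clarify)
    fix x y assume "(x, y) \<in> same_cell s K"
    then have xy: "x \<in> K" "y \<in> K" by (auto simp: same_cell_def)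
    obtain i where i: "gap x y = nat \<bar>x $ i - y $ i\<bar>" using gap_attained by blast
    have "card {v \<in> ?B. ?Q v (x, y)} * max 1 (gap x y) \<le> ((4 * c + 11) * M) ^ CARD('d)"
      using slab_count[OF M, of "x - y" i c] K[OF xy, of i] by (simp add: i)
    then have "real (card {v \<in> ?B. ?Q v (x, y)}) * real (max 1 (gap x y)) \<le> ?C"
      by (simp only: of_nat_mult[symmetric] of_nat_power[symmetric] of_nat_le_iff)
    then show "real (card {v \<in> ?B. ?Q v (x, y)}) \<le> ?C * (1 / real (max 1 (gap x y)))"
      by (simp add: pos_le_divide_eq)
  qed
  also have "\<dots> = ?C * (\<Sum>(x, y)\<in>same_cell s K. 1 / real (max 1 (gap x y)))"
    by (simp add: sum_distrib_left case_prod_beta)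
  finally show ?thesis .
qed

text \<open>The \<open>(\<delta>, s, A)\<close>-condition for the integer vectors that index a family of \<open>\<delta>\<close>-cubes.\<close>

definition frostman :: "nat \<Rightarrow> real \<Rightarrow> real \<Rightarrow> (int^'d) set \<Rightarrow> bool" where
  "frostman n s A K \<longleftrightarrow> (\<forall>l\<le>n. \<forall>\<kappa> :: int^'d.
     real (card {k \<in> K. \<forall>i. k $ i div 2 ^ (n - l) = \<kappa> $ i}) \<le> A * 2 powr (- s * real l) * real (card K))"

text \<open>A ball of radius \<open>2 ^ j\<close> is covered by \<open>3 ^ d\<close> cells of side \<open>2 ^ j\<close>.\<close>

lemma frostman_near:
  fixes K :: "(int^'d) set"
  assumes F: "frostman n s A K" and fin: "finite K" and j: "j \<le> n"
  shows "real (card {y \<in> K. gap x y < 2 ^ j}) \<le> 3 ^ CARD('d) * (A * 2 powr (- s * real (n - j)) * real (card K))"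
proof -
  let ?b = "A * 2 powr (- s * real (n - j)) * real (card K)"
  define cell where "cell u = {k \<in> K. \<forall>i. k $ i div 2 ^ j = x $ i div 2 ^ j + u $ i}" for u :: "int^'d"
  have "{y \<in> K. gap x y < 2 ^ j} \<subseteq> (\<Union>u\<in>int_box 1. cell u)"
  proof
    fix y assume y: "y \<in> {y \<in> K. gap x y < 2 ^ j}"
    have "\<bar>y $ i div 2 ^ j - x $ i div 2 ^ j\<bar> \<le> 1" for i
    proof -
      have "int (gap x y) < int (2 ^ j)" using y by (simp only: of_nat_less_iff mem_Collect_eq)
      moreover have "int (2 ^ j) = 2 ^ j" by simp
      ultimately have "\<bar>x $ i - y $ i\<bar> < 2 ^ j" using gap_ge[of x i y] by linarith
      then have "x $ i \<le> y $ i + 2 ^ j * 1" "y $ i \<le> x $ i + 2 ^ j * 1" by auto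
      then have "x $ i div 2 ^ j \<le> (y $ i + 2 ^ j * 1) div 2 ^ j" "y $ i div 2 ^ j \<le> (x $ i + 2 ^ j * 1) div 2 ^ j"
        using zdiv_mono1[of "x $ i" "y $ i + 2 ^ j * 1" "2 ^ j"] zdiv_mono1[of "y $ i" "x $ i + 2 ^ j * 1" "2 ^ j"]
        by simp_all
      then show ?thesis by simp
    qed
    then have "(\<chi> i. y $ i div 2 ^ j - x $ i div 2 ^ j) \<in> int_box 1" by (simp add: int_box_def)
    moreover have "y \<in> cell (\<chi> i. y $ i div 2 ^ j - x $ i div 2 ^ j)" using y by (simp add: cell_def)
    ultimately show "y \<in> (\<Union>u\<in>int_box 1. cell u)" by blast
  qed
  then have "card {y \<in> K. gap x y < 2 ^ j} \<le> card (\<Union>u\<in>int_box 1. cell u)"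
    by (rule card_mono[rotated]) (auto simp: cell_def fin int_box_finite_card)
  also have "\<dots> \<le> (\<Sum>u\<in>int_box 1. card (cell u))"
    by (rule card_UN_le) (rule int_box_finite_card)
  finally have "real (card {y \<in> K. gap x y < 2 ^ j}) \<le> (\<Sum>u\<in>int_box 1. real (card (cell u)))"
    by (simp only: of_nat_sum[symmetric] of_nat_le_iff)
  also have "\<dots> \<le> (\<Sum>u\<in>(int_box 1 :: (int^'d) set). ?b)"
  proof (rule sum_mono)
    fix u :: "int^'d"
    show "real (card (cell u)) \<le> ?b"
      using F[unfolded frostman_def, rule_format, of "n - j" "\<chi> i. x $ i div 2 ^ j + u $ i"] j
      by (simp add: cell_def)
  qed
  also have "\<dots> = 3 ^ CARD('d) * ?b" by (simp add: int_box_finite_card)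
  finally show ?thesis .
qed

lemma inverse_gap_layers:
  assumes "g < 2 ^ N"
  shows "1 / real (max 1 g) \<le> (\<Sum>j\<le>N. 2 / 2 ^ j * of_bool (g < 2 ^ j))"
proof -
  define j where "j = (LEAST j. g < (2::nat) ^ j)"
  have j: "g < 2 ^ j" unfolding j_def using assms by (rule LeastI)
  have jN: "j \<le> N" unfolding j_def using assms by (rule Least_le)
  have "1 / real (max 1 g) \<le> 2 / 2 ^ j"
  proof (cases j)
    case 0
    then show ?thesis using j by simp
  next
    case (Suc i)
    have "\<not> g < 2 ^ i" using not_less_Least[of i "\<lambda>j. g < 2 ^ j"] Suc by (simp add: j_def)
    then have "real (2 ^ i) \<le> real (max 1 g)" by (intro of_nat_mono) simp
    then have "1 / real (max 1 g) \<le> 1 / 2 ^ i" by (intro divide_left_mono) auto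
    then show ?thesis by (simp add: Suc)
  qed
  also have "\<dots> = (\<Sum>j\<in>{j}. 2 / 2 ^ j * of_bool (g < 2 ^ j))" using j by simp
  also have "\<dots> \<le> (\<Sum>j\<le>N. 2 / 2 ^ j * of_bool (g < 2 ^ j))"
    using jN by (intro sum_mono2) auto
  finally show ?thesis .
qed

text \<open>Decompose \<open>1 / gap\<close> dyadically. The layer of distance \<open>2 ^ j\<close> contributes \<open>2 powr (-j - s * (n - j))\<close>, which
grows with \<open>j\<close> because \<open>s > 1\<close>. So every one of the at most \<open>n + 1\<close> layers is bounded by the last one, \<open>j = n - m\<close>.\<close>

lemma frostman_energy:
  fixes K :: "(int^'d) set"
  assumes F: "frostman n s A K" and fin: "finite K" and m: "m \<le> n" and s: "1 < s" and A: "0 \<le> A"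
  shows "(\<Sum>(x, y)\<in>same_cell (2 ^ (n - m)) K. 1 / real (max 1 (gap x y))) \<le>
     2 * 3 ^ CARD('d) * real (n + 1) * A * 2 powr (- real n - (s - 1) * real m) * (real (card K))\<^sup>2"
proof -
  let ?N = "n - m"
  let ?E = "2 powr (- real n - (s - 1) * real m)"
  let ?k = "real (card K)"
  have "(\<Sum>(x, y)\<in>same_cell (2 ^ ?N) K. 1 / real (max 1 (gap x y))) \<le>
     (\<Sum>(x, y)\<in>same_cell (2 ^ ?N) K. \<Sum>j\<le>?N. 2 / 2 ^ j * of_bool (gap x y < 2 ^ j))"
  proof (rule sum_mono, clarify)
    fix x y assume "(x, y) \<in> same_cell (2 ^ ?N) K"
    then have "gap x y < 2 ^ ?N" by (intro gap_less_of_same_cell) (auto simp: same_cell_def)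
    then show "1 / real (max 1 (gap x y)) \<le> (\<Sum>j\<le>?N. 2 / 2 ^ j * of_bool (gap x y < 2 ^ j))"
      by (rule inverse_gap_layers)
  qed
  also have "\<dots> \<le> (\<Sum>(x, y)\<in>K \<times> K. \<Sum>j\<le>?N. 2 / 2 ^ j * of_bool (gap x y < 2 ^ j))"
    using fin by (intro sum_mono2) (auto simp: same_cell_def intro!: sum_nonneg)
  also have "\<dots> = (\<Sum>x\<in>K. \<Sum>y\<in>K. \<Sum>j\<le>?N. 2 / 2 ^ j * of_bool (gap x y < 2 ^ j))"
    by (rule sum.cartesian_product[symmetric])
  also have "\<dots> = (\<Sum>x\<in>K. \<Sum>j\<le>?N. 2 / 2 ^ j * real (card {y \<in> K. gap x y < 2 ^ j}))"
  proof (rule sum.cong[OF refl])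
    fix x
    have "(\<Sum>y\<in>K. \<Sum>j\<le>?N. 2 / 2 ^ j * of_bool (gap x y < 2 ^ j)) =
        (\<Sum>j\<le>?N. \<Sum>y\<in>K. 2 / 2 ^ j * of_bool (gap x y < 2 ^ j))" by (rule sum.swap)
    also have "\<dots> = (\<Sum>j\<le>?N. 2 / 2 ^ j * real (card {y \<in> K. gap x y < 2 ^ j}))"
    proof (rule sum.cong[OF refl])
      fix j
      have "(\<Sum>y\<in>K. of_bool (gap x y < 2 ^ j) :: real) = real (card {y \<in> K. gap x y < 2 ^ j})"
        using fin by (simp add: Int_def)
      then show "(\<Sum>y\<in>K. 2 / 2 ^ j * of_bool (gap x y < 2 ^ j)) = 2 / 2 ^ j * real (card {y \<in> K. gap x y < 2 ^ j})"
        by (simp only: sum_distrib_left[symmetric])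
    qed
    finally show "(\<Sum>y\<in>K. \<Sum>j\<le>?N. 2 / 2 ^ j * of_bool (gap x y < 2 ^ j)) =
        (\<Sum>j\<le>?N. 2 / 2 ^ j * real (card {y \<in> K. gap x y < 2 ^ j}))" .
  qed
  also have "\<dots> \<le> (\<Sum>x\<in>K. \<Sum>j\<le>?N. 2 * 3 ^ CARD('d) * A * ?E * ?k)"
  proof (intro sum_mono)
    fix x :: "int^'d" and j assume j: "j \<in> {..?N}"
    then have jn: "j \<le> n" by simp
    have "2 / 2 ^ j * real (card {y \<in> K. gap x y < 2 ^ j}) \<le>
        2 / 2 ^ j * (3 ^ CARD('d) * (A * 2 powr (- s * real (n - j)) * ?k))"
      by (intro mult_left_mono frostman_near[OF F fin jn]) auto
    also have "\<dots> = 2 * 3 ^ CARD('d) * A * ?k * (2 powr (- real j) * 2 powr (- s * real (n - j)))"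
      by (simp add: powr_minus powr_realpow field_simps)
    also have "2 powr (- real j) * 2 powr (- s * real (n - j)) = 2 powr (- real j - s * real (n - j))"
      by (simp add: powr_add[symmetric])
    also have "2 * 3 ^ CARD('d) * A * ?k * 2 powr (- real j - s * real (n - j)) \<le> 2 * 3 ^ CARD('d) * A * ?k * ?E"
    proof (intro mult_left_mono powr_mono)
      have "(s - 1) * real j \<le> (s - 1) * real ?N" using j s by (intro mult_left_mono) auto
      moreover have "real (n - j) = real n - real j" "real ?N = real n - real m" using jn m by auto
      ultimately show "- real j - s * real (n - j) \<le> - real n - (s - 1) * real m"
        by (simp add: algebra_simps)
    qed (use A in auto)
    finally show "2 / 2 ^ j * real (card {y \<in> K. gap x y < 2 ^ j}) \<le> 2 * 3 ^ CARD('d) * A * ?E * ?k"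
      by (simp add: mult_ac)
  qed
  also have "\<dots> = ?k * (real (?N + 1) * (2 * 3 ^ CARD('d) * A * ?E * ?k))" by simp
  also have "\<dots> \<le> ?k * (real (n + 1) * (2 * 3 ^ CARD('d) * A * ?E * ?k))"
    using A by (intro mult_left_mono mult_right_mono) auto
  finally show ?thesis by (simp add: power2_eq_square mult_ac)
qed

text \<open>Markov's inequality for the number of close pairs, averaged over the points of the box. With \<open>M = 2 ^ (n + d)\<close> the factor
\<open>M ^ d / M\<close> is comparable to the number of grid directions, and \<open>(n + 1) * A * 2 powr (-n - (s - 1) * m) * |K|^2\<close> bounds the
expected number of close pairs, up to a constant.\<close>

theorem bad_directions_card:
  fixes K :: "(int^'d) set"
  assumes F: "frostman n s A K" and fin: "finite K" and m: "m \<le> n" and s: "1 < s" and A: "0 \<le> A"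
    and M: "1 \<le> M" and K: "\<And>x y i. x \<in> K \<Longrightarrow> y \<in> K \<Longrightarrow> \<bar>x $ i - y $ i\<bar> \<le> int M"
  shows "real (card (bad_directions (2 * M) (2 ^ (n - m)) T K)) * real T * real M \<le>
    (real (14 * CARD('d) + 4) * (real (4 * CARD('d) + 27)) ^ CARD('d) * (2 * 3 ^ CARD('d))) * real (n + 1) *
     real M ^ CARD('d) * (A * 2 powr (- real n - (s - 1) * real m) * (real (card K))\<^sup>2)"
proof -
  let ?d = "CARD('d)"
  let ?s = "2 ^ (n - m) :: int"
  let ?F = "{v \<in> int_box (4 * M). T \<le> card (close_pairs (int ((?d + 4) * M)) ?s K v)}"
  let ?S = "\<Sum>(x, y)\<in>same_cell ?s K. 1 / real (max 1 (gap x y))"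
  have "card ?F * T = (\<Sum>v\<in>?F. T)" by simp
  also have "\<dots> \<le> (\<Sum>v\<in>?F. card (close_pairs (int ((?d + 4) * M)) ?s K v))" by (rule sum_mono) auto
  also have "\<dots> \<le> (\<Sum>v\<in>int_box (4 * M). card (close_pairs (int ((?d + 4) * M)) ?s K v))"
    by (rule sum_mono2) (auto simp: int_box_finite_card)
  finally have "real (card ?F * T) \<le> real (\<Sum>v\<in>int_box (4 * M). card (close_pairs (int ((?d + 4) * M)) ?s K v))"
    by (rule of_nat_mono)
  also have "\<dots> \<le> (real ((4 * (?d + 4) + 11) * M)) ^ ?d * ?S"
    by (rule energy_bound[OF M K fin])
  also have "(real ((4 * (?d + 4) + 11) * M)) ^ ?d = real (4 * ?d + 27) ^ ?d * real M ^ ?d"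
    by (simp add: power_mult_distrib[symmetric] algebra_simps)
  finally have 1: "real (card ?F) * real T \<le> real (4 * ?d + 27) ^ ?d * real M ^ ?d * ?S" by simp
  have "card (bad_directions (2 * M) ?s T K) * M * T \<le> card ?F * (14 * ?d + 4) * T"
    using dilation_count[OF M K fin] by (intro mult_le_mono1)
  then have "real (card (bad_directions (2 * M) ?s T K) * M * T) \<le> real (card ?F * (14 * ?d + 4) * T)"
    by (rule of_nat_mono)
  then have "real (card (bad_directions (2 * M) ?s T K)) * real T * real M \<le>
      real (14 * ?d + 4) * (real (card ?F) * real T)"
    by (simp add: mult_ac del: of_nat_add)
  also have "\<dots> \<le> real (14 * ?d + 4) * (real (4 * ?d + 27) ^ ?d * real M ^ ?d * ?S)"
    by (intro mult_left_mono 1) simp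
  also have "\<dots> \<le> real (14 * ?d + 4) * (real (4 * ?d + 27) ^ ?d * real M ^ ?d *
      (2 * 3 ^ ?d * real (n + 1) * A * 2 powr (- real n - (s - 1) * real m) * (real (card K))\<^sup>2))"
    by (intro mult_left_mono frostman_energy[OF F fin m s A]) auto
  finally show ?thesis by (simp add: mult_ac del: of_nat_add)
qed

section \<open>Extraction of large Frostman fibres\<close>

text \<open>The number of the dyadic interval that contains the projection of the corner of cube \<open>k\<close>. Assigning each
cube to one interval turns the fibres into a partition.\<close>

definition tube :: "real^'d \<Rightarrow> int^'d \<Rightarrow> int" where
  "tube e k = \<lfloor>\<Sum>i\<in>UNIV. of_int (k $ i) * e $ i\<rfloor>"

lemma tube_bounds:
  fixes k :: "int^'d"
  assumes "\<And>i. 0 \<le> k $ i \<and> k $ i < 2 ^ n" "\<And>i. \<bar>e $ i\<bar> \<le> 1"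
  shows "tube e k \<in> {- (int CARD('d) * 2 ^ n)..int CARD('d) * 2 ^ n}"
proof -
  have "\<bar>\<Sum>i\<in>UNIV. of_int (k $ i) * e $ i\<bar> \<le> (\<Sum>i\<in>(UNIV :: 'd set). 2 ^ n)"
  proof (rule order_trans[OF sum_abs sum_mono])
    fix i
    have "real_of_int (k $ i) \<le> real_of_int (2 ^ n)" using assms(1)[of i] by (simp only: of_int_le_iff less_imp_le)
    then have "\<bar>real_of_int (k $ i)\<bar> * \<bar>e $ i\<bar> \<le> 2 ^ n * 1"
      using assms(1)[of i] assms(2)[of i] by (intro mult_mono) auto
    then show "\<bar>of_int (k $ i) * e $ i\<bar> \<le> 2 ^ n" by (simp add: abs_mult)
  qed
  then have "\<bar>\<Sum>i\<in>UNIV. of_int (k $ i) * e $ i\<bar> \<le> real_of_int (int CARD('d) * 2 ^ n)" by simp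
  then have "real_of_int (- (int CARD('d) * 2 ^ n)) \<le> (\<Sum>i\<in>UNIV. of_int (k $ i) * e $ i)"
    "(\<Sum>i\<in>UNIV. of_int (k $ i) * e $ i) \<le> real_of_int (int CARD('d) * 2 ^ n)"
    by (auto simp: abs_le_iff)
  then show ?thesis unfolding tube_def by (auto simp: le_floor_iff floor_le_iff)
qed

text \<open>A vector is heavy at scale \<open>m\<close> if its cell of side \<open>2 ^ -m\<close> contains more than \<open>H m\<close> vectors of its own tube. The bound on pairs
implies that at most half of \<open>K\<close> is heavy at some scale. In the rest \<open>G\<close>, the fibres with at least \<open>|K| / (4 * W)\<close>
elements contain half of \<open>G\<close>, where \<open>W\<close> bounds the number of tubes. A fibre of this kind is Frostman because its cells are bounded by \<open>H m\<close>; the cell at scale 0 bounds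
the size of the fibre and hence from below the number of fibres.\<close>

theorem rich_tubes:
  fixes K :: "(int^'d) set" and e :: "real^'d"
  assumes fin: "finite K" and ne: "K \<noteq> {}" and K: "\<And>k i. k \<in> K \<Longrightarrow> 0 \<le> k $ i \<and> k $ i < 2 ^ n"
    and e: "\<And>i. \<bar>e $ i\<bar> \<le> 1" and B: "0 < B" "2 * real (n + 1) * B \<le> B'"
    and E: "\<And>m. m \<le> n \<Longrightarrow> real (card {(x, y) \<in> same_cell (2 ^ (n - m)) K. tube e x = tube e y}) \<le>
      B * 2 powr (- real n - (s - 1) * real m) * (real (card K))\<^sup>2"
  shows "\<exists>L G. finite L \<and> 2 ^ n / (4 * B') \<le> real (card L) \<and>
    (\<forall>l\<in>L. G l \<subseteq> {k \<in> K. tube e k = l} \<and>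
       real (card K) \<le> 12 * real CARD('d) * 2 ^ n * real (card (G l)) \<and>
       frostman n (s - 1) (12 * real CARD('d) * B') (G l))"
proof -
  let ?d = "real CARD('d)" and ?k = "real (card K)"
  define H where "H m = B' * 2 powr (- real n - (s - 1) * real m) * ?k" for m :: nat
  define cell where "cell m k = {y \<in> K. (\<forall>i. k $ i div 2 ^ (n - m) = y $ i div 2 ^ (n - m)) \<and> tube e k = tube e y}" for m k
  define heavy where "heavy m = {k \<in> K. H m < real (card (cell m k))}" for m
  define G where "G = K - (\<Union>m\<le>n. heavy m)"
  define Gl where "Gl l = {k \<in> G. tube e k = l}" for l
  have kpos: "0 < ?k" using fin ne by (simp add: card_gt_0_iff)
  have B'pos: "0 < B'" using B by (metis less_le_trans mult_pos_pos of_nat_0_less_iff zero_less_numeral add_gr_0 zero_less_one)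
  have Hpos: "0 < H m" for m using kpos B'pos by (simp add: H_def)
  have finG: "finite G" "G \<subseteq> K" using fin by (auto simp: G_def)
  \<comment> \<open>Summing the cell sizes over the heavy vectors counts pairs.\<close>
  have heavy_card: "real (card (heavy m)) \<le> ?k / (2 * real (n + 1))" if m: "m \<le> n" for m
  proof -
    have fh: "finite (heavy m)" using fin by (simp add: heavy_def)
    have "real (card (heavy m)) * H m = (\<Sum>k\<in>heavy m. H m)" by simp
    also have "\<dots> \<le> (\<Sum>k\<in>heavy m. real (card (cell m k)))"
      by (rule sum_mono) (simp add: heavy_def)
    also have "\<dots> \<le> (\<Sum>k\<in>K. real (card (cell m k)))"
      using fin by (intro sum_mono2) (auto simp: heavy_def)
    also have "\<dots> = real (card (SIGMA k:K. cell m k))"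
      using fin by (subst card_SigmaI) (auto simp: cell_def)
    also have "(SIGMA k:K. cell m k) = {(x, y) \<in> same_cell (2 ^ (n - m)) K. tube e x = tube e y}"
      by (auto simp: cell_def same_cell_def)
    also have "real (card \<dots>) \<le> B * 2 powr (- real n - (s - 1) * real m) * ?k\<^sup>2" by (rule E[OF m])
    finally have "real (card (heavy m)) * H m \<le> B * 2 powr (- real n - (s - 1) * real m) * ?k\<^sup>2" .
    then have "(real (card (heavy m)) * B') * (2 powr (- real n - (s - 1) * real m) * ?k) \<le>
        (B * ?k) * (2 powr (- real n - (s - 1) * real m) * ?k)"
      by (simp add: H_def power2_eq_square mult_ac)
    then have "real (card (heavy m)) * B' \<le> B * ?k"
      using kpos by (simp add: mult_le_cancel_right)
    moreover have "real (card (heavy m)) * (2 * real (n + 1) * B) \<le> real (card (heavy m)) * B'"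
      using B by (intro mult_left_mono) auto
    ultimately have "(real (card (heavy m)) * (2 * real (n + 1))) * B \<le> ?k * B" by (simp add: mult_ac)
    then have "real (card (heavy m)) * (2 * real (n + 1)) \<le> ?k" using B(1) by (simp add: mult_le_cancel_right)
    then show ?thesis by (subst pos_le_divide_eq) auto
  qed
  have "real (card (\<Union>m\<le>n. heavy m)) \<le> real (\<Sum>m\<le>n. card (heavy m))"
    by (intro of_nat_mono card_UN_le) simp
  also have "\<dots> = (\<Sum>m\<le>n. real (card (heavy m)))" by simp
  also have "\<dots> \<le> (\<Sum>m\<le>n. ?k / (2 * real (n + 1)))" by (rule sum_mono) (simp only: heavy_card atMost_iff)
  also have "\<dots> = ?k / 2" by (simp add: field_simps)
  finally have "real (card (\<Union>m\<le>n. heavy m)) \<le> ?k / 2" .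
  moreover have "card G = card K - card (\<Union>m\<le>n. heavy m)" "card (\<Union>m\<le>n. heavy m) \<le> card K"
    unfolding G_def using fin by (auto intro!: card_Diff_subset card_mono simp: heavy_def)
  ultimately have Gcard: "?k / 2 \<le> real (card G)" by simp
  define V where "V = tube e ` G"
  have finV: "finite V" using finG by (simp add: V_def)
  \<comment> \<open>An upper bound for the number of tubes that meet the unit cube.\<close>
  define W where "W = 3 * ?d * 2 ^ n"
  have Wpos: "0 < W" by (simp add: W_def)
  have "V \<subseteq> {- (int CARD('d) * 2 ^ n)..int CARD('d) * 2 ^ n}"
    unfolding V_def using tube_bounds[OF K e] finG by blast
  then have "card V \<le> card {- (int CARD('d) * 2 ^ n)..int CARD('d) * 2 ^ n}" by (rule card_mono[rotated]) simp
  also have "\<dots> = nat (2 * (int CARD('d) * 2 ^ n) + 1)" by (simp add: algebra_simps)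
  finally have "card V \<le> nat (2 * (int CARD('d) * 2 ^ n) + 1)" .
  then have "int (card V) \<le> 2 * (int CARD('d) * 2 ^ n) + 1" by (subst (asm) le_nat_iff) auto
  then have "real_of_int (int (card V)) \<le> real_of_int (2 * (int CARD('d) * 2 ^ n) + 1)" by (simp only: of_int_le_iff)
  then have "real (card V) \<le> 2 * ?d * 2 ^ n + 1" by simp
  moreover have "1 * 1 \<le> ?d * 2 ^ n" by (intro mult_mono) (auto simp: Suc_le_eq)
  ultimately have VW: "real (card V) \<le> W" by (simp add: W_def)
  define L where "L = {l \<in> V. ?k / (4 * W) \<le> real (card (Gl l))}"
  have finL: "finite L" using finV by (simp add: L_def)
  have finGl: "finite (Gl l)" for l using finG by (simp add: Gl_def)
  have "card G = (\<Sum>l\<in>V. card (Gl l))"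
  proof -
    have "card (\<Union>l\<in>V. Gl l) = (\<Sum>l\<in>V. card (Gl l))"
      using finV finGl by (intro card_UN_disjoint) (auto simp: Gl_def)
    moreover have "(\<Union>l\<in>V. Gl l) = G" by (auto simp: Gl_def V_def)
    ultimately show ?thesis by simp
  qed
  then have "real (card G) = (\<Sum>l\<in>L. real (card (Gl l))) + (\<Sum>l\<in>V - L. real (card (Gl l)))"
    using finV sum.subset_diff[of L V "\<lambda>l. real (card (Gl l))"] by (simp add: L_def add.commute)
  moreover have "(\<Sum>l\<in>V - L. real (card (Gl l))) \<le> (\<Sum>l\<in>V - L. ?k / (4 * W))"
    by (rule sum_mono) (auto simp: L_def)
  moreover have "(\<Sum>l\<in>V - L. ?k / (4 * W)) \<le> ?k / 4"
  proof -
    have "real (card (V - L)) \<le> W" using card_mono[OF finV, of "V - L"] VW by force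
    then have "real (card (V - L)) * (?k / (4 * W)) \<le> W * (?k / (4 * W))"
      using kpos Wpos by (intro mult_right_mono) auto
    then show ?thesis using Wpos by simp
  qed
  ultimately have Lsum: "?k / 4 \<le> (\<Sum>l\<in>L. real (card (Gl l)))" using Gcard by linarith
  have cell_le: "real (card {k \<in> Gl l. \<forall>i. k $ i div 2 ^ (n - m) = \<kappa> $ i}) \<le> H m" (is "real (card ?X) \<le> _")
    if m: "m \<le> n" for l m \<kappa>
  proof (cases "?X = {}")
    case True
    then have "card ?X = 0" by (simp only: card.empty)
    then show ?thesis using Hpos[of m] by linarith
  next
    case False
    then obtain k where k: "k \<in> ?X" by blast
    then have kG: "k \<in> K" "k \<notin> heavy m" using m by (auto simp: Gl_def G_def)
    have "?X \<subseteq> cell m k" using k finG by (auto simp: cell_def Gl_def)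
    then have "card ?X \<le> card (cell m k)" using fin by (intro card_mono) (auto simp: cell_def)
    moreover have "real (card (cell m k)) \<le> H m" using kG by (simp add: heavy_def)
    ultimately show ?thesis by linarith
  qed
  have Gl_le: "real (card (Gl l)) \<le> H 0" for l
  proof -
    have "{k \<in> Gl l. \<forall>i. k $ i div 2 ^ (n - 0) = (0 :: int^'d) $ i} = Gl l"
      using K finG by (fastforce simp: Gl_def intro!: div_pos_pos_trivial)
    then show ?thesis using cell_le[of 0 l "0 :: int^'d"] by simp
  qed
  have "?k / 4 \<le> real (card L) * H 0"
  proof -
    have "(\<Sum>l\<in>L. real (card (Gl l))) \<le> (\<Sum>l\<in>L. H 0)" by (rule sum_mono) (rule Gl_le)
    then show ?thesis using Lsum by simp
  qed
  also have "H 0 = B' * ?k / 2 ^ n" by (simp add: H_def powr_minus powr_realpow field_simps)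
  finally have "?k * 2 ^ n \<le> ?k * (real (card L) * (4 * B'))" by (simp add: field_simps)
  then have "2 ^ n \<le> real (card L) * (4 * B')" using kpos by (simp add: mult_le_cancel_left)
  then have Lcard: "2 ^ n / (4 * B') \<le> real (card L)" using B'pos by (subst pos_divide_le_eq) auto
  have rich: "?k \<le> 12 * ?d * 2 ^ n * real (card (Gl l))" if "l \<in> L" for l
  proof -
    have "?k / (4 * W) \<le> real (card (Gl l))" using that by (simp add: L_def)
    then have "?k \<le> real (card (Gl l)) * (4 * W)" using Wpos by (subst (asm) pos_divide_le_eq) auto
    then show ?thesis by (simp add: W_def mult_ac)
  qed
  have fro: "frostman n (s - 1) (12 * ?d * B') (Gl l)" if l: "l \<in> L" for l
    unfolding frostman_def
  proof (intro allI impI)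
    fix m and \<kappa> :: "int^'d" assume m: "m \<le> n"
    have "real (card {k \<in> Gl l. \<forall>i. k $ i div 2 ^ (n - m) = \<kappa> $ i}) \<le> H m" by (rule cell_le[OF m])
    also have "H m = B' * 2 powr (- (s - 1) * real m) / 2 ^ n * ?k"
    proof -
      have "- real n - (s - 1) * real m = - real n + (- (s - 1) * real m)" by (simp add: algebra_simps)
      then have "2 powr (- real n - (s - 1) * real m) = 2 powr (- (s - 1) * real m) / 2 ^ n"
        by (simp only: powr_add powr_minus powr_realpow) (simp add: powr_realpow field_simps)
      then show ?thesis by (simp add: H_def)
    qed
    also have "\<dots> \<le> B' * 2 powr (- (s - 1) * real m) / 2 ^ n * (12 * ?d * 2 ^ n * real (card (Gl l)))"
      using B'pos by (intro mult_left_mono rich[OF l]) auto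
    also have "\<dots> = 12 * ?d * B' * 2 powr (- (s - 1) * real m) * real (card (Gl l))" by simp
    finally show "real (card {k \<in> Gl l. \<forall>i. k $ i div 2 ^ (n - m) = \<kappa> $ i}) \<le>
        12 * ?d * B' * 2 powr (- (s - 1) * real m) * real (card (Gl l))" .
  qed
  have "Gl l \<subseteq> {k \<in> K. tube e k = l}" for l using finG by (auto simp: Gl_def)
  then show ?thesis using finL Lcard rich fro by (intro exI[of _ L] exI[of _ Gl]) blast
qed

section \<open>Dyadic cubes and integer vectors\<close>

lemma dyadic_scale_pos: "0 < dyadic_scale n" and dyadic_scale_inverse: "dyadic_scale n * 2 ^ n = 1"
  by (simp_all add: dyadic_scale_def power_one_over)

lemma dyadic_scale_powr: "dyadic_scale n powr x = 2 powr (- real n * x)"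
proof -
  have "dyadic_scale n = 2 powr (- real n)"
    by (simp add: dyadic_scale_def powr_minus powr_realpow power_one_over field_simps)
  then show ?thesis by (simp add: powr_powr)
qed

lemma dyadic_cube_iff: "x \<in> dyadic_cube n k \<longleftrightarrow> (\<forall>i. \<lfloor>x $ i * 2 ^ n\<rfloor> = k $ i)"
proof -
  have "of_int j * dyadic_scale n \<le> y \<and> y < (of_int j + 1) * dyadic_scale n \<longleftrightarrow> \<lfloor>y * 2 ^ n\<rfloor> = j" for j and y :: real
  proof -
    have "of_int j * dyadic_scale n \<le> y \<longleftrightarrow> of_int j \<le> y * 2 ^ n"
      "y < (of_int j + 1) * dyadic_scale n \<longleftrightarrow> y * 2 ^ n < of_int j + 1"
      by (simp_all add: dyadic_scale_def power_one_over field_simps)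
    then show ?thesis by (simp add: floor_eq_iff)
  qed
  then show ?thesis by (simp add: dyadic_cube_def)
qed

definition corner :: "nat \<Rightarrow> int^'d \<Rightarrow> real^'d" where
  "corner n k = (\<chi> i. of_int (k $ i) * dyadic_scale n)"

lemma corner_in_cube: "corner n k \<in> dyadic_cube n k"
  by (simp add: dyadic_cube_iff corner_def mult.assoc dyadic_scale_inverse)

lemma dyadic_cube_inject: "x \<in> dyadic_cube n k \<Longrightarrow> x \<in> dyadic_cube n k' \<Longrightarrow> k = k'"
  by (simp add: dyadic_cube_iff vec_eq_iff)

lemma inj_dyadic_cube: "inj (dyadic_cube n)"
  by (rule injI) (metis corner_in_cube dyadic_cube_inject)

lemma dyadic_cube_nested:
  assumes "x \<in> dyadic_cube n k" "m \<le> n"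
  shows "x \<in> dyadic_cube m \<kappa> \<longleftrightarrow> (\<forall>i. k $ i div 2 ^ (n - m) = \<kappa> $ i)"
proof -
  have "\<lfloor>y * 2 ^ m\<rfloor> = \<lfloor>y * 2 ^ n\<rfloor> div 2 ^ (n - m)" for y :: real
  proof -
    have "(2::real) ^ n = 2 ^ m * 2 ^ (n - m)" using assms(2) by (simp flip: power_add)
    then have "y * 2 ^ m = y * 2 ^ n / real_of_int (2 ^ (n - m))" by simp
    also have "\<lfloor>\<dots>\<rfloor> = \<lfloor>y * 2 ^ n\<rfloor> div 2 ^ (n - m)" by (rule floor_divide_real_eq_div) simp
    finally show ?thesis .
  qed
  then show ?thesis using assms(1) by (simp add: dyadic_cube_iff)
qed

text \<open>Dyadic cubes are nested, so a cube of the family meets a larger dyadic cube only if it is contained in it.\<close>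

lemma cubes_meeting_union:
  fixes K :: "(int^'d) set"
  assumes "m \<le> n"
  shows "dyadic_cubes_meeting n (\<Union>(dyadic_cube n ` K) \<inter> dyadic_cube m \<kappa>) =
    dyadic_cube n ` {k \<in> K. \<forall>i. k $ i div 2 ^ (n - m) = \<kappa> $ i}"
proof (intro set_eqI iffI)
  fix Q assume "Q \<in> dyadic_cubes_meeting n (\<Union>(dyadic_cube n ` K) \<inter> dyadic_cube m \<kappa>)"
  then obtain k' x k where x: "Q = dyadic_cube n k'" "x \<in> dyadic_cube n k'" "k \<in> K" "x \<in> dyadic_cube n k" "x \<in> dyadic_cube m \<kappa>"
    unfolding dyadic_cubes_meeting_def dyadic_cubes_def by auto
  then have "k' = k" using dyadic_cube_inject by blast
  then show "Q \<in> dyadic_cube n ` {k \<in> K. \<forall>i. k $ i div 2 ^ (n - m) = \<kappa> $ i}"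
    using x dyadic_cube_nested[OF x(4) assms, of \<kappa>] by simp
next
  fix Q assume "Q \<in> dyadic_cube n ` {k \<in> K. \<forall>i. k $ i div 2 ^ (n - m) = \<kappa> $ i}"
  then obtain k where k: "Q = dyadic_cube n k" "k \<in> K" "\<forall>i. k $ i div 2 ^ (n - m) = \<kappa> $ i" by auto
  then have "corner n k \<in> dyadic_cube m \<kappa>" using dyadic_cube_nested[OF corner_in_cube assms] by blast
  then show "Q \<in> dyadic_cubes_meeting n (\<Union>(dyadic_cube n ` K) \<inter> dyadic_cube m \<kappa>)"
    unfolding dyadic_cubes_meeting_def dyadic_cubes_def using k corner_in_cube by blast
qed

lemma cubes_meeting_all: "dyadic_cubes_meeting n (\<Union>(dyadic_cube n ` K)) = dyadic_cube n ` K"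
proof (intro set_eqI iffI)
  fix Q assume "Q \<in> dyadic_cubes_meeting n (\<Union>(dyadic_cube n ` K))"
  then obtain k' x k where "Q = dyadic_cube n k'" "x \<in> dyadic_cube n k'" "k \<in> K" "x \<in> dyadic_cube n k"
    unfolding dyadic_cubes_meeting_def dyadic_cubes_def by auto
  then show "Q \<in> dyadic_cube n ` K" using dyadic_cube_inject by blast
next
  fix Q assume "Q \<in> dyadic_cube n ` K"
  then show "Q \<in> dyadic_cubes_meeting n (\<Union>(dyadic_cube n ` K))"
    unfolding dyadic_cubes_meeting_def dyadic_cubes_def using corner_in_cube by blast
qed

lemma bounded_dyadic_cube: "bounded (dyadic_cube n k)"
proof (rule bounded_subset[OF bounded_cbox])
  show "dyadic_cube n k \<subseteq> cbox (corner n k) (\<chi> i. (of_int (k $ i) + 1) * dyadic_scale n)"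
    by (auto simp: dyadic_cube_def mem_box_cart corner_def less_imp_le)
qed

lemma dsc_family_iff_frostman:
  fixes K :: "(int^'d) set"
  assumes "finite K"
  shows "dsc_family n s c (dyadic_cube n ` K) \<longleftrightarrow> K \<noteq> {} \<and> frostman n s c K"
proof -
  have card: "card (dyadic_cube n ` K') = card K'" for K' :: "(int^'d) set"
    by (rule card_image) (metis inj_dyadic_cube inj_on_subset subset_UNIV)
  have "\<Union>(dyadic_cube n ` K) \<noteq> {} \<longleftrightarrow> K \<noteq> {}" using corner_in_cube by fastforce
  moreover have "bounded (\<Union>(dyadic_cube n ` K))" using assms bounded_dyadic_cube by auto
  moreover have "dyadic_cube n ` K \<subseteq> dyadic_cubes n" by (auto simp: dyadic_cubes_def)
  moreover have "(\<forall>m\<le>n. \<forall>Q\<in>dyadic_cubes m. real (card (dyadic_cubes_meeting n (\<Union>(dyadic_cube n ` K) \<inter> Q)))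
          \<le> c * 2 powr (- s * real m) * real (card (dyadic_cubes_meeting n (\<Union>(dyadic_cube n ` K))))) \<longleftrightarrow>
      frostman n s c K"
    unfolding frostman_def dyadic_cubes_def cubes_meeting_all card
    using cubes_meeting_union[of _ n K] card by auto
  ultimately show ?thesis by (simp add: dsc_family_def dsc_set_def)
qed

lemma frostman_mono: "frostman n s A K \<Longrightarrow> A \<le> A' \<Longrightarrow> frostman n s A' K"
  unfolding frostman_def by (meson mult_right_mono of_nat_0_le_iff order_trans powr_ge_zero)

text \<open>The centre of the cube is the point to test: the corner of a half-open cube outside the unit cube may still lie on
its boundary.\<close>

lemma cube_in_unit_box:
  assumes "dyadic_cube n k \<subseteq> cbox 0 1" shows "0 \<le> k $ i \<and> k $ i < 2 ^ n"
proof -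
  define x where "x = (\<chi> i. (of_int (k $ i) + 1 / 2) * dyadic_scale n)"
  have "\<lfloor>x $ i * 2 ^ n\<rfloor> = k $ i" for i
  proof -
    have "x $ i * 2 ^ n = of_int (k $ i) + 1 / 2" by (simp add: x_def mult.assoc dyadic_scale_inverse)
    then show ?thesis by (simp add: floor_eq_iff)
  qed
  then have "x \<in> dyadic_cube n k" by (simp add: dyadic_cube_iff)
  then have "x \<in> cbox 0 1" using assms by blast
  then have "0 \<le> x $ i" "x $ i \<le> 1" by (auto simp: mem_box_cart)
  then have "0 \<le> x $ i * 2 ^ n" "x $ i * 2 ^ n \<le> 1 * 2 ^ n" by (simp, intro mult_right_mono) auto
  then have "0 \<le> real_of_int (k $ i) + 1 / 2" "real_of_int (k $ i) + 1 / 2 \<le> real_of_int (2 ^ n)"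
    by (simp_all add: x_def mult.assoc dyadic_scale_inverse)
  then show ?thesis by linarith
qed

lemma cube_meets_tube:
  "dyadic_cube n k \<inter> {x. x \<bullet> e \<in> {of_int (tube e k) * dyadic_scale n..<(of_int (tube e k) + 1) * dyadic_scale n}} \<noteq> {}"
proof -
  let ?y = "\<Sum>i\<in>UNIV. of_int (k $ i) * e $ i"
  have "corner n k \<bullet> e = ?y * dyadic_scale n"
    by (simp add: inner_vec_def corner_def sum_distrib_left mult_ac)
  moreover have "of_int (tube e k) * dyadic_scale n \<le> ?y * dyadic_scale n"
    using dyadic_scale_pos[of n] by (intro mult_right_mono) (auto simp: tube_def)
  moreover have "?y * dyadic_scale n < (of_int (tube e k) + 1) * dyadic_scale n"
    using dyadic_scale_pos[of n] by (intro mult_strict_right_mono) (auto simp: tube_def)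
  ultimately show ?thesis using corner_in_cube[of n k] by fastforce
qed

text \<open>Guards against the convention that infinite sets have cardinality 0.\<close>

lemma finite_intervals_meeting:
  assumes "\<Union>P \<subseteq> cbox (0 :: real^'d) 1" "norm e = 1"
  shows "finite {I \<in> dyadic_intervals n. \<exists>Q\<in>P. Q \<inter> {x. x \<bullet> e \<in> I} \<noteq> {}}"
proof -
  let ?N = "int CARD('d) * 2 ^ n"
  let ?I = "\<lambda>k::int. {of_int k * dyadic_scale n ..< (of_int k + 1) * dyadic_scale n}"
  have "{I \<in> dyadic_intervals n. \<exists>Q\<in>P. Q \<inter> {x. x \<bullet> e \<in> I} \<noteq> {}} \<subseteq> ?I ` {- ?N - 1..?N}"
  proof
    fix I assume "I \<in> {I \<in> dyadic_intervals n. \<exists>Q\<in>P. Q \<inter> {x. x \<bullet> e \<in> I} \<noteq> {}}"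
    then obtain k x where k: "I = ?I k" and x: "x \<in> \<Union>P" "x \<bullet> e \<in> ?I k"
      unfolding dyadic_intervals_def by blast
    have "\<bar>x $ i\<bar> \<le> 1" for i using x(1) assms(1) by (auto simp: mem_box_cart subset_iff)
    then have "norm x \<le> real CARD('d) * 1" by (rule norm_le_card_bound)
    then have "\<bar>x \<bullet> e\<bar> \<le> real CARD('d)" using Cauchy_Schwarz_ineq2[of x e] assms(2) by simp
    then have b: "\<bar>(x \<bullet> e) * 2 ^ n\<bar> \<le> of_int ?N" by (simp add: abs_mult)
    have "of_int k \<le> (x \<bullet> e) * 2 ^ n" "(x \<bullet> e) * 2 ^ n < of_int k + 1"
      using x(2) by (simp_all add: dyadic_scale_def power_one_over field_simps)
    then have "of_int k \<le> real_of_int ?N" "real_of_int (- ?N - 1) \<le> of_int k" using b by linarith+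
    then have "k \<in> {- ?N - 1..?N}" by (simp only: of_int_le_iff atLeastAtMost_iff)
    then show "I \<in> ?I ` {- ?N - 1..?N}" using k by blast
  qed
  then show ?thesis by (rule finite_subset) simp
qed

text \<open>Round each coordinate of \<open>M * e\<close> to the nearest odd integer.\<close>

lemma rational_direction:
  fixes e :: "real^'d"
  assumes e: "norm e = 1" and M: "2 \<le> M"
  shows "\<exists>a :: int^'d. a \<in> direction_box (2 * M) \<and> near_sphere (2 * M) a \<and>
     (\<forall>i. \<bar>of_int (a $ i) - real M * e $ i\<bar> \<le> 1)"
proof -
  define a :: "int^'d" where "a = (\<chi> i. 2 * \<lfloor>real M * e $ i / 2\<rfloor> + 1)"
  let ?d = "real CARD('d)"
  have near: "\<bar>of_int (a $ i) - real M * e $ i\<bar> \<le> 1" for i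
  proof -
    have "of_int \<lfloor>real M * e $ i / 2\<rfloor> \<le> real M * e $ i / 2" "real M * e $ i / 2 < of_int \<lfloor>real M * e $ i / 2\<rfloor> + 1"
      by linarith+
    moreover have "real_of_int (a $ i) = 2 * of_int \<lfloor>real M * e $ i / 2\<rfloor> + 1" by (simp add: a_def)
    ultimately show ?thesis by linarith
  qed
  have ei: "\<bar>e $ i\<bar> \<le> 1" for i using component_le_norm_cart[of e i] e by simp
  have Mei: "\<bar>real M * e $ i\<bar> \<le> real M" for i
    using ei[of i] by (simp add: abs_mult mult_left_le)
  have box: "a \<in> direction_box (2 * M)"
    unfolding direction_box_def
  proof (intro CollectI allI conjI)
    fix i
    show "odd (a $ i)" by (simp add: a_def)
    have "\<bar>real_of_int (a $ i)\<bar> \<le> real M + 1" using near[of i] Mei[of i] by linarith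
    then have "\<bar>a $ i\<bar> \<le> int M + 1" by linarith
    then show "\<bar>a $ i\<bar> < int (2 * M)" using M by linarith
  qed
  define \<theta> where "\<theta> i = of_int (a $ i) - real M * e $ i" for i
  have "(\<Sum>i\<in>UNIV. (e $ i)\<^sup>2) = 1"
    using e by (simp add: norm_vec_def L2_set_def)
  moreover have "(real_of_int (a $ i))\<^sup>2 = (real M)\<^sup>2 * (e $ i)\<^sup>2 + (2 * (real M * e $ i) * \<theta> i + (\<theta> i)\<^sup>2)" for i
    by (simp add: \<theta>_def power2_eq_square algebra_simps)
  ultimately have sq: "real_of_int (\<Sum>i\<in>UNIV. (a $ i)\<^sup>2) = (real M)\<^sup>2 + (\<Sum>i\<in>UNIV. 2 * (real M * e $ i) * \<theta> i + (\<theta> i)\<^sup>2)"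
    by (simp add: sum.distrib sum_distrib_left[symmetric])
  have "\<bar>\<Sum>i\<in>UNIV. 2 * (real M * e $ i) * \<theta> i + (\<theta> i)\<^sup>2\<bar> \<le> (\<Sum>i\<in>(UNIV :: 'd set). 3 * real M)"
  proof (rule order_trans[OF sum_abs sum_mono])
    fix i
    have \<theta>: "\<bar>\<theta> i\<bar> \<le> 1" using near[of i] by (simp add: \<theta>_def)
    have "\<bar>2 * (real M * e $ i) * \<theta> i\<bar> = 2 * \<bar>real M * e $ i\<bar> * \<bar>\<theta> i\<bar>" by (simp add: abs_mult)
    also have "\<dots> \<le> (2 * real M) * 1" using Mei[of i] \<theta> by (intro mult_mono) auto
    finally have "\<bar>2 * (real M * e $ i) * \<theta> i\<bar> \<le> 2 * real M" by simp
    moreover have "(\<theta> i)\<^sup>2 \<le> 1" using \<theta> by (simp add: abs_square_le_1)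
    moreover have "0 \<le> (\<theta> i)\<^sup>2" "1 \<le> real M" using M by simp_all
    ultimately show "\<bar>2 * (real M * e $ i) * \<theta> i + (\<theta> i)\<^sup>2\<bar> \<le> 3 * real M" by linarith
  qed
  then have "\<bar>real_of_int (\<Sum>i\<in>UNIV. (a $ i)\<^sup>2) - (real M)\<^sup>2\<bar> \<le> 3 * ?d * real M"
    unfolding sq by simp
  then have "\<bar>real_of_int ((\<Sum>i\<in>UNIV. (a $ i)\<^sup>2) - (int M)\<^sup>2)\<bar> \<le> real_of_int (3 * int CARD('d) * int M)"
    by simp
  then have "\<bar>(\<Sum>i\<in>UNIV. (a $ i)\<^sup>2) - (int M)\<^sup>2\<bar> \<le> 3 * int CARD('d) * int M"
    by (simp only: of_int_abs[symmetric] of_int_le_iff)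
  then have "near_sphere (2 * M) a" by (simp add: near_sphere_def power2_eq_square abs_le_iff)
  then show ?thesis using box near by blast
qed

section \<open>Directions of high complexity\<close>

text \<open>Replacing \<open>e\<close> by the grid point \<open>a / M\<close> moves the difference of two projections by at most \<open>d * 2 ^ n / M \<le> 1\<close>, in units of \<open>\<delta>\<close>.
This is the reason for the choice \<open>M = 2 ^ (n + d)\<close>.\<close>

lemma collinear_pairs_close:
  fixes K :: "(int^'d) set"
  assumes K: "\<And>k i. k \<in> K \<Longrightarrow> 0 \<le> k $ i \<and> k $ i < 2 ^ n"
    and a: "\<And>i. \<bar>of_int (a $ i) - real (2 ^ (n + CARD('d))) * e $ i\<bar> \<le> 1"
  shows "{(x, y) \<in> same_cell s K. tube e x = tube e y} \<subseteq> close_pairs (int (2 * 2 ^ (n + CARD('d)))) s K a"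
proof clarify
  fix x y assume xy: "(x, y) \<in> same_cell s K" and t: "tube e x = tube e y"
  let ?M = "real (2 ^ (n + CARD('d)))" and ?d = "CARD('d)"
  let ?w = "\<lambda>i. real_of_int (x $ i - y $ i)"
  have mem: "x \<in> K" "y \<in> K" using xy by (auto simp: same_cell_def)
  have w: "\<bar>?w i\<bar> \<le> 2 ^ n" for i
  proof -
    have "\<bar>x $ i - y $ i\<bar> \<le> 2 ^ n" using K[OF mem(1), of i] K[OF mem(2), of i] by linarith
    then have "real_of_int \<bar>x $ i - y $ i\<bar> \<le> real_of_int (2 ^ n)" by (simp only: of_int_le_iff)
    then show ?thesis by simp
  qed
  have "(\<Sum>i\<in>UNIV. ?w i * e $ i) = (\<Sum>i\<in>UNIV. of_int (x $ i) * e $ i) - (\<Sum>i\<in>UNIV. of_int (y $ i) * e $ i)"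
    by (simp add: sum_subtractf[symmetric] algebra_simps)
  then have 1: "\<bar>\<Sum>i\<in>UNIV. ?w i * e $ i\<bar> \<le> 1" using t unfolding tube_def by linarith
  have "real_of_int (\<Sum>i\<in>UNIV. (x $ i - y $ i) * a $ i) =
      ?M * (\<Sum>i\<in>UNIV. ?w i * e $ i) + (\<Sum>i\<in>UNIV. ?w i * (of_int (a $ i) - ?M * e $ i))"
    by (simp add: sum_distrib_left sum.distrib[symmetric] algebra_simps del: of_nat_power)
  moreover have "\<bar>?M * (\<Sum>i\<in>UNIV. ?w i * e $ i)\<bar> \<le> ?M * 1"
    unfolding abs_mult by (intro mult_mono 1) auto
  moreover have "\<bar>\<Sum>i\<in>UNIV. ?w i * (of_int (a $ i) - ?M * e $ i)\<bar> \<le> (\<Sum>i\<in>(UNIV :: 'd set). 2 ^ n * 1)"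
    by (intro order_trans[OF sum_abs sum_mono]) (unfold abs_mult, intro mult_mono w a, auto)
  moreover have "real ?d * 2 ^ n \<le> ?M"
  proof -
    have "real ?d \<le> 2 ^ ?d" using less_exp[of ?d] by (metis less_imp_le of_nat_le_iff of_nat_numeral of_nat_power)
    then have "real ?d * 2 ^ n \<le> 2 ^ ?d * 2 ^ n" by (rule mult_right_mono) simp
    then show ?thesis by (simp add: power_add mult.commute)
  qed
  ultimately have "\<bar>real_of_int (\<Sum>i\<in>UNIV. (x $ i - y $ i) * a $ i)\<bar> \<le> 2 * ?M" by simp
  then have "\<bar>real_of_int (\<Sum>i\<in>UNIV. (x $ i - y $ i) * a $ i)\<bar> \<le> real_of_int (int (2 * 2 ^ (n + ?d)))" by simp
  then have "\<bar>\<Sum>i\<in>UNIV. (x $ i - y $ i) * a $ i\<bar> \<le> int (2 * 2 ^ (n + ?d))"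
    by (simp only: of_int_abs[symmetric] of_int_le_iff)
  then show "(x, y) \<in> close_pairs (int (2 * 2 ^ (n + ?d))) s K a"
    using xy by (auto simp: close_pairs_def same_cell_def)
qed

text \<open>The payload is a number in base \<open>B\<close> whose last three digits are \<open>n\<close>, \<open>m\<close> and \<open>t\<close>, preceded by the index \<open>j\<close>. The base is
computed from the length of the header, which is proportional to \<open>n\<close>.\<close>

definition described :: "nat \<Rightarrow> nat \<Rightarrow> nat \<Rightarrow> nat \<Rightarrow> nat \<Rightarrow> nat" where
  "described d k a w v = (let B = 4 * d * k * (a + 1) in
     decoder d (w div B div B mod B) (w div B mod B) (w mod B) (w div B div B div B) v)"

lemma prec_described: "prec (\<lambda>\<rho>. described d k (\<rho> 0) (\<rho> 1) (\<rho> 2))"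
  unfolding described_def Let_def by (intro prec_decoder prec_intros)

lemma described_packed:
  fixes B :: nat
  assumes "B = 4 * d * k * (a + 1)" "n < B" "m < B" "t < B"
  shows "described d k a (((j * B + n) * B + m) * B + t) v = decoder d n m t j v"
  unfolding described_def Let_def assms(1)[symmetric] using assms(2-4) by simp

lemma packed_less:
  fixes B :: nat
  assumes "n < B" "m < B" "t < B" "j < J"
  shows "((j * B + n) * B + m) * B + t < J * B ^ 3"
proof -
  have step: "x * B + y < X * B" if "x < X" "y < B" for x y X :: nat
  proof -
    have "x * B + y < Suc x * B" using that by simp
    also have "\<dots> \<le> X * B" using that by (intro mult_le_mono1) simp
    finally show ?thesis .
  qed
  have "((j * B + n) * B + m) * B + t < J * B * B * B" using assms by (intro step)
  then show ?thesis by (simp add: power3_eq_cube mult.assoc)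
qed

lemma power_two_bracket:
  assumes "1 \<le> (N :: nat)" shows "\<exists>t. 2 ^ t \<le> N \<and> N < 2 ^ Suc t"
  using ex_power_ivl1[of 2 N] assms by auto

text \<open>The constant in \<open>bad_directions_card\<close>.\<close>

definition counting_constant :: "nat \<Rightarrow> real" where
  "counting_constant d = real (14 * d + 4) * (real (4 * d + 27)) ^ d * (2 * 3 ^ d)"

text \<open>What "sufficiently small scale" means: the powers \<open>2 powr (\<epsilon> / 2 * n)\<close> and \<open>2 powr (\<epsilon> * n)\<close> absorb the polynomial
factors, and \<open>\<epsilon> / 2 * n\<close> bits absorb the constant overhead of the program.\<close>

definition large_scale :: "nat \<Rightarrow> nat \<Rightarrow> nat \<Rightarrow> real \<Rightarrow> nat \<Rightarrow> bool" where
  "large_scale d k c \<epsilon> n \<longleftrightarrow>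
     2 * counting_constant d * 2 ^ (d * d) * (real n + 1) * (4 * real d * real k * (real d * real n + 2)) ^ 3 \<le> 2 powr (\<epsilon> / 2 * real n) \<and>
     real c + real k + 1 < \<epsilon> / 2 * real n \<and>
     24 * real d * (real n + 1) \<le> 2 powr (\<epsilon> * real n)"

lemma eventually_large_scale:
  assumes "0 < \<epsilon>" shows "\<forall>\<^sub>F n in sequentially. large_scale d k c \<epsilon> n"
proof -
  have poly: "\<forall>\<^sub>F n in sequentially. C * (real n + 1) ^ 4 \<le> 2 powr (b * real n)" if "0 < b" for C b :: real
    using that by real_asymp
  define E where "E = 4 * real d * real k"
  define C where "C = 2 * counting_constant d * 2 ^ (d * d)"
  have C: "0 \<le> C" by (simp add: C_def counting_constant_def)
  have E: "0 \<le> E" by (simp add: E_def)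
  have bound: "C * (x + 1) * (E * (real d * x + 2)) ^ 3 \<le> C * (E * (real d + 2)) ^ 3 * (x + 1) ^ 4"
    if x: "0 \<le> x" for x
  proof -
    have "real d * x + 2 \<le> (real d + 2) * (x + 1)" using x by (simp add: algebra_simps)
    then have "(E * (real d * x + 2)) ^ 3 \<le> (E * ((real d + 2) * (x + 1))) ^ 3"
      using x E by (intro power_mono mult_left_mono) auto
    then have "C * (x + 1) * (E * (real d * x + 2)) ^ 3 \<le> C * (x + 1) * (E * ((real d + 2) * (x + 1))) ^ 3"
      using x C by (intro mult_left_mono) auto
    then show ?thesis by (simp add: power_mult_distrib power4_eq_xxxx power3_eq_cube mult_ac)
  qed
  have "\<forall>\<^sub>F n in sequentially. C * (E * (real d + 2)) ^ 3 * (real n + 1) ^ 4 \<le> 2 powr (\<epsilon> / 2 * real n)"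
    by (rule poly) (use assms in simp)
  moreover have "\<forall>\<^sub>F n in sequentially. real c + real k + 1 < \<epsilon> / 2 * real n"
    using assms by real_asymp
  moreover have "\<forall>\<^sub>F n in sequentially. 24 * real d * (real n + 1) ^ 4 \<le> 2 powr (\<epsilon> * real n)"
    by (rule poly) (rule assms)
  ultimately show ?thesis
  proof eventually_elim
    case (elim n)
    have "real n + 1 \<le> (real n + 1) ^ 4" by (rule self_le_power) auto
    then have "24 * real d * (real n + 1) \<le> 24 * real d * (real n + 1) ^ 4" by (intro mult_left_mono) auto
    then show ?case using elim bound[of "real n"] unfolding large_scale_def C_def[symmetric] E_def[symmetric] by linarith
  qed
qed

text \<open>For \<open>\<epsilon> \<ge> 1/8\<close> the right-hand side exceeds the number of all pairs. For \<open>\<epsilon> < 1/8\<close>, a violation of the bound makes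
the grid point near \<open>e\<close> a bad direction, with threshold \<open>2 ^ t\<close> the largest power of two that does not exceed its number of close
pairs. By \<open>bad_directions_card\<close> the index \<open>j\<close> is less than \<open>Z = 2 powr ((d - 1) * n - 4 * \<epsilon> * n)\<close> times a polynomial, so a
payload of \<open>k * h\<close> bits, about \<open>(d - 1) * n - 7/2 * \<epsilon> * n\<close>, has room for \<open>j\<close>, \<open>n\<close>, \<open>m\<close>, \<open>t\<close>. The header adds \<open>h\<close> bits, about \<open>\<epsilon> * n\<close> by
the choice of \<open>k\<close>, and the total stays below the assumed complexity.\<close>

lemma few_bad_pairs:
  fixes K :: "(int^'d::{finite,wellorder}) set" and e :: "real^'d::_"
  assumes d: "2 \<le> CARD('d)" and ks: "K = set ks" "K \<noteq> {}" and K: "\<And>k i. k \<in> K \<Longrightarrow> 0 \<le> k $ i \<and> k $ i < 2 ^ n"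
    and s: "1 < s" "s \<le> real CARD('d)" and \<epsilon>: "0 < \<epsilon>" and \<eta>: "0 < \<eta>"
    and F: "frostman n s (2 powr (real n * \<eta>)) K"
    and kc: "real CARD('d) \<le> real k * \<epsilon>"
    and bound: "\<And>a w. w < 2 ^ (k * a) \<Longrightarrow>
      kolm U A (nat_string (described CARD('d) k a w (list_encode (map (vec_code int_encode) ks)))) \<le> c + (k + 1) * a"
    and e: "norm e = 1" and n: "large_scale CARD('d) k c \<epsilon> n"
    and complex: "(real CARD('d) - 1) * real n - 2 * \<epsilon> * real n \<le> real (kolm_point U A n e)"
    and m: "m \<le> n"
  shows "real (card {(x, y) \<in> same_cell (2 ^ (n - m)) K. tube e x = tube e y}) \<le>
      2 powr (8 * real CARD('d) * (\<epsilon> + \<eta>) * real n) * 2 powr (- real n - (s - 1) * real m) * (real (card K))\<^sup>2"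
    (is "real (card ?P) \<le> ?B * ?S * _")
proof (cases "1 / 8 \<le> \<epsilon>")
  case True
  have finK: "finite K" using ks by simp
  have "card ?P \<le> card (K \<times> K)" by (rule card_mono) (auto simp: same_cell_def finK)
  then have "real (card ?P) \<le> real (card K * card K)" by (simp only: card_cartesian_product of_nat_le_iff)
  then have "real (card ?P) \<le> 1 * (real (card K))\<^sup>2" by (simp add: power2_eq_square)
  also have "\<dots> \<le> ?B * ?S * (real (card K))\<^sup>2"
  proof (intro mult_right_mono)
    have "real CARD('d) * 1 \<le> real CARD('d) * (8 * (\<epsilon> + \<eta>))" using True \<eta> by (intro mult_left_mono) auto
    then have "real CARD('d) * real n \<le> (8 * real CARD('d) * (\<epsilon> + \<eta>)) * real n"
      by (intro mult_right_mono) (auto simp: mult_ac)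
    moreover have "(s - 1) * real m \<le> (real CARD('d) - 1) * real n" using m s by (intro mult_mono) auto
    ultimately have "0 \<le> 8 * real CARD('d) * (\<epsilon> + \<eta>) * real n + (- real n - (s - 1) * real m)"
      by (simp add: algebra_simps)
    then have "1 \<le> 2 powr (8 * real CARD('d) * (\<epsilon> + \<eta>) * real n + (- real n - (s - 1) * real m))"
      by (intro ge_one_powr_ge_zero) auto
    then show "1 \<le> ?B * ?S" by (simp only: powr_add)
  qed simp
  finally show ?thesis .
next
  case False
  let ?d = "CARD('d)" and ?k = "real (card K)"
  let ?M = "2 ^ (n + ?d) :: nat"
  have finK: "finite K" using ks by simp
  show ?thesis
  proof (rule ccontr)
    assume contr: "\<not> ?thesis"
    have M2: "2 \<le> ?M" using d power_increasing[of 1 "n + ?d" "2::nat"] by simp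
    obtain a where a: "a \<in> direction_box (2 * ?M)" "near_sphere (2 * ?M) a"
      "\<And>i. \<bar>of_int (a $ i) - real ?M * e $ i\<bar> \<le> 1"
      using rational_direction[OF e M2] by blast
    define N where "N = card (close_pairs (int (2 * ?M)) (2 ^ (n - m)) K a)"
    have finC: "finite (close_pairs (int (2 * ?M)) (2 ^ (n - m)) K a)"
      by (rule finite_subset[of _ "K \<times> K"]) (auto simp: close_pairs_def finK)
    have "card ?P \<le> N" unfolding N_def by (rule card_mono[OF finC collinear_pairs_close[OF K a(3)]])
    then have N_gt: "?B * ?S * ?k\<^sup>2 < real N" using contr by linarith
    have NK: "N \<le> card (K \<times> K)" unfolding N_def by (rule card_mono) (auto simp: close_pairs_def finK)
    have kpos: "0 < ?k" using finK ks(2) by (simp add: card_gt_0_iff)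
    have "0 \<le> ?B * ?S * ?k\<^sup>2" by simp
    then have "0 < real N" using N_gt by linarith
    then have "1 \<le> N" by linarith
    then obtain t where t: "2 ^ t \<le> N" "N < 2 ^ Suc t" using power_two_bracket by blast
    have cardK: "card K \<le> 2 ^ (n * ?d)"
    proof -
      have "K \<subseteq> vec_lambda ` (UNIV \<rightarrow>\<^sub>E {0..<2 ^ n} :: ('d \<Rightarrow> int) set)"
      proof
        fix x assume "x \<in> K"
        then have "vec_nth x \<in> UNIV \<rightarrow>\<^sub>E {0..<2 ^ n}" using K by auto
        then show "x \<in> vec_lambda ` (UNIV \<rightarrow>\<^sub>E {0..<2 ^ n})" by (metis image_eqI vec_nth_inverse)
      qed
      then have "card K \<le> card (vec_lambda ` (UNIV \<rightarrow>\<^sub>E {0..<2 ^ n} :: ('d \<Rightarrow> int) set))"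
        by (rule card_mono[rotated]) (auto intro!: finite_imageI finite_PiE)
      also have "\<dots> \<le> card (UNIV \<rightarrow>\<^sub>E {0..<2 ^ n} :: ('d \<Rightarrow> int) set)"
        by (rule card_image_le) (auto intro!: finite_PiE)
      also have "\<dots> = (2 ^ n) ^ ?d" by (simp add: card_PiE nat_power_eq)
      finally show ?thesis by (simp add: power_mult)
    qed
    have t_le: "t \<le> 2 * ?d * n"
    proof -
      have "2 ^ t \<le> card K * card K" using t(1) NK by (simp add: card_cartesian_product)
      also have "\<dots> \<le> 2 ^ (n * ?d) * 2 ^ (n * ?d)" by (intro mult_le_mono cardK)
      finally have "(2::nat) ^ t \<le> 2 ^ (2 * ?d * n)" by (simp add: power_add[symmetric] mult_ac)
      then show ?thesis by (rule power_le_imp_le_exp[rotated]) simp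
    qed
    define bad where "bad = bad_directions (2 * ?M) (2 ^ (n - m)) (2 ^ t) K"
    have a_bad: "a \<in> bad" using a(1,2) t(1) by (simp add: bad_def bad_directions_def N_def)
    have gap: "\<bar>x $ i - y $ i\<bar> \<le> int ?M" if "x \<in> K" "y \<in> K" for x y i
    proof -
      have "\<bar>x $ i - y $ i\<bar> \<le> 2 ^ n" using K[OF that(1), of i] K[OF that(2), of i] by linarith
      also have "(2::int) ^ n \<le> 2 ^ (n + ?d)" by (rule power_increasing) auto
      finally show ?thesis by simp
    qed
    have card_bad: "real (card bad) * real (2 ^ t) * real ?M \<le>
      counting_constant ?d * real (n + 1) * real ?M ^ ?d * (2 powr (real n * \<eta>) * ?S * ?k\<^sup>2)"
      unfolding bad_def counting_constant_def using M2 by (intro bad_directions_card F finK m s gap) auto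
    define Z where "Z = 2 powr ((real ?d - 1) * real n - 4 * \<epsilon> * real n)"
    have bad_le: "real (card bad) \<le> 2 * counting_constant ?d * 2 ^ (?d * ?d) * (real n + 1) * Z"
    proof -
      let ?A = "2 powr (real n * \<eta>)" and ?\<kappa> = "counting_constant ?d"
      have \<kappa>: "0 \<le> ?\<kappa>" by (simp add: counting_constant_def)
      define \<nu> where "\<nu> = real (n + 1)"
      \<comment> \<open>The common factor of both sides, to be cancelled.\<close>
      define u where "u = ?S * ?k\<^sup>2 * real ?M / 2"
      have u: "0 < u" using kpos by (simp add: u_def)
      have "real N < real (2 ^ Suc t)" using t(2) by (simp only: of_nat_less_iff)
      then have "?B * ?S * ?k\<^sup>2 / 2 \<le> real (2 ^ t)" using N_gt by simp
      then have "real (card bad) * (?B * ?S * ?k\<^sup>2 / 2) * real ?M \<le> real (card bad) * real (2 ^ t) * real ?M"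
        by (intro mult_right_mono mult_left_mono) auto
      then have "real (card bad) * (?B * ?S * ?k\<^sup>2 / 2) * real ?M \<le>
          ?\<kappa> * \<nu> * real ?M ^ ?d * (?A * ?S * ?k\<^sup>2)" using card_bad unfolding \<nu>_def by (rule order_trans)
      moreover have "real ?M ^ ?d = real ?M * real ?M ^ (?d - 1)"
        using d by (simp add: power_eq_if)
      ultimately have "(real (card bad) * ?B) * u \<le> (2 * ?\<kappa> * \<nu> * real ?M ^ (?d - 1) * ?A) * u"
        by (simp add: u_def mult_ac)
      then have 1: "real (card bad) * ?B \<le> 2 * ?\<kappa> * \<nu> * real ?M ^ (?d - 1) * ?A"
        using u by (simp add: mult_le_cancel_right)
      have 2: "?A \<le> ?B * 2 powr (- 4 * \<epsilon> * real n)"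
      proof -
        have "4 * \<epsilon> + \<eta> \<le> 8 * real ?d * (\<epsilon> + \<eta>)"
        proof -
          have "4 * \<epsilon> + \<eta> \<le> 8 * 1 * (\<epsilon> + \<eta>)" using \<epsilon> \<eta> by simp
          also have "\<dots> \<le> 8 * real ?d * (\<epsilon> + \<eta>)" using d \<epsilon> \<eta> by (intro mult_right_mono) auto
          finally show ?thesis .
        qed
        then have "(4 * \<epsilon> + \<eta>) * real n \<le> 8 * real ?d * (\<epsilon> + \<eta>) * real n" by (rule mult_right_mono) simp
        then have "real n * \<eta> \<le> 8 * real ?d * (\<epsilon> + \<eta>) * real n + (- 4 * \<epsilon> * real n)"
          by (simp add: algebra_simps)
        then have "?A \<le> 2 powr (8 * real ?d * (\<epsilon> + \<eta>) * real n + (- 4 * \<epsilon> * real n))" by (rule powr_mono) simp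
        then show ?thesis by (simp only: powr_add)
      qed
      have 3: "real ?M ^ (?d - 1) \<le> 2 powr ((real ?d - 1) * real n) * 2 ^ (?d * ?d)"
      proof -
        have "(n + ?d) * (?d - 1) \<le> n * (?d - 1) + ?d * ?d" by (simp add: add_mult_distrib)
        then have "(2::real) ^ ((n + ?d) * (?d - 1)) \<le> 2 ^ (n * (?d - 1) + ?d * ?d)" by (rule power_increasing) simp
        moreover have "(2::real) ^ (n * (?d - 1)) = 2 powr ((real ?d - 1) * real n)"
          using d by (subst powr_realpow[symmetric]) (simp_all add: of_nat_diff mult.commute)
        moreover have "real ?M ^ (?d - 1) = 2 ^ ((n + ?d) * (?d - 1))"
          by (simp only: power_mult of_nat_power of_nat_numeral)
        ultimately show ?thesis by (simp only: power_add[of 2 "n * (?d - 1)"])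
      qed
      have "real (card bad) * ?B \<le> 2 * ?\<kappa> * \<nu> * (2 powr ((real ?d - 1) * real n) * 2 ^ (?d * ?d)) *
          (?B * 2 powr (- 4 * \<epsilon> * real n))"
        using \<kappa> by (intro order_trans[OF 1] mult_mono 2 3 mult_left_mono) (auto simp: \<nu>_def)
      also have "\<dots> = 2 * ?\<kappa> * 2 ^ (?d * ?d) * (real n + 1) *
          (2 powr ((real ?d - 1) * real n) * 2 powr (- 4 * \<epsilon> * real n)) * ?B"
        by (simp add: mult_ac \<nu>_def)
      also have "2 powr ((real ?d - 1) * real n) * 2 powr (- 4 * \<epsilon> * real n) = Z"
        by (simp add: Z_def powr_add[symmetric])
      finally show ?thesis by (simp add: mult_le_cancel_right)
    qed
    define h where "h = nat \<lceil>((real ?d - 1) - 7 / 2 * \<epsilon>) * real n / real k\<rceil>"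
    define B where "B = 4 * ?d * k * (h + 1)"
    have kpos': "0 < k" using kc \<epsilon> d by (cases k) auto
    have slope: "0 \<le> (real ?d - 1) - 7 / 2 * \<epsilon>" "1 / 2 \<le> (real ?d - 1) - 7 / 2 * \<epsilon>" using False d by auto
    define X where "X = ((real ?d - 1) - 7 / 2 * \<epsilon>) * real n / real k"
    have X0: "0 \<le> X" using slope by (simp add: X_def)
    have kX: "real k * X = ((real ?d - 1) - 7 / 2 * \<epsilon>) * real n" using kpos' by (simp add: X_def)
    have hX: "X \<le> real h" "real h \<le> X + 1"
      using X0 unfolding h_def X_def[symmetric] by linarith+
    have kh: "((real ?d - 1) - 7 / 2 * \<epsilon>) * real n \<le> real k * real h"
      "real k * real h \<le> ((real ?d - 1) - 7 / 2 * \<epsilon>) * real n + real k"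
      unfolding kX[symmetric] using mult_left_mono[OF hX(1), of "real k"] mult_left_mono[OF hX(2), of "real k"]
      by (simp_all add: distrib_left)
    have realB: "real B = 4 * real ?d * (real k * real h + real k)" by (simp add: B_def algebra_simps)
    have B_gt: "2 * ?d * n < B"
    proof -
      have "1 / 2 * real n \<le> ((real ?d - 1) - 7 / 2 * \<epsilon>) * real n" by (intro mult_right_mono slope) simp
      then have "1 / 2 * real n < real k * real h + real k" using kh(1) kpos' by linarith
      then have "4 * real ?d * (1 / 2 * real n) < real B"
        unfolding realB using d by (intro mult_strict_left_mono) auto
      then have "real (2 * ?d * n) < real B" by (simp add: mult_ac)
      then show ?thesis by (simp only: of_nat_less_iff)
    qed
    have Xd: "X \<le> real ?d * real n"
    proof -
      have "((real ?d - 1) - 7 / 2 * \<epsilon>) * real n \<le> real ?d * real n" using \<epsilon> by (intro mult_right_mono) auto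
      also have "\<dots> = real ?d * real n * 1" by simp
      also have "\<dots> \<le> real ?d * real n * real k" using kpos' by (intro mult_left_mono) auto
      finally show ?thesis using kpos' by (simp add: X_def pos_divide_le_eq)
    qed
    have B_le: "real B \<le> 4 * real ?d * real k * (real ?d * real n + 2)"
    proof -
      have "real B = 4 * real ?d * real k * (real h + 1)" by (simp add: B_def algebra_simps)
      also have "\<dots> \<le> 4 * real ?d * real k * (real ?d * real n + 2)" using hX(2) Xd by (intro mult_left_mono) auto
      finally show ?thesis .
    qed
    have room: "real (card bad) * real B ^ 3 \<le> 2 ^ (k * h)"
    proof -
      have "real (card bad) * real B ^ 3 \<le> (2 * counting_constant ?d * 2 ^ (?d * ?d) * (real n + 1) * Z) *
          (4 * real ?d * real k * (real ?d * real n + 2)) ^ 3"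
        by (intro mult_mono bad_le power_mono B_le) (auto simp: counting_constant_def Z_def)
      also have "\<dots> = (2 * counting_constant ?d * 2 ^ (?d * ?d) * (real n + 1) *
          (4 * real ?d * real k * (real ?d * real n + 2)) ^ 3) * Z" by (simp only: mult_ac)
      also have "\<dots> \<le> 2 powr (\<epsilon> / 2 * real n) * Z"
        using n by (intro mult_right_mono) (auto simp: large_scale_def Z_def)
      also have "\<dots> = 2 powr (((real ?d - 1) - 7 / 2 * \<epsilon>) * real n)"
        by (simp add: Z_def powr_add[symmetric] algebra_simps)
      also have "\<dots> \<le> 2 powr (real (k * h))" using kh(1) by (intro powr_mono) auto
      also have "\<dots> = 2 ^ (k * h)" by (rule powr_realpow) simp
      finally show ?thesis .
    qed
    have n_large: "real c + real k + 1 < \<epsilon> / 2 * real n" using n by (simp add: large_scale_def)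
    have len: "real (c + (k + 1) * h) < (real ?d - 1) * real n - 2 * \<epsilon> * real n"
    proof -
      have "X \<le> \<epsilon> * real n"
      proof -
        have "((real ?d - 1) - 7 / 2 * \<epsilon>) * real n \<le> real k * \<epsilon> * real n"
          using kc \<epsilon> by (intro mult_right_mono) auto
        then show ?thesis using kpos' by (simp add: X_def pos_divide_le_eq mult_ac)
      qed
      moreover have "real (c + (k + 1) * h) = real c + real k * real h + real h" by (simp add: algebra_simps)
      ultimately have "real (c + (k + 1) * h) \<le> real c + real k + 1 +
          (((real ?d - 1) - 7 / 2 * \<epsilon>) * real n + \<epsilon> * real n)" using kh(2) hX(2) by linarith
      also have "\<dots> < (real ?d - 1) * real n - 2 * \<epsilon> * real n"
        using n_large by (simp add: algebra_simps)
      finally show ?thesis .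
    qed
    obtain j where j: "j < card bad" and dec: "decoder ?d n m t j (list_encode (map (vec_code int_encode) ks)) =
      vec_code rat_code (\<chi> i. (of_int (a $ i) / 2 ^ (n + ?d) :: rat))"
      using decoder_selects[of ks a n m t] a_bad K unfolding bad_def ks(1) by auto
    define w where "w = ((j * B + n) * B + m) * B + t"
    have "1 * n \<le> (2 * ?d) * n" using d by (intro mult_le_mono1) simp
    then have small: "n < B" "m < B" "t < B" using B_gt t_le m by linarith+
    have "w < card bad * B ^ 3" unfolding w_def by (rule packed_less[OF small j])
    also have "\<dots> \<le> 2 ^ (k * h)"
    proof -
      have "real (card bad * B ^ 3) \<le> real (2 ^ (k * h))" using room by simp
      then show ?thesis by (simp only: of_nat_le_iff)
    qed
    finally have "w < 2 ^ (k * h)" .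
    from bound[OF this]
    have kolm: "kolm_rat U A (\<chi> i. (of_int (a $ i) / 2 ^ (n + ?d) :: rat)) \<le> c + (k + 1) * h"
      unfolding w_def described_packed[OF B_def small] dec kolm_rat_def .
    have "norm ((\<chi> i. of_rat ((\<chi> i. (of_int (a $ i) / 2 ^ (n + ?d) :: rat)) $ i)) - e) < dyadic_scale n"
      (is "norm ?v < _")
    proof -
      have "\<bar>?v $ i\<bar> \<le> 1 / real ?M" for i
      proof -
        have "?v $ i = (of_int (a $ i) - real ?M * e $ i) / real ?M"
          by (simp add: of_rat_divide of_rat_power field_simps)
        then show ?thesis using a(3)[of i] by (simp add: divide_right_mono)
      qed
      then have "norm ?v \<le> real ?d * (1 / real ?M)" by (rule norm_le_card_bound)
      also have "\<dots> < 2 ^ ?d * (1 / real ?M)"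
      proof (rule mult_strict_right_mono)
        show "real ?d < 2 ^ ?d" using less_exp[of ?d] by (metis of_nat_less_iff of_nat_numeral of_nat_power)
      qed simp
      also have "\<dots> = dyadic_scale n" by (simp add: dyadic_scale_def power_add power_one_over)
      finally show ?thesis .
    qed
    then have "kolm_point U A n e \<le> kolm_rat U A (\<chi> i. (of_int (a $ i) / 2 ^ (n + ?d) :: rat))"
      unfolding kolm_point_def by (intro Least_le) blast
    then have "real (kolm_point U A n e) \<le> real (c + (k + 1) * h)" using kolm by linarith
    then show False using complex len by linarith
  qed
qed


theorem theorem3p3:
  fixes U \<Phi> :: tm and s :: real
  assumes "universal_prefix_tm U" and "oracle_tm \<Phi>"
    and "CARD('d::{finite,wellorder}) \<ge> 2"
    and "1 < s" and "s \<le> real CARD('d::{finite,wellorder})"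
  shows "\<exists>c1>0. \<exists>c2>0. \<exists>C1\<ge>0. \<exists>C2\<ge>0.
    \<forall>\<epsilon>\<in>{0<..<s - 1}. \<forall>\<eta>\<in>{0<..<s - 1}.
    \<exists>\<omega> :: nat \<Rightarrow> real. \<omega> \<longlonglongrightarrow> 0 \<and>
    (\<forall>\<^sub>F n in sequentially.
      \<forall>(P :: (real^'d::{finite,wellorder}) set set) (A :: oracle_seq).
        dsc_family n s (dyadic_scale n powr (- \<eta>)) P \<and> \<Union>P \<subseteq> cbox 0 1 \<and>
        decodes_data \<Phi> A n P s \<epsilon> \<eta> \<longrightarrow>
        (\<forall>e :: real^'d::{finite,wellorder}. norm e = 1 \<and>
            real (kolm_point U A n e) \<ge> (real CARD('d::{finite,wellorder}) - 1) * real n - 2 * \<epsilon> * real n \<longrightarrow>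
          real (card {I \<in> dyadic_intervals n.
              \<exists>P2 \<subseteq> {Q \<in> P. Q \<inter> {x. x \<bullet> e \<in> I} \<noteq> {}}.
                dsc_family n (s - 1) (dyadic_scale n powr (- (C2 * (\<epsilon> + \<eta>)))) P2 \<and>
                real (card P2) \<ge> c2 * dyadic_scale n powr (1 + \<omega> n) * real (card P)})
          \<ge> c1 * dyadic_scale n powr (- 1 + C1 * (\<epsilon> + \<eta>))))"
proof -
  let ?d = "CARD('d)"
  \<comment> \<open>The summand 1 absorbs the factors that are polynomial in \<open>n\<close>.\<close>
  define D where "D = 8 * real ?d + 1"
  have main: "real (card {I \<in> dyadic_intervals n.
              \<exists>P2 \<subseteq> {Q \<in> P. Q \<inter> {x. x \<bullet> e \<in> I} \<noteq> {}}.
                dsc_family n (s - 1) (dyadic_scale n powr (- (D * (\<epsilon> + \<eta>)))) P2 \<and>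
                real (card P2) \<ge> 1 / (12 * real ?d) * dyadic_scale n powr (1 + 0) * real (card P)})
          \<ge> 1 * dyadic_scale n powr (- 1 + D * (\<epsilon> + \<eta>))" (is "real (card ?S) \<ge> _")
    if \<epsilon>: "0 < \<epsilon>" and \<eta>: "0 < \<eta>" and kc: "real ?d \<le> real k * \<epsilon>"
      and bound: "\<And>A v a w. tm_outputs_at \<Phi> A 1 0 v \<Longrightarrow> w < 2 ^ (k * a) \<Longrightarrow>
        kolm U A (nat_string (described ?d k a w v)) \<le> c + (k + 1) * a"
      and n: "large_scale ?d k c \<epsilon> n"
      and P: "dsc_family n s (dyadic_scale n powr (- \<eta>)) P" "\<Union>P \<subseteq> cbox 0 1" "decodes_data \<Phi> A n P s \<epsilon> \<eta>"
      and e: "norm e = 1" "(real ?d - 1) * real n - 2 * \<epsilon> * real n \<le> real (kolm_point U A n e)"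
    for \<epsilon> \<eta> :: real and k c n :: nat and P :: "(real^'d::_) set set" and A e
  proof -
    obtain ks where ks: "tm_outputs_at \<Phi> A 1 0 (list_encode (map (vec_code int_encode) ks))"
      "P = dyadic_cube n ` set ks" using P(3) by (auto simp: decodes_data_def)
    define K where "K = set ks"
    have finK: "finite K" by (simp add: K_def)
    have PK: "P = dyadic_cube n ` K" by (simp add: K_def ks(2))
    have KF: "K \<noteq> {}" "frostman n s (2 powr (real n * \<eta>)) K"
      using P(1) unfolding PK dsc_family_iff_frostman[OF finK] dyadic_scale_powr by auto
    have box: "0 \<le> x $ i \<and> x $ i < 2 ^ n" if "x \<in> K" for x i
      using that P(2) unfolding PK by (intro cube_in_unit_box) auto
    define B where "B = 2 powr (8 * real ?d * (\<epsilon> + \<eta>) * real n)"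
    define B' where "B' = 2 * real (n + 1) * B"
    have E: "real (card {(x, y) \<in> same_cell (2 ^ (n - m)) K. tube e x = tube e y}) \<le>
      B * 2 powr (- real n - (s - 1) * real m) * (real (card K))\<^sup>2" if "m \<le> n" for m
      unfolding B_def using assms KF box \<epsilon> \<eta> kc bound[OF ks(1)] e n that
      by (intro few_bad_pairs[where ks = ks and k = k and c = c and U = U and A = A]) (auto simp: K_def)
    have ei: "\<bar>e $ i\<bar> \<le> 1" for i using component_le_norm_cart[of e i] e(1) by simp
    have B: "0 < B" "2 * real (n + 1) * B \<le> B'" by (simp_all add: B_def B'_def)
    obtain L G where LG: "finite L" "2 ^ n / (4 * B') \<le> real (card L)"
      "\<And>l. l \<in> L \<Longrightarrow> G l \<subseteq> {k \<in> K. tube e k = l}"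
      "\<And>l. l \<in> L \<Longrightarrow> real (card K) \<le> 12 * real ?d * 2 ^ n * real (card (G l))"
      "\<And>l. l \<in> L \<Longrightarrow> frostman n (s - 1) (12 * real ?d * B') (G l)"
      using rich_tubes[OF finK KF(1) box ei B E] by blast
    define J where "J l = {of_int l * dyadic_scale n ..< (of_int l + 1) * dyadic_scale n}" for l :: int
    have injJ: "inj J"
    proof (rule injI)
      fix l l' assume eq: "J l = J l'"
      have mem: "of_int i * dyadic_scale n \<in> J i'\<longleftrightarrow> i = i'" for i i'
        using dyadic_scale_pos[of n] by (auto simp: J_def mult_le_cancel_right mult_less_cancel_right)
      show "l = l'" using eq mem[of l l] mem[of l l'] by simp
    qed
    have small: "24 * real ?d * (real n + 1) \<le> 2 powr ((\<epsilon> + \<eta>) * real n)"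
    proof -
      have "24 * real ?d * (real n + 1) \<le> 2 powr (\<epsilon> * real n)" using n by (simp add: large_scale_def)
      also have "\<dots> \<le> 2 powr ((\<epsilon> + \<eta>) * real n)" using \<eta> by (intro powr_mono mult_right_mono) auto
      finally show ?thesis .
    qed
    have powD: "2 powr ((\<epsilon> + \<eta>) * real n) * B = 2 powr (D * (\<epsilon> + \<eta>) * real n)"
      by (simp add: B_def D_def powr_add[symmetric] algebra_simps)
    have const: "12 * real ?d * B' \<le> dyadic_scale n powr (- (D * (\<epsilon> + \<eta>)))"
    proof -
      have "12 * real ?d * B' = 24 * real ?d * (real n + 1) * B" by (simp add: B'_def)
      also have "\<dots> \<le> 2 powr ((\<epsilon> + \<eta>) * real n) * B" using small B(1) by (intro mult_right_mono) auto
      also have "\<dots> = dyadic_scale n powr (- (D * (\<epsilon> + \<eta>)))"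
        unfolding powD dyadic_scale_powr by (simp add: mult_ac)
      finally show ?thesis .
    qed
    have finS: "finite ?S"
    proof (rule finite_subset[OF _ finite_intervals_meeting[OF P(2) e(1), of n]])
      show "?S \<subseteq> {I \<in> dyadic_intervals n. \<exists>Q\<in>P. Q \<inter> {x. x \<bullet> e \<in> I} \<noteq> {}}"
        by (fastforce simp: dsc_family_def dsc_set_def)
    qed
    have "J ` L \<subseteq> ?S"
    proof (rule image_subsetI)
      fix l assume l: "l \<in> L"
      have finG: "finite (G l)" using LG(3)[OF l] finK by (auto intro: finite_subset)
      have cardG: "card (dyadic_cube n ` G l) = card (G l)" "card P = card K"
        unfolding PK by (rule card_image, metis inj_dyadic_cube inj_on_subset subset_UNIV)+
      have "0 < real (card K)" using finK KF(1) by (simp add: card_gt_0_iff)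
      then have "G l \<noteq> {}" using LG(4)[OF l] by auto
      moreover have "frostman n (s - 1) (dyadic_scale n powr (- (D * (\<epsilon> + \<eta>)))) (G l)"
        using frostman_mono[OF LG(5)[OF l] const] .
      ultimately have "dsc_family n (s - 1) (dyadic_scale n powr (- (D * (\<epsilon> + \<eta>)))) (dyadic_cube n ` G l)"
        by (simp add: dsc_family_iff_frostman[OF finG])
      moreover have "1 / (12 * real ?d) * dyadic_scale n powr (1 + 0) * real (card P) \<le> real (card (dyadic_cube n ` G l))"
      proof -
        have "dyadic_scale n * real (card K) \<le> dyadic_scale n * (12 * real ?d * 2 ^ n * real (card (G l)))"
          using LG(4)[OF l] dyadic_scale_pos[of n] by (intro mult_left_mono) auto
        also have "\<dots> = (dyadic_scale n * 2 ^ n) * (12 * real ?d * real (card (G l)))" by (simp only: mult_ac)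
        finally have "dyadic_scale n * real (card K) \<le> 12 * real ?d * real (card (G l))"
          by (simp add: dyadic_scale_inverse)
        then show ?thesis unfolding cardG using dyadic_scale_pos[of n] by (simp add: pos_divide_le_eq mult_ac)
      qed
      moreover have "dyadic_cube n ` G l \<subseteq> {Q \<in> P. Q \<inter> {x. x \<bullet> e \<in> J l} \<noteq> {}}"
        using LG(3)[OF l] cube_meets_tube[of n _ e] unfolding PK J_def by fastforce
      moreover have "J l \<in> dyadic_intervals n" by (auto simp: dyadic_intervals_def J_def)
      ultimately show "J l \<in> ?S" by blast
    qed
    then have "card (J ` L) \<le> card ?S" by (rule card_mono[OF finS])
    moreover have "card (J ` L) = card L" by (rule card_image) (metis injJ inj_on_subset subset_UNIV)
    ultimately have "real (card L) \<le> real (card ?S)" by simp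
    moreover have "dyadic_scale n powr (- 1 + D * (\<epsilon> + \<eta>)) \<le> 2 ^ n / (4 * B')"
    proof -
      have "8 * (real n + 1) \<le> (24 * real ?d) * (real n + 1)" using assms(3) by (intro mult_right_mono) auto
      then have "8 * (real n + 1) \<le> 2 powr ((\<epsilon> + \<eta>) * real n)" using small by linarith
      then have "8 * (real n + 1) * B \<le> 2 powr ((\<epsilon> + \<eta>) * real n) * B"
        using B(1) by (intro mult_right_mono) auto
      moreover have "4 * B' = 8 * (real n + 1) * B" by (simp add: B'_def)
      ultimately have "4 * B' \<le> 2 powr ((\<epsilon> + \<eta>) * real n) * B" by (simp only:)
      then have "2 ^ n / (2 powr ((\<epsilon> + \<eta>) * real n) * B) \<le> 2 ^ n / (4 * B')"
        using B by (intro divide_left_mono) (auto simp: B'_def intro!: mult_pos_pos)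
      moreover have "dyadic_scale n powr (- 1 + D * (\<epsilon> + \<eta>)) = 2 ^ n / (2 powr ((\<epsilon> + \<eta>) * real n) * B)"
      proof -
        have "- real n * (- 1 + D * (\<epsilon> + \<eta>)) = real n - D * (\<epsilon> + \<eta>) * real n" by (simp add: algebra_simps)
        then show ?thesis unfolding powD dyadic_scale_powr by (simp add: powr_diff powr_realpow)
      qed
      ultimately show ?thesis by simp
    qed
    ultimately show ?thesis using LG(2) by linarith
  qed
  show ?thesis
  proof (rule exI[of _ 1], rule conjI, simp, rule exI[of _ "1 / (12 * real ?d)"], rule conjI, simp,
      rule exI[of _ D], rule conjI, simp add: D_def, rule exI[of _ D], rule conjI, simp add: D_def,
      intro ballI, goal_cases)
    case (1 \<epsilon> \<eta>)
    then have \<epsilon>: "0 < \<epsilon>" and \<eta>: "0 < \<eta>" by auto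
    define k where "k = nat \<lceil>real ?d / \<epsilon>\<rceil>"
    have "real ?d / \<epsilon> \<le> real k" unfolding k_def by linarith
    then have kc: "real ?d \<le> real k * \<epsilon>" using \<epsilon> by (simp add: pos_divide_le_eq)
    obtain c where bound: "\<And>A v a w. tm_outputs_at \<Phi> A 1 0 v \<Longrightarrow> w < 2 ^ (k * a) \<Longrightarrow>
        kolm U A (nat_string (described ?d k a w v)) \<le> c + (k + 1) * a"
      using kolm_upper_bound[OF assms(1,2) prec_described] by blast
    show ?case
      by (rule exI[of _ "\<lambda>_. 0"], rule conjI, rule tendsto_const,
          rule eventually_mono[OF eventually_large_scale[OF \<epsilon>, of ?d k c]])
        (use main[OF \<epsilon> \<eta> kc bound] in blast)
  qed
qed

end
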